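(* Assume the Weak Schanuel Conjecture. Let $K/\mathbb{Q}$ be a real Galois number field with Galois group $G$ and log unit lattice $\Lambda_K$. Let $u\in\mathcal{O}_K^\times$ be a weak Minkowski unit and $v=\mathrm{Log}(u)$. Then the bilinear form \[\mathfrak{Gr}_v:R_\mathbb{C}\times R_\mathbb{C}\to\mathbb{C},\quad \mathfrak{Gr}_v(\alpha,\beta)=\langle\alpha v,\beta v\rangle\] is a $\overline{\mathbb{Q}}$-generic point of the variety $\mathrm{Sym}^G(R_\mathbb{C})$ (the base change to $\mathbb{C}$ of the $\overline{\mathbb{Q}}$-variety $\mathrm{Sym}^G(R_{\overline{\mathbb{Q}}})$).
   Context: Weak Schanuel Conjecture: if $\ell_1,\dots,\ell_m\in\mathbb{C}$ are $\mathbb{Q}$-linearly independent logarithms of algebraic numbers, then they are algebraically independent. For a field $F$, $R_F=F[G]/(N_G)$ with $N_G=\sum_{g\in G}g$, and $\mathrm{Sym}^G(R_F)$ is the affine $F$-variety of symmetric $F$-bilinear forms $\mathfrak{b}$ on $R_F$ with $\mathfrak{b}(g\alpha,g\beta)=\mathfrak{b}(\alpha,\beta)$ for all $g\in G$. Fix a real embedding $\iota$ of $K$ and write $\mathrm{Log}(u)=(\log|\iota(h(u))|)_{h\in G}\in\mathbb{R}^n\subset\mathbb{C}^n$, $n=|G|$; $G$ acts on $\mathbb{C}^n$ by $(g\cdot x)_h=x_{hg}$, so $\mathrm{Log}(g(u))=g\cdot\mathrm{Log}(u)$, and this extends to an action of $R_\mathbb{C}$ on the hyperplane $\sum x_h=0$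 containing $v$. $\langle x,y\rangle=\sum_h x_hy_h$. A weak Minkowski unit is a unit whose Galois conjugates generate a finite-index subgroup of $\mathcal{O}_K^\times$. A point $p$ of $X_\mathbb{C}$ (base change of an irreducible $\overline{\mathbb{Q}}$-variety $X_{\overline{\mathbb{Q}}}$) is $\overline{\mathbb{Q}}$-generic if its image under the base change map $X_\mathbb{C}\to X_{\overline{\mathbb{Q}}}$ is Zariski-dense, i.e. $p$ lies in no proper Zariski-closed subset defined over $\overline{\mathbb{Q}}$. *)

theory Defs
  imports
    Complex_Main
    "HOL-Library.Poly_Mapping"
    "HOL-Computational_Algebra.Polynomial"
    "HOL-Algebra.Generated_Groups"
    "HOL-Algebra.QuotRing"
begin

subsection \<open>Multivariate polynomials, algebraic independence, Weak Schanuel Conjecture\<close>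

text \<open>A polynomial in variables of type \<open>'v\<close> is a finitely supported map from monomials
  (finitely supported exponent vectors) to coefficients.\<close>

type_synonym ('v, 'c) mpol = "('v \<Rightarrow>\<^sub>0 nat) \<Rightarrow>\<^sub>0 'c"

definition mpol_eval :: "('v \<Rightarrow> 'c::comm_ring_1) \<Rightarrow> ('v, 'c) mpol \<Rightarrow> 'c" where
  "mpol_eval x p =
     (\<Sum>m\<in>Poly_Mapping.keys p. Poly_Mapping.lookup p m *
        (\<Prod>i\<in>Poly_Mapping.keys m. x i ^ Poly_Mapping.lookup m i))"

definition mpols_over :: "'c::comm_ring_1 set \<Rightarrow> 'v set \<Rightarrow> ('v, 'c) mpol set" where
  "mpols_over k I =
     {p. (\<forall>m. Poly_Mapping.lookup p m \<in> k) \<and>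
         (\<forall>m\<in>Poly_Mapping.keys p. Poly_Mapping.keys m \<subseteq> I)}"

definition alg_independent :: "'c::comm_ring_1 set \<Rightarrow> 'v set \<Rightarrow> ('v \<Rightarrow> 'c) \<Rightarrow> bool" where
  "alg_independent k I x \<longleftrightarrow> (\<forall>p\<in>mpols_over k I. mpol_eval x p = 0 \<longrightarrow> p = 0)"

definition rat_lin_independent :: "'v set \<Rightarrow> ('v \<Rightarrow> 'c::field_char_0) \<Rightarrow> bool" where
  "rat_lin_independent I x \<longleftrightarrow>
     (\<forall>c :: 'v \<Rightarrow> rat. (\<Sum>i\<in>I. of_rat (c i) * x i) = 0 \<longrightarrow> (\<forall>i\<in>I. c i = 0))"

definition weak_schanuel_conjecture :: bool where
  "weak_schanuel_conjecture \<longleftrightarrow>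
     (\<forall>(m::nat) (l :: nat \<Rightarrow> complex).
        (\<forall>i<m. algebraic (exp (l i))) \<and> rat_lin_independent {..<m} l
        \<longrightarrow> alg_independent \<rat> {..<m} l)"

definition Qbar :: "complex set" where
  "Qbar = {z. algebraic z}"


subsection \<open>Galois number fields and their units\<close>

definition is_ring_hom :: "('a::ring_1 \<Rightarrow> 'b::ring_1) \<Rightarrow> bool" where
  "is_ring_hom f \<longleftrightarrow>
     f 1 = 1 \<and> (\<forall>x y. f (x + y) = f x + f y) \<and> (\<forall>x y. f (x * y) = f x * f y)"

definition number_field :: "'k::field_char_0 itself \<Rightarrow> bool" where
  "number_field _ \<longleftrightarrow>
     (\<exists>B :: 'k set. finite B \<and> module.span (\<lambda>(q::rat) (x::'k). of_rat q * x) B = UNIV)"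

text \<open>Field automorphisms in characteristic 0 fix \<open>\<rat>\<close>, so this is the
  automorphism group of \<open>K\<close> over \<open>\<rat>\<close>.\<close>

definition gal_group :: "'k::field_char_0 itself \<Rightarrow> ('k \<Rightarrow> 'k) monoid" where
  "gal_group _ = \<lparr>carrier = {\<sigma>. bij \<sigma> \<and> is_ring_hom \<sigma>}, mult = (\<circ>), one = id\<rparr>"

definition galois_over_rat :: "'k::field_char_0 itself \<Rightarrow> bool" where
  "galois_over_rat K \<longleftrightarrow> {x. \<forall>\<sigma>\<in>carrier (gal_group K). \<sigma> x = x} = \<rat>"

definition integer_units :: "'k::field_char_0 itself \<Rightarrow> 'k monoid" where
  "integer_units _ =
     \<lparr>carrier = {x. x \<noteq> 0 \<and> algebraic_int x \<and> algebraic_int (inverse x)},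
      mult = (*), one = 1\<rparr>"

definition weak_minkowski_unit :: "'k::field_char_0 \<Rightarrow> bool" where
  "weak_minkowski_unit u \<longleftrightarrow>
     (let U = integer_units TYPE('k) in
        u \<in> carrier U \<and>
        finite (rcosets\<^bsub>U\<^esub> (generate U {\<sigma> u | \<sigma>. \<sigma> \<in> carrier (gal_group TYPE('k))})))"


subsection \<open>The ring \<open>F[G]/(N\<^sub>G)\<close> for a finite group \<open>G\<close>\<close>

definition group_ring :: "'g monoid \<Rightarrow> ('g \<Rightarrow> 'f::field) ring" where
  "group_ring G =
     \<lparr>carrier = {a. \<forall>g. g \<notin> carrier G \<longrightarrow> a g = 0},
      mult = (\<lambda>a b g. if g \<in> carrier G
                then \<Sum>h\<in>carrier G. a h * b (inv\<^bsub>G\<^esub> h \<otimes>\<^bsub>G\<^esub> g) else 0),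
      one = (\<lambda>g. if g = \<one>\<^bsub>G\<^esub> then 1 else 0),
      zero = (\<lambda>g. 0),
      add = (\<lambda>a b g. a g + b g)\<rparr>"

definition norm_elt :: "'g monoid \<Rightarrow> 'g \<Rightarrow> 'f::field" where
  "norm_elt G = (\<lambda>g. if g \<in> carrier G then 1 else 0)"

definition norm_ideal :: "'g monoid \<Rightarrow> ('g \<Rightarrow> 'f::field) set" where
  "norm_ideal G = Idl\<^bsub>group_ring G\<^esub> {norm_elt G}"

definition R_ring :: "'g monoid \<Rightarrow> ('g \<Rightarrow> 'f::field) set ring" where
  "R_ring G = group_ring G Quot norm_ideal G"

text \<open>\<open>R_single G c g\<close> is the class of \<open>c g\<close> in \<open>F[G]/(N\<^sub>G)\<close>.\<close>

definition R_single :: "'g monoid \<Rightarrow> 'f::field \<Rightarrow> 'g \<Rightarrow> ('g \<Rightarrow> 'f) set" where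
  "R_single G c g = norm_ideal G +>\<^bsub>group_ring G\<^esub> (\<lambda>h. if h = g then c else 0)"


subsection \<open>Invariant symmetric bilinear forms\<close>

type_synonym ('g, 'f) R_form = "('g \<Rightarrow> 'f) set \<Rightarrow> ('g \<Rightarrow> 'f) set \<Rightarrow> 'f"

text \<open>Scalars \<open>c\<close> act on \<open>R_ring G\<close> through the classes of \<open>c 1\<^sub>G\<close>.  Values of a form
  outside the carrier are irrelevant.  By symmetry, linearity in the first argument is
  bilinearity.\<close>

definition sym_forms :: "'g monoid \<Rightarrow> ('g, 'f::field) R_form set" where
  "sym_forms G =
     {b. (\<forall>A\<in>carrier (R_ring G). \<forall>B\<in>carrier (R_ring G). b A B = b B A) \<and>
         (\<forall>A\<in>carrier (R_ring G). \<forall>A'\<in>carrier (R_ring G). \<forall>B\<in>carrier (R_ring G).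
            b (A \<oplus>\<^bsub>R_ring G\<^esub> A') B = b A B + b A' B) \<and>
         (\<forall>c. \<forall>A\<in>carrier (R_ring G). \<forall>B\<in>carrier (R_ring G).
            b (R_single G c \<one>\<^bsub>G\<^esub> \<otimes>\<^bsub>R_ring G\<^esub> A) B = c * b A B) \<and>
         (\<forall>g\<in>carrier G. \<forall>A\<in>carrier (R_ring G). \<forall>B\<in>carrier (R_ring G).
            b (R_single G 1 g \<otimes>\<^bsub>R_ring G\<^esub> A) (R_single G 1 g \<otimes>\<^bsub>R_ring G\<^esub> B) = b A B)}"

text \<open>The classes of the group elements span \<open>R_ring G\<close> over every field, in particular they
  span its \<open>\<rat>\<close>-structure; so for a subfield \<open>k\<close> of \<open>F\<close> the coordinate ring of
  \<open>sym_forms\<close> over \<open>k\<close> is generated over \<open>k\<close> by the following coordinates,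
  indexed by pairs of group elements.\<close>

definition form_coords :: "'g monoid \<Rightarrow> ('g, 'f::field) R_form \<Rightarrow> 'g \<times> 'g \<Rightarrow> 'f" where
  "form_coords G b = (\<lambda>(g, h). b (R_single G 1 g) (R_single G 1 h))"

text \<open>\<open>X\<close> is the set of points of an affine variety whose coordinate functions
  \<open>\<lambda>x. \<phi> x i\<close>, \<open>i \<in> I\<close>, generate its coordinate ring over the field of definition \<open>k\<close>.\<close>

definition zariski_closed_over ::
  "'c::field set \<Rightarrow> 'v set \<Rightarrow> ('x \<Rightarrow> 'v \<Rightarrow> 'c) \<Rightarrow> 'x set \<Rightarrow> 'x set \<Rightarrow> bool" where
  "zariski_closed_over k I \<phi> X Z \<longleftrightarrow>
     (\<exists>S \<subseteq> mpols_over k I. Z = {x \<in> X. \<forall>p\<in>S. mpol_eval (\<phi> x) p = 0})"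

definition generic_point ::
  "'c::field set \<Rightarrow> 'v set \<Rightarrow> ('x \<Rightarrow> 'v \<Rightarrow> 'c) \<Rightarrow> 'x set \<Rightarrow> 'x \<Rightarrow> bool" where
  "generic_point k I \<phi> X x \<longleftrightarrow>
     x \<in> X \<and> \<not> (\<exists>Z. zariski_closed_over k I \<phi> X Z \<and> Z \<noteq> X \<and> x \<in> Z)"

definition generic_sym_form :: "'g monoid \<Rightarrow> ('g, complex) R_form \<Rightarrow> bool" where
  "generic_sym_form G b \<longleftrightarrow>
     generic_point Qbar (carrier G \<times> carrier G) (form_coords G) (sym_forms G) b"


subsection \<open>The logarithmic embedding and the Gram form\<close>

text \<open>\<open>\<complex>\<^sup>n\<close> with coordinates indexed by \<open>G\<close> is the space of extensional functions on
  \<open>carrier G\<close>.\<close>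

definition log_vec :: "('k::field_char_0 \<Rightarrow> real) \<Rightarrow> 'k \<Rightarrow> ('k \<Rightarrow> 'k) \<Rightarrow> complex" where
  "log_vec \<iota> u = (\<lambda>h\<in>carrier (gal_group TYPE('k)). complex_of_real (ln \<bar>\<iota> (h u)\<bar>))"

text \<open>The linear extension of \<open>(g \<cdot> x)\<^sub>h = x\<^sub>h\<^sub>g\<close> to the group ring.\<close>

definition group_ring_act :: "'g monoid \<Rightarrow> ('g \<Rightarrow> 'f::field) \<Rightarrow> ('g \<Rightarrow> 'f) \<Rightarrow> 'g \<Rightarrow> 'f" where
  "group_ring_act G a x = (\<lambda>h\<in>carrier G. \<Sum>g\<in>carrier G. a g * x (h \<otimes>\<^bsub>G\<^esub> g))"

text \<open>All representatives of a class act in the same way on a vector with coordinate sum 0;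
  only for such \<open>x\<close> is the following meaningful.\<close>

definition R_act :: "'g monoid \<Rightarrow> ('g \<Rightarrow> 'f::field) set \<Rightarrow> ('g \<Rightarrow> 'f) \<Rightarrow> 'g \<Rightarrow> 'f" where
  "R_act G A x = the_elem ((\<lambda>a. group_ring_act G a x) ` A)"

definition gram_form :: "'g monoid \<Rightarrow> ('g \<Rightarrow> 'f::field) \<Rightarrow> ('g, 'f) R_form" where
  "gram_form G v A B = (\<Sum>h\<in>carrier G. R_act G A v h * R_act G B v h)"

end

theory Submission
  imports Defs
    "Jordan_Normal_Form.Char_Poly"
    "HOL-Computational_Algebra.Formal_Power_Series"
begin

text \<open>Dirichlet's construction gives a unit all of whose conjugates except one are smaller than 1 in
  absolute value, so the only linear relation between the logarithmic vectors of its conjugates is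
  the norm relation. Some power of this unit lies in the group generated by the conjugates of \<open>u\<close>,
  hence the same holds for \<open>u\<close>: the numbers \<open>v\<^sub>g\<close>, \<open>g \<noteq> 1\<close>, are linearly independent over \<open>\<rat>\<close>, and by
  the conjecture algebraically independent over \<open>\<rat>\<close>, hence over the algebraic numbers. A polynomial
  with algebraic coefficients that vanishes at the Gram form of \<open>v\<close> therefore vanishes at the Gram form
  of every \<open>x\<close> with coordinate sum 0.

  An invariant symmetric form is a function \<open>\<phi>\<close> on the group with \<open>\<phi> (g\<inverse>) = \<phi> g\<close> and sum 0, and
  the Gram form of \<open>x\<close> corresponds to the convolution \<open>x\<^sup>* x\<close>. If \<open>e\<close> is the unit of the sum-zero part
  of the group algebra, then \<open>r e + \<phi>\<close> has a self-adjoint square root for large \<open>r\<close>, so the polynomial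
  vanishes on \<open>r e + \<phi>\<close> for all large \<open>r\<close>, hence also for \<open>r = 0\<close>.\<close>

subsection \<open>Integral elements over a subring of a field\<close>

text \<open>That the conjugates of \<open>u\<close> generate a subgroup of finite index yields
  nothing until the unit group is known to be large; Dirichlet's unit supplies exactly this. A
  rational relation between the numbers \<open>v_g\<close> concerns a single coordinate, whereas the
  kernel arguments need it in all coordinates. After clearing denominators the relation says that a
  product x of powers of the conjugates g(u) satisfies |\<iota>(x)| = 1. As \<iota> is real, x is 1
  or -1, so all conjugates of x have logarithm 0 and the relation holds between whole vectors. The
  norm relation then makes the coefficients constant, and the omitted index g = 1 forces that
  constant to be 0. The square root is built by a power series because the group algebra need not be
  commutative: powers of a single element commute, so no decomposition into matrix blocks
  enters.\<close>

locale coeff_subring =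
  fixes k :: "'a::field set"
  assumes one_mem: "1 \<in> k"
    and diff_mem: "a \<in> k \<Longrightarrow> b \<in> k \<Longrightarrow> a - b \<in> k"
    and mult_mem: "a \<in> k \<Longrightarrow> b \<in> k \<Longrightarrow> a * b \<in> k"
begin

lemma zero_mem: "0 \<in> k"
  using diff_mem[OF one_mem one_mem] by simp

lemma uminus_mem: "a \<in> k \<Longrightarrow> - a \<in> k"
  using diff_mem[OF zero_mem] by simp

lemma add_mem: "a \<in> k \<Longrightarrow> b \<in> k \<Longrightarrow> a + b \<in> k"
  using diff_mem[OF _ uminus_mem, of a b] by simp

lemma sum_mem: "(\<And>i. i \<in> A \<Longrightarrow> f i \<in> k) \<Longrightarrow> sum f A \<in> k"
  by (induction A rule: infinite_finite_induct) (auto intro: zero_mem add_mem)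

section \<open>Polynomials with coefficients in the subring\<close>

definition polys :: "'a poly set" where
  "polys = {p. \<forall>i. coeff p i \<in> k}"

lemma const_polys: "a \<in> k \<Longrightarrow> [:a:] \<in> polys"
  by (auto simp: polys_def coeff_pCons zero_mem split: nat.split)

lemma one_polys: "1 \<in> polys"
  using const_polys[OF one_mem] by (simp add: one_pCons)

lemma add_polys: "p \<in> polys \<Longrightarrow> q \<in> polys \<Longrightarrow> p + q \<in> polys"
  by (auto simp: polys_def add_mem)

lemma uminus_polys: "p \<in> polys \<Longrightarrow> - p \<in> polys"
  by (auto simp: polys_def uminus_mem)

lemma mult_polys: "p \<in> polys \<Longrightarrow> q \<in> polys \<Longrightarrow> p * q \<in> polys"
  by (auto simp: polys_def coeff_mult intro!: sum_mem mult_mem)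

lemma sum_polys: "(\<And>i. i \<in> A \<Longrightarrow> f i \<in> polys) \<Longrightarrow> sum f A \<in> polys"
  by (induction A rule: infinite_finite_induct)
     (auto intro: add_polys const_polys[OF zero_mem, simplified])

lemma prod_polys: "(\<And>i. i \<in> A \<Longrightarrow> f i \<in> polys) \<Longrightarrow> prod f A \<in> polys"
  by (induction A rule: infinite_finite_induct) (auto intro: one_polys mult_polys)

text \<open>The Leibniz formula is a signed sum of products of entries of \<open>X - A\<close>, each
  a polynomial over \<open>k\<close>.\<close>

lemma char_poly_polys:
  assumes A: "A \<in> carrier_mat n n" and k: "\<And>i j. i < n \<Longrightarrow> j < n \<Longrightarrow> A $$ (i, j) \<in> k"
  shows "char_poly A \<in> polys"
proof -
  have entry: "char_poly_matrix A $$ (i, j) \<in> polys" if "i < n" "j < n" for i j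
    using that A k[OF that] const_polys[OF zero_mem]
    by (auto simp: char_poly_matrix_def polys_def coeff_pCons zero_mem one_mem uminus_mem
          split: nat.split)
  have C: "char_poly_matrix A \<in> carrier_mat n n"
    using A by simp
  have sgn: "signof p \<in> polys" for p :: "nat \<Rightarrow> nat"
    by (auto simp: sign_def intro: one_polys uminus_polys)
  show ?thesis
    unfolding char_poly_def det_def'[OF C]
    by (intro sum_polys mult_polys prod_polys sgn entry)
       (auto dest: permutes_in_image)
qed

section \<open>Integrality and finitely generated modules\<close>

definition integral_elem :: "'a \<Rightarrow> bool" where
  "integral_elem x \<longleftrightarrow> (\<exists>p\<in>polys. lead_coeff p = 1 \<and> poly p x = 0)"

definition lincombs :: "'a set \<Rightarrow> 'a set" where
  "lincombs B = {\<Sum>b\<in>B. c b * b | c. \<forall>b. c b \<in> k}"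

lemma lincombs_add: "x \<in> lincombs B \<Longrightarrow> y \<in> lincombs B \<Longrightarrow> x + y \<in> lincombs B"
proof -
  assume "x \<in> lincombs B" "y \<in> lincombs B"
  then obtain c d where "x = (\<Sum>b\<in>B. c b * b)" "\<forall>b. c b \<in> k" "y = (\<Sum>b\<in>B. d b * b)" "\<forall>b. d b \<in> k"
    by (auto simp: lincombs_def)
  then show ?thesis
    by (auto simp: lincombs_def add_mem sum.distrib algebra_simps intro!: exI[of _ "\<lambda>b. c b + d b"])
qed

lemma lincombs_scale: "a \<in> k \<Longrightarrow> x \<in> lincombs B \<Longrightarrow> a * x \<in> lincombs B"
proof -
  assume a: "a \<in> k" and "x \<in> lincombs B"
  then obtain c where "x = (\<Sum>b\<in>B. c b * b)" "\<forall>b. c b \<in> k"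
    by (auto simp: lincombs_def)
  then show ?thesis using a
    by (auto simp: lincombs_def mult_mem sum_distrib_left mult.assoc intro!: exI[of _ "\<lambda>b. a * c b"])
qed

lemma lincombs_zero: "0 \<in> lincombs B"
  by (auto simp: lincombs_def zero_mem intro!: exI[of _ "\<lambda>_. 0"])

lemma lincombs_sum: "(\<And>i. i \<in> A \<Longrightarrow> f i \<in> lincombs B) \<Longrightarrow> sum f A \<in> lincombs B"
  by (induction A rule: infinite_finite_induct) (auto intro: lincombs_zero lincombs_add)

lemma lincombs_base: "finite B \<Longrightarrow> b \<in> B \<Longrightarrow> b \<in> lincombs B"
  by (auto simp: lincombs_def zero_mem one_mem if_distrib[of "\<lambda>x. x * _"] cong: if_cong
        intro!: exI[of _ "\<lambda>x. if x = b then 1 else 0"])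

lemma lincombs_uminus: "x \<in> lincombs B \<Longrightarrow> - x \<in> lincombs B"
  using lincombs_scale[OF uminus_mem[OF one_mem]] by simp

lemma lincombs_mult:
  assumes "x \<in> lincombs B" "\<And>b. b \<in> B \<Longrightarrow> z * b \<in> lincombs B'"
  shows "z * x \<in> lincombs B'"
proof -
  obtain c where c: "x = (\<Sum>b\<in>B. c b * b)" "\<forall>b. c b \<in> k"
    using assms(1) by (auto simp: lincombs_def)
  have "z * x = (\<Sum>b\<in>B. c b * (z * b))"
    by (simp add: c sum_distrib_left mult_ac)
  also have "\<dots> \<in> lincombs B'"
    using c(2) assms(2) by (blast intro: lincombs_sum lincombs_scale)
  finally show ?thesis .
qed

text \<open>The determinant trick. Expanding each \<open>z * b\<close> over \<open>B\<close> gives a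
  matrix over \<open>k\<close> that has the column of all elements of \<open>B\<close> as
  eigenvector with eigenvalue \<open>z\<close>; the column is non-zero because of \<open>b0\<close>.
  So \<open>z\<close> is a root of a monic characteristic polynomial over \<open>k\<close>.\<close>

lemma integral_elem_if_stable:
  assumes fin: "finite B" and nz: "b0 \<in> B" "b0 \<noteq> 0"
    and stable: "\<And>b. b \<in> B \<Longrightarrow> z * b \<in> lincombs B"
  shows "integral_elem z"
proof -
  define n where "n = card B"
  obtain f where f: "bij_betw f {0..<n} B"
    using ex_bij_betw_nat_finite[OF fin] n_def by blast
  have "\<forall>b\<in>B. \<exists>c. z * b = (\<Sum>b'\<in>B. c b' * b') \<and> (\<forall>b'. c b' \<in> k)"
    using stable by (auto simp: lincombs_def)
  then obtain c where c: "\<And>b. b \<in> B \<Longrightarrow> z * b = (\<Sum>b'\<in>B. c b b' * b')"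
      "\<And>b b'. b \<in> B \<Longrightarrow> c b b' \<in> k"
    by metis
  define A where "A = mat n n (\<lambda>(i, j). c (f i) (f j))"
  define v where "v = vec n f"
  have fB: "f i \<in> B" if "i < n" for i
    using f that by (auto simp: bij_betw_def)
  have A: "A \<in> carrier_mat n n"
    by (simp add: A_def)
  have "v \<noteq> 0\<^sub>v n"
  proof
    assume "v = 0\<^sub>v n"
    then have "f i = 0" if "i < n" for i
      using that by (metis v_def index_vec index_zero_vec(1))
    moreover obtain i where "i < n" "f i = b0"
      using f nz(1) by (auto simp: bij_betw_def image_iff)
    ultimately show False
      using nz by auto
  qed
  moreover have "A *\<^sub>v v = z \<cdot>\<^sub>v v"
  proof (rule eq_vecI)
    fix i assume "i < dim_vec (z \<cdot>\<^sub>v v)"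
    then have i: "i < n"
      by (simp add: v_def)
    have "(A *\<^sub>v v) $ i = (\<Sum>j\<in>{0..<n}. c (f i) (f j) * f j)"
      using i by (simp add: A_def v_def scalar_prod_def)
    also have "\<dots> = (\<Sum>b'\<in>B. c (f i) b' * b')"
      by (rule sum.reindex_bij_betw[OF f])
    also have "\<dots> = z * f i"
      using c(1)[OF fB[OF i]] by simp
    finally show "(A *\<^sub>v v) $ i = (z \<cdot>\<^sub>v v) $ i"
      using i by (simp add: v_def)
  qed (simp add: A_def v_def)
  ultimately have "eigenvalue A z"
    unfolding eigenvalue_def eigenvector_def using A by (intro exI[of _ v]) (simp add: v_def)
  then have "poly (char_poly A) z = 0"
    using eigenvalue_root_char_poly[OF A] by simp
  moreover have "char_poly A \<in> polys"
    by (rule char_poly_polys[OF A]) (auto simp: A_def intro!: c fB)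
  ultimately show ?thesis
    using degree_monic_char_poly[OF A] unfolding integral_elem_def by metis
qed

text \<open>A converse for finitely many elements at once. Having one module stable under all of
  \<open>S\<close> is what makes sums and products integral.\<close>

lemma integral_imp_stable:
  assumes "finite S" "\<And>s. s \<in> S \<Longrightarrow> integral_elem s"
  obtains B where "finite B" "1 \<in> B" "\<And>s b. s \<in> S \<Longrightarrow> b \<in> B \<Longrightarrow> s * b \<in> lincombs B"
proof -
  have "\<exists>B. finite B \<and> 1 \<in> B \<and> (\<forall>s\<in>S. \<forall>b\<in>B. s * b \<in> lincombs B)"
    using assms
  proof (induction S rule: finite_induct)
    case empty
    show ?case by (intro exI[of _ "{1}"]) auto
  next
    case (insert s S)
    then obtain B where B: "finite B" "1 \<in> B" "\<And>t b. t \<in> S \<Longrightarrow> b \<in> B \<Longrightarrow> t * b \<in> lincombs B"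
      by auto
    obtain p where p: "p \<in> polys" "lead_coeff p = 1" "poly p s = 0"
      using insert.prems[of s] by (auto simp: integral_elem_def)
    define d where "d = degree p"
    \<comment> \<open>A monic constant is 1 and has no root. Positive degree admits the exponent 0,
      which puts 1 into the new set \<open>C\<close>.\<close>
    have d: "d > 0"
    proof (rule ccontr)
      assume "\<not> d > 0"
      then have "degree p = 0" by (simp add: d_def)
      then obtain a where "p = [:a:]" by (rule degree_eq_zeroE)
      then show False using p by simp
    qed
    \<comment> \<open>Powers of \<open>s\<close> below the degree are enough, since the monic
      equation rewrites \<open>s ^ d\<close> through lower ones.\<close>
    define C where "C = (\<lambda>(i, b). s ^ i * b) ` ({..<d} \<times> B)"
    have finC: "finite C"
      using B(1) by (simp add: C_def)
    have C: "s ^ i * b \<in> lincombs C" if "i < d" "b \<in> B" for i b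
      using that by (intro lincombs_base finC) (auto simp: C_def image_iff)
    have powd: "s ^ d = - (\<Sum>i<d. coeff p i * s ^ i)"
    proof -
      have "0 = (\<Sum>i\<le>d. coeff p i * s ^ i)"
        using p(3) by (simp add: poly_altdef d_def)
      also have "{..d} = insert d {..<d}" by auto
      finally show ?thesis
        using p(2) by (simp add: d_def eq_neg_iff_add_eq_0 add.commute)
    qed
    have stab_s: "s * b \<in> lincombs C" if b: "b \<in> C" for b
    proof -
      obtain i b' where ib: "i < d" "b' \<in> B" "b = s ^ i * b'"
        using b by (auto simp: C_def)
      show ?thesis
      proof (cases "Suc i < d")
        case True
        then show ?thesis using C[OF True ib(2)] ib(3) by (simp add: mult.assoc)
      next
        case False
        then have "s * b = s ^ d * b'"
          using ib by (metis Suc_lessI mult.assoc power_Suc)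
        also have "\<dots> = - (\<Sum>i<d. coeff p i * (s ^ i * b'))"
          unfolding powd by (simp add: sum_distrib_right mult.assoc)
        also have "\<dots> \<in> lincombs C"
          using p(1) ib(2) by (intro lincombs_uminus lincombs_sum lincombs_scale C) (auto simp: polys_def)
        finally show ?thesis .
      qed
    qed
    have stab_t: "t * b \<in> lincombs C" if t: "t \<in> S" and b: "b \<in> C" for t b
    proof -
      obtain i b' where ib: "i < d" "b' \<in> B" "b = s ^ i * b'"
        using b by (auto simp: C_def)
      have "s ^ i * (t * b') \<in> lincombs C"
        by (rule lincombs_mult[OF B(3)[OF t ib(2)]]) (rule C[OF ib(1)])
      then show ?thesis by (simp add: ib(3) mult_ac)
    qed
    have "1 \<in> C"
      unfolding C_def using B(2) d by (intro image_eqI[of _ _ "(0, 1)"]) auto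
    then show ?case
      using finC stab_s stab_t by (intro exI[of _ C]) auto
  qed
  then show ?thesis using that by blast
qed

lemma
  assumes "integral_elem x" "integral_elem y"
  shows integral_elem_add: "integral_elem (x + y)"
    and integral_elem_mult: "integral_elem (x * y)"
proof -
  obtain B where B: "finite B" "1 \<in> B" "\<And>s b. s \<in> {x, y} \<Longrightarrow> b \<in> B \<Longrightarrow> s * b \<in> lincombs B"
    using integral_imp_stable[of "{x, y}"] assms by (metis finite.emptyI finite.insertI insertE singletonD)
  show "integral_elem (x + y)"
    by (rule integral_elem_if_stable[OF B(1,2)])
       (auto simp: distrib_right intro!: lincombs_add B(3))
  have "x * (y * b) \<in> lincombs B" if "b \<in> B" for b
    by (rule lincombs_mult[OF B(3)[of y b]]) (use that in \<open>auto intro: B(3)\<close>)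
  then show "integral_elem (x * y)"
    by (intro integral_elem_if_stable[OF B(1,2)]) (auto simp: mult.assoc)
qed

end

section \<open>Algebraic integers and algebraic numbers as the cases \<int> and \<rat>\<close>

interpretation int_coeffs: coeff_subring "\<int> :: 'a::field_char_0 set"
  by unfold_locales auto

interpretation rat_coeffs: coeff_subring "\<rat> :: 'a::field_char_0 set"
  by unfold_locales auto

lemma algebraic_int_iff_integral: "algebraic_int x \<longleftrightarrow> int_coeffs.integral_elem x"
  unfolding int_coeffs.integral_elem_def int_coeffs.polys_def algebraic_int.simps by auto

lemma algebraic_int_plus:
  "algebraic_int x \<Longrightarrow> algebraic_int y \<Longrightarrow> algebraic_int (x + y :: 'a::field_char_0)"
  unfolding algebraic_int_iff_integral by (rule int_coeffs.integral_elem_add)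

lemma algebraic_int_times:
  "algebraic_int x \<Longrightarrow> algebraic_int y \<Longrightarrow> algebraic_int (x * y :: 'a::field_char_0)"
  unfolding algebraic_int_iff_integral by (rule int_coeffs.integral_elem_mult)

lemma algebraic_int_sum:
  "(\<And>i. i \<in> A \<Longrightarrow> algebraic_int (f i)) \<Longrightarrow> algebraic_int (sum f A :: 'a::field_char_0)"
  by (induction A rule: infinite_finite_induct) (auto intro: algebraic_int_plus)

lemma algebraic_int_prod:
  "(\<And>i. i \<in> A \<Longrightarrow> algebraic_int (f i)) \<Longrightarrow> algebraic_int (prod f A :: 'a::field_char_0)"
  by (induction A rule: infinite_finite_induct)
     (auto intro: algebraic_int_times int_imp_algebraic_int)

lemma algebraic_int_power: "algebraic_int x \<Longrightarrow> algebraic_int (x ^ n :: 'a::field_char_0)"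
  using algebraic_int_prod[of "{..<n}" "\<lambda>_. x"] by simp

lemma algebraic_imp_integral:
  assumes "algebraic x" shows "rat_coeffs.integral_elem x"
proof -
  obtain p where p: "\<And>i. coeff p i \<in> \<rat>" "p \<noteq> 0" "poly p x = 0"
    using assms by (auto simp: algebraic_altdef)
  have "Polynomial.smult (inverse (lead_coeff p)) p \<in> rat_coeffs.polys"
    using p(1) by (auto simp: rat_coeffs.polys_def)
  then show ?thesis
    using p(2,3) unfolding rat_coeffs.integral_elem_def
    by (intro bexI[of _ "Polynomial.smult (inverse (lead_coeff p)) p"]) auto
qed

lemma integral_imp_algebraic: "rat_coeffs.integral_elem x \<Longrightarrow> algebraic x"
  unfolding rat_coeffs.integral_elem_def rat_coeffs.polys_def
  by (force simp: algebraic_altdef)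

lemma algebraic_int_multiple:
  fixes x :: "'a::field_char_0"
  assumes "algebraic x"
  obtains m :: int where "m \<noteq> 0" "algebraic_int (of_int m * x)"
proof -
  obtain p where p: "\<And>i. coeff p i \<in> \<int>" "p \<noteq> 0" "poly p x = 0"
    using assms by (auto simp: algebraic_def)
  define d where "d = degree p"
  define a where "a = lead_coeff p"
  have a: "a \<in> \<int>" "a \<noteq> 0"
    using p by (auto simp: a_def)
  have "d > 0"
  proof (rule ccontr)
    assume "\<not> d > 0"
    then have "degree p = 0" by (simp add: d_def)
    then obtain c where "p = [:c:]" by (rule degree_eq_zeroE)
    then show False using p by simp
  qed
  \<comment> \<open>This is \<open>a ^ (d - 1) * p (Y / a)\<close>: the powers of \<open>a\<close>
    stay integral for \<open>i < d\<close>, and the leading coefficient becomes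
    \<open>a / a = 1\<close>.\<close>
  define q where "q = monom 1 d + (\<Sum>i<d. monom (coeff p i * a ^ (d - 1 - i)) i)"
  have coeffq: "coeff q i = (if i = d then 1 else if i < d then coeff p i * a ^ (d - 1 - i) else 0)" for i
    by (auto simp: q_def coeff_sum)
  have degq: "degree q = d"
    by (rule antisym) (auto simp: coeffq intro!: degree_le le_degree)
  have "poly q (a * x) = (a * x) ^ d + (\<Sum>i<d. coeff p i * a ^ (d - 1 - i) * (a * x) ^ i)"
    by (simp add: q_def poly_sum poly_monom)
  also have "(\<Sum>i<d. coeff p i * a ^ (d - 1 - i) * (a * x) ^ i) = (\<Sum>i<d. a ^ (d - 1) * (coeff p i * x ^ i))"
  proof (rule sum.cong)
    fix i assume "i \<in> {..<d}"
    then have "a ^ (d - 1) = a ^ (d - 1 - i) * a ^ i"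
      by (simp flip: power_add)
    then show "coeff p i * a ^ (d - 1 - i) * (a * x) ^ i = a ^ (d - 1) * (coeff p i * x ^ i)"
      by (simp add: power_mult_distrib mult_ac)
  qed simp
  also have "(a * x) ^ d = a ^ (d - 1) * (coeff p d * x ^ d)"
    using \<open>d > 0\<close> by (cases d) (auto simp: a_def d_def power_mult_distrib mult_ac)
  also have "a ^ (d - 1) * (coeff p d * x ^ d) + (\<Sum>i<d. a ^ (d - 1) * (coeff p i * x ^ i))
      = a ^ (d - 1) * (\<Sum>i\<le>d. coeff p i * x ^ i)"
    by (simp add: sum_distrib_left distrib_left add.commute flip: lessThan_Suc_atMost)
  also have "(\<Sum>i\<le>d. coeff p i * x ^ i) = 0"
    using p(3) by (simp add: poly_altdef d_def)
  finally have "poly q (a * x) = 0" by simp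
  moreover have "coeff q i \<in> \<int>" for i
    using p(1) a by (auto simp: coeffq)
  ultimately have "algebraic_int (a * x)"
    using degq coeffq[of d] by (intro algebraic_int.intros[of q]) auto
  moreover obtain m where "a = of_int m" using a by (auto elim: Ints_cases)
  ultimately show ?thesis using a that[of m] by auto
qed

subsection \<open>Polynomial functions\<close>

text \<open>Polynomials taken as functions, so that substitution and restriction to curves are plain
  inductions. As \<open>k\<close> is an arbitrary set, it can be shrunk to the finitely many
  constants that occur.\<close>

inductive_set polyfun :: "'c::comm_ring_1 set \<Rightarrow> 'v set \<Rightarrow> (('v \<Rightarrow> 'c) \<Rightarrow> 'c) set"
  for k :: "'c set" and I :: "'v set" where
  const: "c \<in> k \<Longrightarrow> (\<lambda>_. c) \<in> polyfun k I"
| var: "i \<in> I \<Longrightarrow> (\<lambda>x. x i) \<in> polyfun k I"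
| add: "F \<in> polyfun k I \<Longrightarrow> G \<in> polyfun k I \<Longrightarrow> (\<lambda>x. F x + G x) \<in> polyfun k I"
| mult: "F \<in> polyfun k I \<Longrightarrow> G \<in> polyfun k I \<Longrightarrow> (\<lambda>x. F x * G x) \<in> polyfun k I"

lemma polyfun_sum:
  assumes "0 \<in> k" "\<And>a. a \<in> A \<Longrightarrow> F a \<in> polyfun k I"
  shows "(\<lambda>x. \<Sum>a\<in>A. F a x) \<in> polyfun k I"
  using assms by (induction A rule: infinite_finite_induct) (auto intro: polyfun.intros)

lemma polyfun_prod:
  assumes "1 \<in> k" "\<And>a. a \<in> A \<Longrightarrow> F a \<in> polyfun k I"
  shows "(\<lambda>x. \<Prod>a\<in>A. F a x) \<in> polyfun k I"
  using assms by (induction A rule: infinite_finite_induct) (auto intro: polyfun.intros)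

lemma polyfun_power:
  assumes "1 \<in> k" "F \<in> polyfun k I"
  shows "(\<lambda>x. F x ^ n) \<in> polyfun k I"
  using polyfun_prod[of k "{..<n}" "\<lambda>_. F"] assms by simp

lemma polyfun_subst:
  assumes "F \<in> polyfun k J" "\<And>j. j \<in> J \<Longrightarrow> (\<lambda>x. G x j) \<in> polyfun k I"
  shows "(\<lambda>x. F (G x)) \<in> polyfun k I"
  using assms by induction (auto intro: polyfun.intros)

lemma polyfun_mono: "F \<in> polyfun k I \<Longrightarrow> k \<subseteq> k' \<Longrightarrow> F \<in> polyfun k' I"
  by (induction rule: polyfun.induct) (auto intro: polyfun.intros)

text \<open>Prepares the choice of one finite-dimensional \<rat>-space stable under all constants of
  \<open>F\<close>.\<close>

lemma polyfun_finite_coeffs: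
  assumes "F \<in> polyfun k I"
  obtains S where "finite S" "S \<subseteq> k" "F \<in> polyfun S I"
proof -
  have "\<exists>S. finite S \<and> S \<subseteq> k \<and> F \<in> polyfun S I"
    using assms
  proof induction
    case (const c)
    then show ?case by (intro exI[of _ "{c}"]) (auto intro: polyfun.intros)
  next
    case (var i)
    then show ?case by (intro exI[of _ "{}"]) (auto intro: polyfun.intros)
  next
    case (add F G)
    then obtain S T where "finite S" "S \<subseteq> k" "F \<in> polyfun S I" "finite T" "T \<subseteq> k" "G \<in> polyfun T I"
      by auto
    then show ?case
      by (intro exI[of _ "S \<union> T"]) (auto intro!: polyfun.add elim: polyfun_mono)
  next
    case (mult F G)
    then obtain S T where "finite S" "S \<subseteq> k" "F \<in> polyfun S I" "finite T" "T \<subseteq> k" "G \<in> polyfun T I"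
      by auto
    then show ?case
      by (intro exI[of _ "S \<union> T"]) (auto intro!: polyfun.mult elim: polyfun_mono)
  qed
  then show ?thesis using that by blast
qed

text \<open>Infinitely many zeros on a polynomial curve force vanishing along all of it. Used on
  coordinate lines and on the line of forms \<open>s e + \<phi>\<close>.\<close>

lemma polyfun_along_curve:
  assumes "F \<in> polyfun k I" "\<And>i. i \<in> I \<Longrightarrow> \<exists>q. \<forall>t. c t i = poly q t"
  shows "\<exists>q. \<forall>t. F (c t) = poly q t"
  using assms(1)
proof induction
  case (const a)
  show ?case by (intro exI[of _ "[:a:]"]) auto
next
  case (var i)
  then show ?case using assms(2) by blast
next
  case (add F G)
  then show ?case by (metis poly_add)
next
  case (mult F G)
  then show ?case by (metis poly_mult)
qed

lemma polyfun_rational_value: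
  assumes "F \<in> polyfun \<rat> I" "\<And>i. i \<in> I \<Longrightarrow> y i \<in> \<rat>"
  shows "F y \<in> (\<rat> :: 'a::field_char_0 set)"
  using assms by induction auto

text \<open>Coordinates are freed from rationality one at a time, \<open>J\<close> being those
  already free: in each coordinate \<open>F\<close> is a univariate polynomial that vanishes at all
  natural numbers.\<close>

lemma polyfun_eq_0_if_0_on_rationals:
  fixes F :: "('v \<Rightarrow> 'a::field_char_0) \<Rightarrow> 'a"
  assumes F: "F \<in> polyfun k I" and "finite I"
    and zero: "\<And>y. (\<And>i. i \<in> I \<Longrightarrow> y i \<in> \<rat>) \<Longrightarrow> F y = 0"
  shows "F y = 0"
proof -
  have "\<forall>y. (\<forall>i\<in>I - J. y i \<in> \<rat>) \<longrightarrow> F y = 0" if "finite J" for J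
    using that
  proof induction
    case empty
    then show ?case using zero by simp
  next
    case (insert j J)
    show ?case
    proof (intro allI impI)
      fix y :: "'v \<Rightarrow> 'a" assume y: "\<forall>i\<in>I - insert j J. y i \<in> \<rat>"
      have "\<exists>q. \<forall>t. F (y(j := t)) = poly q t"
      proof (rule polyfun_along_curve[OF F])
        fix i show "\<exists>q. \<forall>t. (y(j := t)) i = poly q t"
        proof (cases "i = j")
          case True
          then show ?thesis by (intro exI[of _ "[:0, 1:]"]) auto
        next
          case False
          then show ?thesis by (intro exI[of _ "[:y i:]"]) auto
        qed
      qed
      then obtain q where q: "F (y(j := t)) = poly q t" for t
        by blast
      have "poly q (of_nat t) = 0" for t
        using insert.IH y unfolding q[symmetric] by (auto simp: of_nat_in_Nats)
      then have "range of_nat \<subseteq> {t. poly q t = 0}"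
        by auto
      moreover have "infinite (range (of_nat :: nat \<Rightarrow> 'a))"
        by (rule range_inj_infinite) (simp add: inj_on_def)
      ultimately have "q = 0"
        using poly_roots_finite finite_subset by blast
      then show "F y = 0"
        using q[of "y j"] by simp
    qed
  qed
  from this[OF \<open>finite I\<close>] show ?thesis by auto
qed

section \<open>Evaluation of formal polynomials is a ring homomorphism\<close>

definition monom_eval :: "('v \<Rightarrow> 'c::comm_ring_1) \<Rightarrow> ('v \<Rightarrow>\<^sub>0 nat) \<Rightarrow> 'c" where
  "monom_eval x m = (\<Prod>i\<in>Poly_Mapping.keys m. x i ^ Poly_Mapping.lookup m i)"

lemma monom_eval_superset:
  assumes "finite A" "Poly_Mapping.keys m \<subseteq> A"
  shows "monom_eval x m = (\<Prod>i\<in>A. x i ^ Poly_Mapping.lookup m i)"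
  unfolding monom_eval_def using assms by (intro prod.mono_neutral_left) (auto simp: in_keys_iff)

lemma monom_eval_add: "monom_eval x (m + m') = monom_eval x m * monom_eval x m'"
proof -
  let ?A = "Poly_Mapping.keys m \<union> Poly_Mapping.keys m'"
  have "Poly_Mapping.keys (m + m') \<subseteq> ?A"
    by (rule Poly_Mapping.keys_add)
  then show ?thesis
    by (simp add: monom_eval_superset[of ?A] lookup_add power_add prod.distrib)
qed

lemma mpol_eval_superset:
  assumes "finite A" "Poly_Mapping.keys p \<subseteq> A"
  shows "mpol_eval x p = (\<Sum>m\<in>A. Poly_Mapping.lookup p m * monom_eval x m)"
  unfolding mpol_eval_def monom_eval_def[symmetric]
  using assms by (intro sum.mono_neutral_left) (auto simp: in_keys_iff)

lemma mpol_eval_add: "mpol_eval x (p + q) = mpol_eval x p + mpol_eval x q"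
proof -
  let ?A = "Poly_Mapping.keys p \<union> Poly_Mapping.keys q"
  have "Poly_Mapping.keys (p + q) \<subseteq> ?A"
    by (rule Poly_Mapping.keys_add)
  then show ?thesis
    by (simp add: mpol_eval_superset[of ?A] lookup_add distrib_right sum.distrib)
qed

lemma mpol_eval_zero: "mpol_eval x 0 = 0"
  by (simp add: mpol_eval_def)

lemma mpol_eval_single: "mpol_eval x (Poly_Mapping.single m c) = c * monom_eval x m"
  by (simp add: mpol_eval_superset[of "{m}"])

lemma mpol_eval_sum: "mpol_eval x (sum f A) = (\<Sum>a\<in>A. mpol_eval x (f a))"
  by (induction A rule: infinite_finite_induct) (auto simp: mpol_eval_zero mpol_eval_add)

lemma mpol_sum_monomials:
  "p = (\<Sum>m\<in>Poly_Mapping.keys p. Poly_Mapping.single m (Poly_Mapping.lookup p m))"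
  by (rule poly_mapping_eqI)
     (auto simp: lookup_sum lookup_single when_def in_keys_iff)

lemma mpol_mult_monomials:
  "p * q = (\<Sum>m\<in>Poly_Mapping.keys p. \<Sum>m'\<in>Poly_Mapping.keys q.
      Poly_Mapping.single (m + m') (Poly_Mapping.lookup p m * Poly_Mapping.lookup q m'))"
  by (subst mpol_sum_monomials[of p], subst mpol_sum_monomials[of q])
     (simp add: sum_product mult_single)

lemma mpol_eval_mult: "mpol_eval x (p * q) = mpol_eval x p * mpol_eval x q"
proof -
  have "mpol_eval x (p * q) = (\<Sum>m\<in>Poly_Mapping.keys p. \<Sum>m'\<in>Poly_Mapping.keys q.
      Poly_Mapping.lookup p m * Poly_Mapping.lookup q m' * monom_eval x (m + m'))"
    by (simp only: mpol_mult_monomials[of p q] mpol_eval_sum mpol_eval_single)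
  also have "\<dots> = mpol_eval x p * mpol_eval x q"
    by (simp add: monom_eval_add mpol_eval_superset[OF finite_keys order_refl] sum_product mult_ac)
  finally show ?thesis .
qed

context coeff_subring
begin

lemma mpols_over_zero: "0 \<in> mpols_over k I"
  by (auto simp: mpols_over_def zero_mem)

lemma mpols_over_single: "c \<in> k \<Longrightarrow> Poly_Mapping.keys m \<subseteq> I \<Longrightarrow> Poly_Mapping.single m c \<in> mpols_over k I"
  by (auto simp: mpols_over_def lookup_single when_def zero_mem)

lemma mpols_over_add: "p \<in> mpols_over k I \<Longrightarrow> q \<in> mpols_over k I \<Longrightarrow> p + q \<in> mpols_over k I"
  using Poly_Mapping.keys_add[of p q] by (fastforce simp: mpols_over_def lookup_add add_mem)

lemma mpols_over_sum: "(\<And>a. a \<in> A \<Longrightarrow> f a \<in> mpols_over k I) \<Longrightarrow> sum f A \<in> mpols_over k I"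
  by (induction A rule: infinite_finite_induct) (auto intro: mpols_over_zero mpols_over_add)

lemma mpols_over_mult:
  assumes "p \<in> mpols_over k I" "q \<in> mpols_over k I" shows "p * q \<in> mpols_over k I"
proof -
  have "Poly_Mapping.keys (m + m') \<subseteq> I"
    if "m \<in> Poly_Mapping.keys p" "m' \<in> Poly_Mapping.keys q" for m m'
    using assms that Poly_Mapping.keys_add[of m m'] by (fastforce simp: mpols_over_def)
  then show ?thesis
    unfolding mpol_mult_monomials[of p q] using assms
    by (intro mpols_over_sum mpols_over_single mult_mem) (auto simp: mpols_over_def)
qed

text \<open>\<open>alg_independent\<close> speaks of formal polynomials; this provides one for a
  function built by other means, such as a determinant.\<close>

lemma polyfun_imp_mpol:
  assumes "F \<in> polyfun k I"
  shows "\<exists>p\<in>mpols_over k I. \<forall>x. F x = mpol_eval x p"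
  using assms
proof induction
  case (const c)
  then show ?case
    by (intro bexI[of _ "Poly_Mapping.single 0 c"] mpols_over_single)
       (auto simp: mpol_eval_single monom_eval_def)
next
  case (var i)
  then show ?case
    by (intro bexI[of _ "Poly_Mapping.single (Poly_Mapping.single i 1) 1"] mpols_over_single)
       (auto simp: mpol_eval_single monom_eval_def one_mem)
next
  case (add F G)
  then show ?case by (metis mpols_over_add mpol_eval_add)
next
  case (mult F G)
  then show ?case by (metis mpols_over_mult mpol_eval_mult)
qed

end

lemma mpol_imp_polyfun:
  assumes "p \<in> mpols_over k I" "0 \<in> k" "1 \<in> k"
  shows "(\<lambda>x. mpol_eval x p) \<in> polyfun k I"
  unfolding mpol_eval_def using assms
  by (intro polyfun_sum polyfun.mult polyfun_prod polyfun_power polyfun.const polyfun.var)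
     (auto simp: mpols_over_def)

subsection \<open>Algebraic independence over the algebraic numbers\<close>

interpretation rat_vs: vector_space "\<lambda>(q::rat) (x::'a::field_char_0). of_rat q * x"
  by unfold_locales (auto simp: algebra_simps of_rat_add of_rat_mult)

lemma rat_lincombs_eq_span:
  assumes "finite B"
  shows "rat_coeffs.lincombs B = rat_vs.span (B :: 'a::field_char_0 set)"
proof (intro equalityI subsetI)
  fix x assume "x \<in> rat_coeffs.lincombs B"
  then obtain c where c: "x = (\<Sum>b\<in>B. c b * b)" "\<forall>b. c b \<in> \<rat>"
    by (auto simp: rat_coeffs.lincombs_def)
  have "\<forall>b. \<exists>q. c b = of_rat q"
    using c(2) by (metis Rats_cases)
  then obtain q where "\<And>b. c b = of_rat (q b)"
    by metis
  then show "x \<in> rat_vs.span B"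
    unfolding rat_vs.span_finite[OF assms] using c(1) by auto
next
  fix x assume "x \<in> rat_vs.span B"
  then obtain q where "x = (\<Sum>b\<in>B. of_rat (q b) * b)"
    unfolding rat_vs.span_finite[OF assms] by auto
  then show "x \<in> rat_coeffs.lincombs B"
    unfolding rat_coeffs.lincombs_def by (auto intro!: exI[of _ "\<lambda>b. of_rat (q b)"])
qed

text \<open>Over \<rat> the generators of the stable module can be thinned out to a basis.
  Independence later turns a non-zero rational vector into a non-zero number.\<close>

lemma algebraic_stable_basis:
  fixes S :: "'a::field_char_0 set"
  assumes "finite S" "\<And>s. s \<in> S \<Longrightarrow> algebraic s"
  obtains B where "finite B" "B \<noteq> {}" "rat_vs.independent B"
    "\<And>s b. s \<in> S \<Longrightarrow> b \<in> B \<Longrightarrow> s * b \<in> rat_coeffs.lincombs B"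
proof -
  obtain B where B: "finite B" "1 \<in> B" "\<And>s b. s \<in> S \<Longrightarrow> b \<in> B \<Longrightarrow> s * b \<in> rat_coeffs.lincombs B"
    using rat_coeffs.integral_imp_stable[OF assms(1) algebraic_imp_integral[OF assms(2)]] by blast
  obtain C where C: "C \<subseteq> B" "rat_vs.independent C" "B \<subseteq> rat_vs.span C"
    using rat_vs.maximal_independent_subset[of B] by blast
  have fin: "finite C"
    using C(1) B(1) by (rule finite_subset)
  have sub: "rat_coeffs.lincombs B \<subseteq> rat_coeffs.lincombs C"
    unfolding rat_lincombs_eq_span[OF B(1)] rat_lincombs_eq_span[OF fin]
    using C(3) by (intro rat_vs.span_minimal rat_vs.subspace_span)
  have "C \<noteq> {}"
    using C(3) B(2) by auto
  then show ?thesis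
    using that[OF fin _ C(2)] sub B(3) C(1) by blast
qed

text \<open>Constants act on the span of the \<open>f i\<close> by rational matrices and variables
  by scalar matrices; sums and products follow. The entries are thus polynomials over \<rat>,
  whatever the constants of \<open>F\<close> are.\<close>

lemma polyfun_matrix_rep:
  fixes f :: "nat \<Rightarrow> 'a::field_char_0"
  assumes "F \<in> polyfun S I"
    and stable: "\<And>s i. s \<in> S \<Longrightarrow> i < n \<Longrightarrow> \<exists>c. (\<forall>j. c j \<in> \<rat>) \<and> s * f i = (\<Sum>j<n. c j * f j)"
  shows "\<exists>M. (\<forall>i j. M i j \<in> polyfun \<rat> I) \<and> (\<forall>y. \<forall>i<n. F y * f i = (\<Sum>j<n. M i j y * f j))"
  using assms(1)
proof induction
  case (const s)
  then have "\<forall>i. \<exists>c. i < n \<longrightarrow> (\<forall>j. c j \<in> \<rat>) \<and> s * f i = (\<Sum>j<n. c j * f j)"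
    using stable by blast
  then obtain c where c: "\<And>i j. i < n \<Longrightarrow> c i j \<in> \<rat>" "\<And>i. i < n \<Longrightarrow> s * f i = (\<Sum>j<n. c i j * f j)"
    by metis
  show ?case
    using c by (intro exI[of _ "\<lambda>i j _. if i < n then c i j else 0"]) (auto intro: polyfun.const)
next
  case (var v)
  have "(\<lambda>y. if i = j then y v else 0) \<in> polyfun \<rat> I" for i j :: nat
    using var by (cases "i = j") (auto intro: polyfun.intros)
  moreover have "y v * f i = (\<Sum>j<n. (if i = j then y v else 0) * f j)" if "i < n" for i y
  proof -
    have "(\<Sum>j<n. (if i = j then y v else 0) * f j) = (\<Sum>j<n. if i = j then y v * f j else 0)"
      by (intro sum.cong) auto
    then show ?thesis using that by simp
  qed
  ultimately show ?case
    by (intro exI[of _ "\<lambda>i j y. if i = j then y v else 0"]) blast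
next
  case (add F G)
  from add.IH(1) obtain M where M: "\<And>i j. M i j \<in> polyfun \<rat> I"
    "\<And>y i. i < n \<Longrightarrow> F y * f i = (\<Sum>j<n. M i j y * f j)"
    by (elim exE conjE) blast
  from add.IH(2) obtain N where N: "\<And>i j. N i j \<in> polyfun \<rat> I"
    "\<And>y i. i < n \<Longrightarrow> G y * f i = (\<Sum>j<n. N i j y * f j)"
    by (elim exE conjE) blast
  show ?case
    by (intro exI[of _ "\<lambda>i j y. M i j y + N i j y"])
       (auto intro!: polyfun.add M(1) N(1) simp: distrib_right M(2) N(2) sum.distrib)
next
  case (mult F G)
  from mult.IH(1) obtain M where M: "\<And>i j. M i j \<in> polyfun \<rat> I"
    "\<And>y i. i < n \<Longrightarrow> F y * f i = (\<Sum>j<n. M i j y * f j)"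
    by (elim exE conjE) blast
  from mult.IH(2) obtain N where N: "\<And>i j. N i j \<in> polyfun \<rat> I"
    "\<And>y i. i < n \<Longrightarrow> G y * f i = (\<Sum>j<n. N i j y * f j)"
    by (elim exE conjE) blast
  \<comment> \<open>The matrices multiply in reverse order: \<open>G y * f i\<close> is expanded
    first by \<open>N\<close>, then \<open>F y\<close> acts on each \<open>f l\<close> by
    \<open>M\<close>.\<close>
  have "F y * G y * f i = (\<Sum>j<n. (\<Sum>l<n. N i l y * M l j y) * f j)" if "i < n" for i y
  proof -
    have "F y * G y * f i = F y * (\<Sum>l<n. N i l y * f l)"
      using N(2)[OF that] by (simp add: mult.assoc)
    also have "\<dots> = (\<Sum>l<n. N i l y * (F y * f l))"
      by (simp add: sum_distrib_left mult_ac)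
    also have "\<dots> = (\<Sum>l<n. N i l y * (\<Sum>j<n. M l j y * f j))"
      using M(2) by (intro sum.cong) auto
    also have "\<dots> = (\<Sum>j<n. (\<Sum>l<n. N i l y * M l j y) * f j)"
      unfolding sum_distrib_left sum_distrib_right by (subst sum.swap) (simp add: mult_ac)
    finally show ?thesis .
  qed
  then show ?case
    by (intro exI[of _ "\<lambda>i j y. \<Sum>l<n. N i l y * M l j y"])
       (auto intro!: polyfun_sum polyfun.mult M(1) N(1))
qed

lemma polyfun_det:
  assumes "\<And>i j. M i j \<in> polyfun \<rat> I"
  shows "(\<lambda>y. det (mat n n (\<lambda>(i, j). M i j y))) \<in> polyfun (\<rat> :: 'a::field_char_0 set) I"
proof -
  have "(\<lambda>y. \<Sum>p\<in>{p. p permutes {0..<n}}. signof p * (\<Prod>i\<in>{0..<n}. M i (p i) y)) \<in> polyfun \<rat> I"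
    by (intro polyfun_sum polyfun.mult polyfun_prod polyfun.const assms) (auto simp: sign_def)
  moreover have "det (mat n n (\<lambda>(i, j). M i j y))
      = (\<Sum>p\<in>{p. p permutes {0..<n}}. signof p * (\<Prod>i\<in>{0..<n}. M i (p i) y))" for y
  proof -
    have C: "mat n n (\<lambda>(i, j). M i j y) \<in> carrier_mat n n" by simp
    have eq: "i < n \<Longrightarrow> p permutes {0..<n} \<Longrightarrow> p i < n" for i p
      using permutes_in_image[of p "{0..<n}" i] by auto
    show ?thesis
      unfolding det_def'[OF C]
      by (intro sum.cong prod.cong arg_cong2[where f = "(*)"] refl) (auto simp: eq)
  qed
  ultimately show ?thesis by simp
qed

text \<open>If \<open>F\<close> has algebraic coefficients, multiplication by \<open>F y\<close> on a suitable finite-dimensional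
  \<open>\<rat>\<close>-subspace of the field is a matrix whose entries are polynomials in \<open>y\<close> over \<open>\<rat>\<close>. Its
  determinant, a norm of \<open>F\<close>, vanishes at \<open>x\<close>, hence everywhere; at rational points this forces
  \<open>F y = 0\<close>.\<close>

lemma alg_independent_imp_polyfun_eq_0:
  fixes x :: "'v \<Rightarrow> 'a::field_char_0"
  assumes indep: "alg_independent \<rat> I x" and "finite I"
    and F: "F \<in> polyfun {z. algebraic z} I" and zero: "F x = 0"
  shows "F y = 0"
proof -
  obtain S where S: "finite S" "S \<subseteq> {z. algebraic z}" "F \<in> polyfun S I"
    using polyfun_finite_coeffs[OF F] by blast
  obtain B where B: "finite B" "B \<noteq> {}" "rat_vs.independent B"
    "\<And>s b. s \<in> S \<Longrightarrow> b \<in> B \<Longrightarrow> s * b \<in> rat_coeffs.lincombs B"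
    using algebraic_stable_basis[OF S(1)] S(2) by blast
  define n where "n = card B"
  obtain f where f: "bij_betw f {..<n} B"
    using ex_bij_betw_nat_finite[OF B(1)] n_def by (auto simp: atLeast0LessThan)
  have n: "n > 0"
    using B(1,2) by (auto simp: n_def card_gt_0_iff)
  have fB: "f i \<in> B" if "i < n" for i
    using f that by (auto simp: bij_betw_def)
  have f0: "c i = 0" if "(\<Sum>i<n. of_rat (c i) * f i) = 0" "i < n" for c :: "nat \<Rightarrow> rat" and i
  proof -
    define c' where "c' = c \<circ> the_inv_into {..<n} f"
    have c': "c' (f j) = c j" if "j < n" for j
      using f that by (simp add: c'_def bij_betw_def the_inv_into_f_f)
    have "(\<Sum>b\<in>B. of_rat (c' b) * b) = (\<Sum>i<n. of_rat (c' (f i)) * f i)"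
      by (rule sum.reindex_bij_betw[OF f, symmetric])
    also have "\<dots> = 0"
      using that(1) by (simp add: c')
    finally have "c' (f i) = 0"
      using B(1,3) fB[OF that(2)] unfolding rat_vs.independent_explicit_finite_subsets by blast
    then show ?thesis using c' that(2) by simp
  qed
  have stable: "\<exists>c. (\<forall>j. c j \<in> \<rat>) \<and> s * f i = (\<Sum>j<n. c j * f j)" if s: "s \<in> S" and i: "i < n" for s i
  proof -
    obtain c where c: "s * f i = (\<Sum>b\<in>B. c b * b)" "\<forall>b. c b \<in> \<rat>"
      using B(4)[OF s fB[OF i]] by (auto simp: rat_coeffs.lincombs_def)
    have "(\<Sum>b\<in>B. c b * b) = (\<Sum>j<n. c (f j) * f j)"
      by (rule sum.reindex_bij_betw[OF f, symmetric])
    then show ?thesis using c by (intro exI[of _ "c \<circ> f"]) auto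
  qed
  obtain M where M: "\<And>i j. M i j \<in> polyfun \<rat> I"
    "\<And>y i. i < n \<Longrightarrow> F y * f i = (\<Sum>j<n. M i j y * f j)"
    using polyfun_matrix_rep[OF S(3), of n f] stable by atomize_elim blast
  define D where "D = (\<lambda>y. mat n n (\<lambda>(i, j). M i j y))"
  have D: "D y \<in> carrier_mat n n" for y
    by (simp add: D_def)
  obtain p where p: "p \<in> mpols_over \<rat> I" "\<And>y. det (D y) = mpol_eval y p"
    using rat_coeffs.polyfun_imp_mpol[OF polyfun_det[of M I n, OF M(1)]] unfolding D_def by blast
  \<comment> \<open>Because \<open>F x = 0\<close>, the column of the \<open>f i\<close> is a
    non-zero kernel vector.\<close>
  have "det (D x) = 0"
  proof -
    have "vec n f \<noteq> 0\<^sub>v n"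
    proof
      assume "vec n f = 0\<^sub>v n"
      then have "f i = 0" if "i < n" for i
        using that by (metis index_vec index_zero_vec(1))
      then have "(1::rat) = 0"
        using f0[of "\<lambda>_. 1" 0] n by simp
      then show False by simp
    qed
    moreover have "D x *\<^sub>v vec n f = 0\<^sub>v n"
    proof (rule eq_vecI)
      fix i assume "i < dim_vec (0\<^sub>v n :: 'a vec)"
      then have i: "i < n" by simp
      then have "(D x *\<^sub>v vec n f) $ i = (\<Sum>j<n. M i j x * f j)"
        by (simp add: D_def scalar_prod_def atLeast0LessThan)
      also have "\<dots> = 0"
        using M(2)[OF i, of x] zero by simp
      finally show "(D x *\<^sub>v vec n f) $ i = 0\<^sub>v n $ i"
        using i by simp
    qed (simp add: D_def)
    ultimately show ?thesis
      unfolding det_0_iff_vec_prod_zero[OF D] by (intro exI[of _ "vec n f"]) auto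
  qed
  then have "p = 0"
    using indep p unfolding alg_independent_def by metis
  then have det0: "det (D y) = 0" for y
    using p(2) by (simp add: mpol_eval_zero)
  have "F y = 0" if y: "\<And>i. i \<in> I \<Longrightarrow> y i \<in> \<rat>" for y
  proof -
    have "\<exists>q. M i j y = of_rat q" for i j
      using polyfun_rational_value[OF M(1)[of i j], of y, OF y] unfolding Rats_def by blast
    then obtain q where q: "\<And>i j. M i j y = of_rat (q i j)"
      by metis
    define Q where "Q = mat n n (\<lambda>(i, j). q i j)"
    have Q: "Q \<in> carrier_mat n n" by (simp add: Q_def)
    have "D y = map_mat of_rat Q"
      by (rule eq_matI) (auto simp: D_def Q_def q)
    then have "of_rat (det Q) = (0 :: 'a)"
      using det0[of y] by (simp add: of_rat_hom.hom_det)
    \<comment> \<open>A left kernel vector \<open>v\<close> is required: weighting the expansions of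
      \<open>F y * f i\<close> by the entries of \<open>v\<close> annihilates their right sides. As
      \<open>v\<close> is rational, independence keeps the weighted sum of the \<open>f i\<close>
      non-zero, so \<open>F y\<close> must be 0.\<close>
    then have "det (transpose_mat Q) = 0"
      using det_transpose[OF Q] by simp
    then obtain v where v: "v \<in> carrier_vec n" "v \<noteq> 0\<^sub>v n" "transpose_mat Q *\<^sub>v v = 0\<^sub>v n"
      using det_0_iff_vec_prod_zero[of "transpose_mat Q" n] Q by auto
    have col: "(\<Sum>i<n. q i j * v $ i) = 0" if j: "j < n" for j
    proof -
      have "(transpose_mat Q *\<^sub>v v) $ j = (\<Sum>i<n. q i j * v $ i)"
        using j v(1) by (simp add: Q_def scalar_prod_def atLeast0LessThan)
      then show ?thesis using v(3) j by simp
    qed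
    have "F y * (\<Sum>i<n. of_rat (v $ i) * f i) = (\<Sum>i<n. of_rat (v $ i) * (F y * f i))"
      by (simp add: sum_distrib_left mult_ac)
    also have "\<dots> = (\<Sum>i<n. of_rat (v $ i) * (\<Sum>j<n. of_rat (q i j) * f j))"
      using M(2) by (intro sum.cong) (auto simp: q)
    also have "\<dots> = (\<Sum>j<n. of_rat (\<Sum>i<n. q i j * v $ i) * f j)"
      unfolding of_rat_sum sum_distrib_left sum_distrib_right
      by (subst sum.swap) (simp add: of_rat_mult mult_ac)
    also have "\<dots> = 0"
      by (simp add: col)
    finally have "F y = 0 \<or> (\<Sum>i<n. of_rat (v $ i) * f i) = 0"
      by simp
    moreover have "(\<Sum>i<n. of_rat (v $ i) * f i) \<noteq> 0"
    proof
      assume "(\<Sum>i<n. of_rat (v $ i) * f i) = 0"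
      then have "v $ i = 0" if "i < n" for i
        using f0 that by blast
      then have "v = 0\<^sub>v n"
        using v(1) by (intro eq_vecI) auto
      then show False
        using v(2) by simp
    qed
    ultimately show ?thesis by simp
  qed
  then show ?thesis
    using polyfun_eq_0_if_0_on_rationals[OF F \<open>finite I\<close>, of y] by blast
qed

subsection \<open>The group ring modulo the norm element\<close>

locale finite_group = group G for G :: "'a monoid" (structure) +
  assumes fin: "finite (carrier G)"
begin

section \<open>Sums over the group and convolution\<close>

lemma sum_lmult:
  assumes "k \<in> carrier G"
  shows "(\<Sum>h\<in>carrier G. f (k \<otimes> h)) = (\<Sum>h\<in>carrier G. f h)"
  by (rule sum.reindex_bij_witness[of _ "\<lambda>h. inv k \<otimes> h" "\<lambda>h. k \<otimes> h"])
     (use assms in \<open>auto simp: m_assoc[symmetric]\<close>)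

lemma sum_rmult:
  assumes "k \<in> carrier G"
  shows "(\<Sum>h\<in>carrier G. f (h \<otimes> k)) = (\<Sum>h\<in>carrier G. f h)"
  by (rule sum.reindex_bij_witness[of _ "\<lambda>h. h \<otimes> inv k" "\<lambda>h. h \<otimes> k"])
     (use assms in \<open>auto simp: m_assoc\<close>)

lemma sum_inv: "(\<Sum>h\<in>carrier G. f (inv h)) = (\<Sum>h\<in>carrier G. f h)"
  by (rule sum.reindex_bij_witness[of _ "\<lambda>h. inv h" "\<lambda>h. inv h"]) auto

text \<open>The group ring product without the cut-off outside the group, so that identities hold
  for arbitrary functions at arguments in the group.\<close>

definition gconv :: "('a \<Rightarrow> 'f::field) \<Rightarrow> ('a \<Rightarrow> 'f) \<Rightarrow> 'a \<Rightarrow> 'f" where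
  "gconv a b g = (\<Sum>h\<in>carrier G. a h * b (inv h \<otimes> g))"

lemma gconv_cong:
  assumes "\<And>g. g \<in> carrier G \<Longrightarrow> a g = a' g" "\<And>g. g \<in> carrier G \<Longrightarrow> b g = b' g" "g \<in> carrier G"
  shows "gconv a b g = gconv a' b' g"
  unfolding gconv_def using assms by (intro sum.cong) auto

lemma gconv_assoc:
  assumes g: "g \<in> carrier G"
  shows "gconv (gconv a b) c g = gconv a (gconv b c) g"
proof -
  have "gconv (gconv a b) c g
      = (\<Sum>k\<in>carrier G. \<Sum>h\<in>carrier G. a k * b (inv k \<otimes> h) * c (inv h \<otimes> g))"
    unfolding gconv_def sum_distrib_right by (rule sum.swap)
  also have "\<dots> = (\<Sum>k\<in>carrier G. \<Sum>h\<in>carrier G. a k * b (inv k \<otimes> (k \<otimes> h)) * c (inv (k \<otimes> h) \<otimes> g))"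
    by (intro sum.cong refl sum_lmult[symmetric])
  also have "\<dots> = gconv a (gconv b c) g"
    unfolding gconv_def sum_distrib_left using g
    by (intro sum.cong refl) (simp add: m_assoc[symmetric] inv_mult_group mult.assoc)
  finally show ?thesis .
qed

text \<open>The augmentation map is multiplicative; this keeps all convolution powers in the
  sum-zero part.\<close>

lemma sum_gconv: "(\<Sum>g\<in>carrier G. gconv a b g) = (\<Sum>g\<in>carrier G. a g) * (\<Sum>g\<in>carrier G. b g)"
proof -
  have "(\<Sum>g\<in>carrier G. gconv a b g) = (\<Sum>h\<in>carrier G. a h * (\<Sum>g\<in>carrier G. b (inv h \<otimes> g)))"
    unfolding gconv_def sum_distrib_left by (rule sum.swap)
  also have "\<dots> = (\<Sum>h\<in>carrier G. a h * (\<Sum>g\<in>carrier G. b g))"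
    by (intro sum.cong refl arg_cong2[where f = "(*)"] sum_lmult) auto
  finally show ?thesis by (simp add: sum_distrib_right)
qed

lemma group_ring_simps:
  "carrier (group_ring G) = {a. \<forall>g. g \<notin> carrier G \<longrightarrow> a g = 0}"
  "a \<otimes>\<^bsub>group_ring G\<^esub> b = (\<lambda>g. if g \<in> carrier G then gconv a b g else 0)"
  "\<one>\<^bsub>group_ring G\<^esub> = (\<lambda>g. if g = \<one> then 1 else 0)"
  "\<zero>\<^bsub>group_ring G\<^esub> = (\<lambda>g. 0)"
  "a \<oplus>\<^bsub>group_ring G\<^esub> b = (\<lambda>g. a g + b g)"
  by (simp_all add: group_ring_def gconv_def fun_eq_iff)

definition single :: "'f::field \<Rightarrow> 'a \<Rightarrow> 'a \<Rightarrow> 'f" where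
  "single c g = (\<lambda>h. if h = g then c else 0)"

lemma single_carrier: "g \<in> carrier G \<Longrightarrow> single c g \<in> carrier (group_ring G)"
  by (auto simp: group_ring_simps single_def)

lemma gconv_single_left:
  assumes "g \<in> carrier G"
  shows "gconv (single c g) a k = c * a (inv g \<otimes> k)"
proof -
  have "gconv (single c g) a k = (\<Sum>h\<in>carrier G. if h = g then c * a (inv h \<otimes> k) else 0)"
    unfolding gconv_def single_def by (intro sum.cong) auto
  then show ?thesis using assms fin by simp
qed

lemma gconv_single_right:
  assumes "g \<in> carrier G" "k \<in> carrier G"
  shows "gconv a (single c g) k = a (k \<otimes> inv g) * c"
proof -
  have "gconv a (single c g) k = (\<Sum>h\<in>carrier G. if h = k \<otimes> inv g then a h * c else 0)"
    unfolding gconv_def single_def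
  proof (intro sum.cong refl)
    fix h assume "h \<in> carrier G"
    then have "inv h \<otimes> k = g \<longleftrightarrow> h = k \<otimes> inv g"
      using assms by (metis inv_closed inv_solve_left inv_solve_right m_closed)
    then show "a h * (if inv h \<otimes> k = g then c else 0) = (if h = k \<otimes> inv g then a h * c else 0)"
      by auto
  qed
  then show ?thesis using assms fin by simp
qed

lemma group_ring_ring: "ring (group_ring G :: ('a \<Rightarrow> 'f::field) ring)"
proof (rule ringI)
  show "abelian_group (group_ring G :: ('a \<Rightarrow> 'f) ring)"
  proof (rule abelian_groupI)
    fix x :: "'a \<Rightarrow> 'f" assume "x \<in> carrier (group_ring G)"
    then show "\<exists>y\<in>carrier (group_ring G). y \<oplus>\<^bsub>group_ring G\<^esub> x = \<zero>\<^bsub>group_ring G\<^esub>"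
      by (intro bexI[of _ "\<lambda>g. - x g"]) (auto simp: group_ring_simps)
  qed (auto simp: group_ring_simps fun_eq_iff add_ac)
  have one: "\<one>\<^bsub>group_ring G\<^esub> = (single 1 \<one> :: 'a \<Rightarrow> 'f)"
    by (simp add: group_ring_simps single_def)
  show "monoid (group_ring G :: ('a \<Rightarrow> 'f) ring)"
  proof (rule monoidI)
    fix x y z :: "'a \<Rightarrow> 'f"
    assume "x \<in> carrier (group_ring G)" "y \<in> carrier (group_ring G)" "z \<in> carrier (group_ring G)"
    have "gconv (\<lambda>g. if g \<in> carrier G then gconv x y g else 0) z g = gconv (gconv x y) z g"
      "gconv x (\<lambda>g. if g \<in> carrier G then gconv y z g else 0) g = gconv x (gconv y z) g"
      if "g \<in> carrier G" for g
      using that by (auto intro!: gconv_cong)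
    then show "x \<otimes>\<^bsub>group_ring G\<^esub> y \<otimes>\<^bsub>group_ring G\<^esub> z = x \<otimes>\<^bsub>group_ring G\<^esub> (y \<otimes>\<^bsub>group_ring G\<^esub> z)"
      by (auto simp: group_ring_simps fun_eq_iff gconv_assoc)
  next
    fix x :: "'a \<Rightarrow> 'f" assume x: "x \<in> carrier (group_ring G)"
    then show "\<one>\<^bsub>group_ring G\<^esub> \<otimes>\<^bsub>group_ring G\<^esub> x = x" "x \<otimes>\<^bsub>group_ring G\<^esub> \<one>\<^bsub>group_ring G\<^esub> = x"
      unfolding one by (auto simp: group_ring_simps fun_eq_iff gconv_single_left gconv_single_right)
  qed (auto simp: group_ring_simps)
qed (auto simp: group_ring_simps fun_eq_iff gconv_def algebra_simps sum.distrib)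

lemma norm_elt_carrier: "norm_elt G \<in> carrier (group_ring G)"
  by (auto simp: group_ring_simps norm_elt_def)

text \<open>Convolving a constant function with anything gives a constant function, so the scalar
  multiples of the norm element are closed under products from both sides. They bound the ideal it
  generates from above.\<close>

lemma norm_multiples_ideal:
  "ideal {\<lambda>g. if g \<in> carrier G then c else 0 | c. True} (group_ring G :: ('a \<Rightarrow> 'f::field) ring)"
  (is "ideal ?I ?R")
proof (rule idealI[OF group_ring_ring])
  interpret R: ring ?R by (rule group_ring_ring)
  show "subgroup ?I (add_monoid ?R)"
  proof (rule R.add.subgroupI)
    fix a :: "'a \<Rightarrow> 'f" assume "a \<in> ?I"
    then obtain c where c: "a = (\<lambda>g. if g \<in> carrier G then c else 0)" by auto
    have "\<ominus>\<^bsub>?R\<^esub> a = (\<lambda>g. if g \<in> carrier G then - c else 0)"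
      by (rule R.minus_equality) (auto simp: c group_ring_simps)
    then show "\<ominus>\<^bsub>?R\<^esub> a \<in> ?I" by auto
  next
    fix a b :: "'a \<Rightarrow> 'f" assume "a \<in> ?I" "b \<in> ?I"
    then obtain c d where "a = (\<lambda>g. if g \<in> carrier G then c else 0)" "b = (\<lambda>g. if g \<in> carrier G then d else 0)"
      by auto
    then have "a \<oplus>\<^bsub>?R\<^esub> b = (\<lambda>g. if g \<in> carrier G then c + d else 0)"
      by (auto simp: group_ring_simps)
    then show "a \<oplus>\<^bsub>?R\<^esub> b \<in> ?I" by auto
  qed (auto simp: group_ring_simps)
next
  fix a x :: "'a \<Rightarrow> 'f" assume "a \<in> ?I"
  then obtain c where c: "a = (\<lambda>g. if g \<in> carrier G then c else 0)" by auto
  have "gconv x a g = (\<Sum>h\<in>carrier G. x h * c)" if "g \<in> carrier G" for g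
    unfolding gconv_def c using that by (intro sum.cong) auto
  then have "x \<otimes>\<^bsub>?R\<^esub> a = (\<lambda>g. if g \<in> carrier G then \<Sum>h\<in>carrier G. x h * c else 0)"
    by (auto simp: group_ring_simps)
  then show "x \<otimes>\<^bsub>?R\<^esub> a \<in> ?I" by blast
  have "gconv a x g = (\<Sum>h\<in>carrier G. c * x h)" if g: "g \<in> carrier G" for g
  proof -
    have "gconv a x g = (\<Sum>h\<in>carrier G. c * x (inv h \<otimes> g))"
      unfolding gconv_def c by (intro sum.cong) auto
    also have "\<dots> = (\<Sum>h\<in>carrier G. c * x (h \<otimes> g))"
      by (rule sum_inv)
    also have "\<dots> = (\<Sum>h\<in>carrier G. c * x h)"
      by (rule sum_rmult[OF g])
    finally show ?thesis .
  qed
  then have "a \<otimes>\<^bsub>?R\<^esub> x = (\<lambda>g. if g \<in> carrier G then \<Sum>h\<in>carrier G. c * x h else 0)"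
    by (auto simp: group_ring_simps)
  then show "a \<otimes>\<^bsub>?R\<^esub> x \<in> ?I" by blast
qed

lemma norm_ideal_ideal: "ideal (norm_ideal G) (group_ring G :: ('a \<Rightarrow> 'f::field) ring)"
  unfolding norm_ideal_def
  by (rule ring.genideal_ideal[OF group_ring_ring]) (simp add: norm_elt_carrier)

lemma norm_elt_mem: "norm_elt G \<in> norm_ideal G"
  unfolding norm_ideal_def
  by (rule ring.genideal_self'[OF group_ring_ring]) (rule norm_elt_carrier)

lemma norm_idealE:
  assumes "a \<in> norm_ideal G"
  obtains c where "a = (\<lambda>g. if g \<in> carrier G then c else 0)"
proof -
  have "norm_ideal G \<subseteq> {\<lambda>g. if g \<in> carrier G then c else 0 | c :: 'b. True}"
    unfolding norm_ideal_def
    by (rule ring.genideal_minimal[OF group_ring_ring norm_multiples_ideal])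
       (auto simp: norm_elt_def fun_eq_iff intro: exI[of _ 1])
  then show ?thesis using assms that by blast
qed

section \<open>Classes modulo the norm element and their action\<close>

definition cls :: "('a \<Rightarrow> 'f::field) \<Rightarrow> ('a \<Rightarrow> 'f) set" where
  "cls a = norm_ideal G +>\<^bsub>group_ring G\<^esub> a"

lemma R_single_eq_cls: "R_single G c g = cls (single c g)"
  by (simp add: R_single_def cls_def single_def)

lemma R_carrier: "carrier (R_ring G) = cls ` carrier (group_ring G)"
  by (auto simp: R_ring_def FactRing_def A_RCOSETS_def' cls_def)

lemma cls_hom: "cls \<in> Ring.ring_hom (group_ring G) (R_ring G)"
  unfolding R_ring_def cls_def by (rule ideal.rcos_ring_hom[OF norm_ideal_ideal])

lemma cls_mult:
  "a \<in> carrier (group_ring G) \<Longrightarrow> b \<in> carrier (group_ring G) \<Longrightarrow>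
   cls a \<otimes>\<^bsub>R_ring G\<^esub> cls b = cls (a \<otimes>\<^bsub>group_ring G\<^esub> b)"
  by (rule ring_hom_mult[OF cls_hom, symmetric])

lemma cls_add:
  "a \<in> carrier (group_ring G) \<Longrightarrow> b \<in> carrier (group_ring G) \<Longrightarrow>
   cls a \<oplus>\<^bsub>R_ring G\<^esub> cls b = cls (a \<oplus>\<^bsub>group_ring G\<^esub> b)"
  by (rule ring_hom_add[OF cls_hom, symmetric])

lemma cls_self: "a \<in> carrier (group_ring G) \<Longrightarrow> a \<in> cls a"
  unfolding cls_def
  by (rule abelian_subgroup.a_rcos_self)
     (use norm_ideal_ideal ideal.axioms(1) group_ring_ring ring_def abelian_subgroupI3 additive_subgroup.a_subgroup in \<open>blast+\<close>)

lemma cls_norm_elt: "cls (norm_elt G) = cls (\<lambda>_. 0 :: 'f::field)"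
proof -
  interpret I: ideal "norm_ideal G" "group_ring G :: ('a \<Rightarrow> 'f) ring"
    by (rule norm_ideal_ideal)
  have "norm_ideal G +>\<^bsub>group_ring G\<^esub> norm_elt G = (norm_ideal G :: ('a \<Rightarrow> 'f) set)"
    by (rule I.a_rcos_const[OF norm_elt_mem])
  moreover have "norm_ideal G +>\<^bsub>group_ring G\<^esub> \<zero>\<^bsub>group_ring G\<^esub> = (norm_ideal G :: ('a \<Rightarrow> 'f) set)"
    by (rule I.a_rcos_const) (rule additive_subgroup.zero_closed[OF ideal.axioms(1)[OF norm_ideal_ideal]])
  ultimately show ?thesis by (simp add: cls_def group_ring_simps)
qed

text \<open>Representatives differ by \<open>c\<close> times the norm element, which acts on
  \<open>v\<close> through \<open>c\<close> times its coordinate sum, that is by 0. So the set in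
  \<open>R_act\<close> is a singleton and \<open>the_elem\<close> is meaningful.\<close>

lemma R_act_cls:
  assumes a: "a \<in> carrier (group_ring G)" and v: "(\<Sum>g\<in>carrier G. v g) = 0"
  shows "R_act G (cls a) v = group_ring_act G a v"
proof -
  have "group_ring_act G b v = group_ring_act G a v" if b: "b \<in> cls a" for b
  proof -
    obtain i where i: "i \<in> norm_ideal G" "b = i \<oplus>\<^bsub>group_ring G\<^esub> a"
      using b by (auto simp: cls_def a_r_coset_def')
    obtain c where c: "i = (\<lambda>g. if g \<in> carrier G then c else 0)"
      using norm_idealE[OF i(1)] by blast
    have "(\<Sum>g\<in>carrier G. b g * v (h \<otimes> g)) = (\<Sum>g\<in>carrier G. a g * v (h \<otimes> g))"
      if h: "h \<in> carrier G" for h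
    proof -
      have "(\<Sum>g\<in>carrier G. b g * v (h \<otimes> g))
          = (\<Sum>g\<in>carrier G. c * v (h \<otimes> g) + a g * v (h \<otimes> g))"
        by (intro sum.cong) (auto simp: i(2) c group_ring_simps distrib_right)
      also have "\<dots> = c * (\<Sum>g\<in>carrier G. v (h \<otimes> g)) + (\<Sum>g\<in>carrier G. a g * v (h \<otimes> g))"
        by (simp add: sum.distrib sum_distrib_left)
      also have "(\<Sum>g\<in>carrier G. v (h \<otimes> g)) = 0"
        using sum_lmult[OF h, of v] v by simp
      finally show ?thesis by simp
    qed
    then show ?thesis
      by (auto simp: group_ring_act_def fun_eq_iff)
  qed
  then have "(\<lambda>b. group_ring_act G b v) ` cls a = {group_ring_act G a v}"
    using cls_self[OF a] by blast
  then show ?thesis by (simp add: R_act_def)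
qed

text \<open>A group element acts by right translation of the index; with \<open>sum_rmult\<close>
  this gives the invariance of Gram forms.\<close>

lemma group_ring_act_single_mult:
  assumes "g \<in> carrier G" "h \<in> carrier G"
  shows "group_ring_act G (single c g \<otimes>\<^bsub>group_ring G\<^esub> a) v h = c * group_ring_act G a v (h \<otimes> g)"
proof -
  have "group_ring_act G (single c g \<otimes>\<^bsub>group_ring G\<^esub> a) v h
      = (\<Sum>k\<in>carrier G. c * a (inv g \<otimes> k) * v (h \<otimes> k))"
    using assms unfolding group_ring_act_def
    by (auto simp: group_ring_simps gconv_single_left intro!: sum.cong)
  also have "\<dots> = (\<Sum>k\<in>carrier G. c * a (inv g \<otimes> (g \<otimes> k)) * v (h \<otimes> (g \<otimes> k)))"
    by (rule sum_lmult[OF assms(1), symmetric])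
  also have "\<dots> = (\<Sum>k\<in>carrier G. c * (a k * v (h \<otimes> g \<otimes> k)))"
    using assms by (intro sum.cong refl) (simp add: m_assoc[symmetric] mult.assoc)
  also have "\<dots> = c * group_ring_act G a v (h \<otimes> g)"
    using assms by (simp add: group_ring_act_def sum_distrib_left)
  finally show ?thesis .
qed

lemma group_ring_act_single:
  assumes "g \<in> carrier G" "h \<in> carrier G"
  shows "group_ring_act G (single c g) v h = c * v (h \<otimes> g)"
proof -
  have "group_ring_act G (single c g) v h = (\<Sum>k\<in>carrier G. if k = g then c * v (h \<otimes> k) else 0)"
    using assms unfolding group_ring_act_def single_def by (auto intro!: sum.cong)
  then show ?thesis using assms fin by simp
qed

lemma mult_carrier: "a \<otimes>\<^bsub>group_ring G\<^esub> b \<in> carrier (group_ring G)"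
  by (simp add: group_ring_simps)

lemma gram_form_cls:
  assumes "(\<Sum>g\<in>carrier G. v g) = 0" "a \<in> carrier (group_ring G)" "b \<in> carrier (group_ring G)"
  shows "gram_form G v (cls a) (cls b)
    = (\<Sum>h\<in>carrier G. group_ring_act G a v h * group_ring_act G b v h)"
  using assms by (simp add: gram_form_def R_act_cls)

section \<open>Invariant symmetric forms in coordinates\<close>

lemma gram_form_in_sym_forms:
  assumes v: "(\<Sum>g\<in>carrier G. v g) = 0"
  shows "gram_form G v \<in> sym_forms G"
proof -
  note [simp] = gram_form_cls[OF v] cls_mult cls_add mult_carrier single_carrier
  have add_carrier [simp]: "a \<oplus>\<^bsub>group_ring G\<^esub> b \<in> carrier (group_ring G)"
    if "a \<in> carrier (group_ring G)" "b \<in> carrier (group_ring G)" for a b :: "'a \<Rightarrow> 'b"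
    using that by (simp add: group_ring_simps)
  have "gram_form G v (cls (a \<oplus>\<^bsub>group_ring G\<^esub> a')) (cls b)
      = gram_form G v (cls a) (cls b) + gram_form G v (cls a') (cls b)"
    if "a \<in> carrier (group_ring G)" "a' \<in> carrier (group_ring G)" "b \<in> carrier (group_ring G)" for a a' b
  proof -
    have "group_ring_act G (a \<oplus>\<^bsub>group_ring G\<^esub> a') v h = group_ring_act G a v h + group_ring_act G a' v h"
      if "h \<in> carrier G" for h
      using that by (simp add: group_ring_act_def group_ring_simps distrib_right sum.distrib)
    then show ?thesis
      using that by (simp add: distrib_right sum.distrib)
  qed
  moreover have "gram_form G v (cls (single c \<one> \<otimes>\<^bsub>group_ring G\<^esub> a)) (cls b) = c * gram_form G v (cls a) (cls b)"
    if "a \<in> carrier (group_ring G)" "b \<in> carrier (group_ring G)" for a b c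
    using that by (simp add: group_ring_act_single_mult sum_distrib_left mult.assoc)
  moreover have "gram_form G v (cls (single 1 g \<otimes>\<^bsub>group_ring G\<^esub> a)) (cls (single 1 g \<otimes>\<^bsub>group_ring G\<^esub> b))
      = gram_form G v (cls a) (cls b)"
    if "g \<in> carrier G" "a \<in> carrier (group_ring G)" "b \<in> carrier (group_ring G)" for a b g
    using that by (simp add: group_ring_act_single_mult
        sum_rmult[of g "\<lambda>h. group_ring_act G a v h * group_ring_act G b v h"])
  ultimately show ?thesis
    unfolding sym_forms_def R_carrier R_single_eq_cls
    by (auto simp: mult.commute)
qed

lemma form_coords_gram_form:
  assumes "(\<Sum>g\<in>carrier G. v g) = 0" "g \<in> carrier G" "h \<in> carrier G"
  shows "form_coords G (gram_form G v) (g, h) = (\<Sum>k\<in>carrier G. v (k \<otimes> g) * v (k \<otimes> h))"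
  using assms
  by (simp add: form_coords_def R_single_eq_cls gram_form_cls single_carrier group_ring_act_single)

text \<open>Take \<open>\<phi> g = b(1, g)\<close>. Invariance moves the pair \<open>(g, h)\<close>
  to \<open>(1, inv g \<otimes> h)\<close>; symmetry gives
  \<open>b(1, inv g) = b(g, 1) = b(1, g)\<close>; the sum of all values is the form at the norm
  element and 1, which is 0 because the class of the norm element is 0.\<close>

lemma sym_form_coords:
  assumes b: "b \<in> sym_forms G"
  obtains \<phi> where "\<And>g. g \<in> carrier G \<Longrightarrow> \<phi> (inv g) = \<phi> g" "(\<Sum>g\<in>carrier G. \<phi> g) = 0"
    "\<And>g h. g \<in> carrier G \<Longrightarrow> h \<in> carrier G \<Longrightarrow> form_coords G b (g, h) = \<phi> (inv g \<otimes> h)"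
proof -
  define \<beta> where "\<beta> = (\<lambda>a a'. b (cls a) (cls a'))"
  have sym: "\<beta> a a' = \<beta> a' a"
    if "a \<in> carrier (group_ring G)" "a' \<in> carrier (group_ring G)" for a a'
    using b that unfolding sym_forms_def R_carrier \<beta>_def by blast
  have add: "\<beta> (a \<oplus>\<^bsub>group_ring G\<^esub> a') c = \<beta> a c + \<beta> a' c"
    if "a \<in> carrier (group_ring G)" "a' \<in> carrier (group_ring G)" "c \<in> carrier (group_ring G)" for a a' c
    using b that unfolding sym_forms_def R_carrier \<beta>_def by (auto simp: cls_add)
  have inv': "\<beta> (single 1 g \<otimes>\<^bsub>group_ring G\<^esub> a) (single 1 g \<otimes>\<^bsub>group_ring G\<^esub> a') = \<beta> a a'"
    if "g \<in> carrier G" "a \<in> carrier (group_ring G)" "a' \<in> carrier (group_ring G)" for a a' g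
    using b that unfolding sym_forms_def R_carrier \<beta>_def R_single_eq_cls
    by (auto simp: cls_mult single_carrier)
  have single_mult: "single 1 g \<otimes>\<^bsub>group_ring G\<^esub> single 1 h = (single 1 (g \<otimes> h) :: 'a \<Rightarrow> 'b)"
    if "g \<in> carrier G" "h \<in> carrier G" for g h
  proof
    fix k show "(single 1 g \<otimes>\<^bsub>group_ring G\<^esub> single 1 h) k = (single 1 (g \<otimes> h) k :: 'b)"
    proof (cases "k \<in> carrier G")
      case True
      then have "inv g \<otimes> k = h \<longleftrightarrow> k = g \<otimes> h"
        using that by (metis inv_closed inv_solve_left)
      then show ?thesis
        using that True by (simp add: group_ring_simps gconv_single_left) (simp add: single_def)
    next
      case False
      then show ?thesis using that by (auto simp: group_ring_simps single_def)
    qed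
  qed
  have inv_single: "\<beta> (single 1 (k \<otimes> g)) (single 1 (k \<otimes> h)) = \<beta> (single 1 g) (single 1 h)"
    if "k \<in> carrier G" "g \<in> carrier G" "h \<in> carrier G" for g h k
    using inv'[of k "single 1 g" "single 1 h"] that by (simp add: single_mult single_carrier)
  define \<phi> where "\<phi> = (\<lambda>g. \<beta> (single 1 \<one>) (single 1 g))"
  have sum: "\<beta> (\<lambda>g. if g \<in> A then 1 else 0) c = (\<Sum>g\<in>A. \<beta> (single 1 g) c)"
    if "finite A" "A \<subseteq> carrier G" "c \<in> carrier (group_ring G)" for A c
    using that
  proof (induction A rule: finite_induct)
    case empty
    have z: "(\<lambda>_. 0) \<in> carrier (group_ring G)" by (simp add: group_ring_simps)
    have "\<beta> (\<lambda>_. 0) c = \<beta> (\<lambda>_. 0) c + \<beta> (\<lambda>_. 0) c"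
      using add[OF z z empty(2)] by (simp only: group_ring_simps add_0_left)
    then have "\<beta> (\<lambda>_. 0) c = 0"
      by (metis add_cancel_left_left)
    then show ?case by simp
  next
    case (insert x A)
    have "(\<lambda>g. if g \<in> insert x A then 1 else 0)
        = single 1 x \<oplus>\<^bsub>group_ring G\<^esub> (\<lambda>g. if g \<in> A then 1 else 0 :: 'b)"
      using insert.hyps by (auto simp: group_ring_simps single_def)
    moreover have "(\<lambda>g. if g \<in> A then 1 else 0 :: 'b) \<in> carrier (group_ring G)"
      using insert.prems by (auto simp: group_ring_simps)
    ultimately have "\<beta> (\<lambda>g. if g \<in> insert x A then 1 else 0) c
        = \<beta> (single 1 x) c + \<beta> (\<lambda>g. if g \<in> A then 1 else 0) c"
      using insert.prems by (simp only: add single_carrier insert_subset)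
    then show ?case
      using insert by simp
  qed
  show ?thesis
  proof (rule that[of \<phi>])
    fix g assume g: "g \<in> carrier G"
    have "\<phi> (inv g) = \<beta> (single 1 g) (single 1 \<one>)"
      using inv_single[of g \<one> "inv g"] g by (simp add: \<phi>_def)
    then show "\<phi> (inv g) = \<phi> g"
      using sym g by (simp add: \<phi>_def single_carrier)
  next
    have "(\<Sum>g\<in>carrier G. \<phi> g) = (\<Sum>g\<in>carrier G. \<beta> (single 1 g) (single 1 \<one>))"
      using sym by (intro sum.cong) (auto simp: \<phi>_def single_carrier)
    also have "\<dots> = \<beta> (norm_elt G) (single 1 \<one>)"
      using sum[OF fin] by (simp add: norm_elt_def single_carrier)
    also have "\<dots> = \<beta> (\<lambda>_. 0) (single 1 \<one>)"
      by (simp add: \<beta>_def cls_norm_elt)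
    also have "\<dots> = 0"
      using sum[of "{}" "single 1 \<one>"] by (simp add: single_carrier)
    finally show "(\<Sum>g\<in>carrier G. \<phi> g) = 0" .
  next
    fix g h assume "g \<in> carrier G" "h \<in> carrier G"
    then show "form_coords G b (g, h) = \<phi> (inv g \<otimes> h)"
      using inv_single[of "inv g" g h]
      by (simp add: \<phi>_def form_coords_def R_single_eq_cls \<beta>_def)
  qed
qed

end

subsection \<open>Density of the Gram forms\<close>

text \<open>Consecutive coefficients have ratio \<open>(1/2 - k) / (k + 1)\<close>, of modulus at
  most 1. A geometric series can then dominate the square root series.\<close>

lemma norm_half_gchoose_le_1: "cmod ((1/2) gchoose k) \<le> 1"
proof (induction k)
  case (Suc k)
  have "((1/2 :: complex) gchoose Suc k) = ((1/2) gchoose k) * ((1/2 - of_nat k) / of_nat (Suc k))"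
    using gbinomial_mult_1[of "1/2 :: complex" k] by (simp add: field_simps del: of_nat_Suc)
  moreover have "cmod ((1/2 - of_nat k) / of_nat (Suc k)) \<le> 1"
  proof -
    have "cmod (1/2 - of_nat k) \<le> 1 + real k"
      using norm_triangle_ineq4[of "1/2 :: complex" "of_nat k"] by (simp add: norm_divide)
    then show ?thesis
      by (simp add: norm_divide divide_le_eq del: of_nat_Suc)
  qed
  ultimately show ?case
    using Suc by (metis mult_le_one norm_ge_zero norm_mult)
qed simp

lemma polyfun_cong:
  "F \<in> polyfun k I \<Longrightarrow> (\<And>i. i \<in> I \<Longrightarrow> x i = y i) \<Longrightarrow> F x = F y"
  by (induction rule: polyfun.induct) auto

context finite_group
begin

text \<open>The idempotent \<open>1 - N / n\<close>, where \<open>N\<close> is the norm element and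
  \<open>n\<close> the group order.\<close>

definition sum_zero_unit :: "'a \<Rightarrow> complex" where
  "sum_zero_unit g = (if g = \<one> then 1 else 0) - 1 / of_nat (card (carrier G))"

text \<open>Powers within the sum-zero part, hence starting from its own unit and not from the delta
  function at \<open>\<one>\<close>.\<close>

primrec conv_pow :: "('a \<Rightarrow> complex) \<Rightarrow> nat \<Rightarrow> 'a \<Rightarrow> complex" where
  "conv_pow \<phi> 0 = sum_zero_unit"
| "conv_pow \<phi> (Suc k) = gconv \<phi> (conv_pow \<phi> k)"

lemma card_pos: "card (carrier G) > 0"
  using fin one_closed by (auto simp: card_gt_0_iff)

lemma sum_sum_zero_unit: "(\<Sum>g\<in>carrier G. sum_zero_unit g) = 0"
  using one_closed fin by (auto simp: sum_zero_unit_def sum_subtractf)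

lemma sum_zero_unit_inv: "g \<in> carrier G \<Longrightarrow> sum_zero_unit (inv g) = sum_zero_unit g"
  by (simp add: sum_zero_unit_def)

lemma gconv_sum_zero_unit_left:
  assumes "(\<Sum>g\<in>carrier G. a g) = 0" "g \<in> carrier G"
  shows "gconv sum_zero_unit a g = a g"
proof -
  let ?n = "of_nat (card (carrier G)) :: complex"
  have "gconv sum_zero_unit a g
      = (\<Sum>h\<in>carrier G. (if h = \<one> then a (inv h \<otimes> g) else 0) - (1 / ?n) * a (inv h \<otimes> g))"
    unfolding gconv_def sum_zero_unit_def by (intro sum.cong) (auto simp: left_diff_distrib)
  also have "\<dots> = a g - (1 / ?n) * (\<Sum>h\<in>carrier G. a (inv h \<otimes> g))"
    using assms fin by (simp add: sum_subtractf sum_distrib_left)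
  also have "(\<Sum>h\<in>carrier G. a (inv h \<otimes> g)) = 0"
    using sum_inv[of "\<lambda>h. a (h \<otimes> g)"] sum_rmult[OF assms(2), of a] assms(1) by simp
  finally show ?thesis by simp
qed

text \<open>Inverting the argument is an anti-automorphism of the convolution algebra; on functions
  invariant under it only the swap of the factors remains.\<close>

lemma gconv_inv:
  assumes "\<And>g. g \<in> carrier G \<Longrightarrow> a (inv g) = a g" "\<And>g. g \<in> carrier G \<Longrightarrow> b (inv g) = b g"
    and g: "g \<in> carrier G"
  shows "gconv a b (inv g) = gconv b a g"
proof -
  have "gconv b a g = (\<Sum>h\<in>carrier G. b (g \<otimes> h) * a (inv (g \<otimes> h) \<otimes> g))"
    unfolding gconv_def by (rule sum_lmult[OF g, symmetric])
  also have "\<dots> = gconv a b (inv g)"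
    unfolding gconv_def
  proof (intro sum.cong refl)
    fix h assume h: "h \<in> carrier G"
    have "inv (g \<otimes> h) \<otimes> g = inv h"
      using g h by (simp add: inv_mult_group m_assoc)
    moreover have "inv h \<otimes> inv g = inv (g \<otimes> h)"
      using g h by (simp add: inv_mult_group)
    ultimately show "b (g \<otimes> h) * a (inv (g \<otimes> h) \<otimes> g) = a h * b (inv h \<otimes> inv g)"
      using assms g h by simp
  qed
  finally show ?thesis by simp
qed

lemma gconv_sum_zero_unit_right:
  assumes "(\<Sum>g\<in>carrier G. a g) = 0" "\<And>g. g \<in> carrier G \<Longrightarrow> a (inv g) = a g" "g \<in> carrier G"
  shows "gconv a sum_zero_unit g = a g"
  using gconv_inv[of sum_zero_unit a g] gconv_sum_zero_unit_left[of a "inv g"] assms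
  by (simp add: sum_zero_unit_inv)

text \<open>The binomial series \<open>\<Sum>\<^sub>k (1/2 choose k) t\<^sup>k \<phi>\<^sup>k\<close> converges for small \<open>t\<close> to a square root of
  \<open>1 + t \<phi>\<close> in the sum-zero part of the group algebra; it is self-adjoint, so its Gram form is
  \<open>1 + t \<phi>\<close>.\<close>

lemma gram_sqrt_exists:
  assumes sym: "\<And>g. g \<in> carrier G \<Longrightarrow> \<phi> (inv g) = \<phi> g" and sum0: "(\<Sum>g\<in>carrier G. \<phi> g) = 0"
  obtains r where "r > 0"
    "\<And>t. cmod t < r \<Longrightarrow> \<exists>x. (\<Sum>g\<in>carrier G. x g) = 0 \<and>
      (\<forall>g\<in>carrier G. \<forall>h\<in>carrier G. (\<Sum>k\<in>carrier G. x (k \<otimes> g) * x (k \<otimes> h))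
         = sum_zero_unit (inv g \<otimes> h) + t * \<phi> (inv g \<otimes> h))"
proof -
  \<comment> \<open>Convolution with \<open>\<phi>\<close> enlarges the maximal modulus at most by
    the sum of the \<open>cmod (\<phi> g)\<close>. The added 1 makes \<open>1 / C\<close> a positive
    radius even for \<open>\<phi> = 0\<close>.\<close>
  define C where "C = 1 + (\<Sum>g\<in>carrier G. cmod (\<phi> g))"
  have C: "C \<ge> 1"
    by (simp add: C_def sum_nonneg)
  let ?P = "conv_pow \<phi>"
  have sumP: "(\<Sum>g\<in>carrier G. ?P k g) = 0" for k
    by (cases k) (simp_all add: sum_sum_zero_unit sum_gconv sum0)
  have P1: "?P 1 g = \<phi> g" if "g \<in> carrier G" for g
    using gconv_sum_zero_unit_right[OF sum0 sym that] by simp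
  have P_add: "gconv (?P i) (?P j) g = ?P (i + j) g" if "g \<in> carrier G" for i j g
    using that
  proof (induction i arbitrary: g)
    case 0
    then show ?case by (simp add: gconv_sum_zero_unit_left sumP)
  next
    case (Suc i)
    then have "gconv (?P (Suc i)) (?P j) g = gconv \<phi> (gconv (?P i) (?P j)) g"
      by (simp add: gconv_assoc)
    also have "\<dots> = gconv \<phi> (?P (i + j)) g"
      using Suc by (intro gconv_cong) auto
    finally show ?case by simp
  qed
  \<comment> \<open>The swap caused by inversion is undone by \<open>P_add\<close>: powers of
    \<open>\<phi>\<close> commute even if the group does not.\<close>
  have P_sym: "?P k (inv g) = ?P k g" if "g \<in> carrier G" for k g
    using that
  proof (induction k arbitrary: g)
    case 0
    then show ?case by (simp add: sum_zero_unit_inv)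
  next
    case (Suc k)
    have "?P (Suc k) (inv g) = gconv (?P k) \<phi> g"
      using Suc by (simp add: gconv_inv sym)
    also have "\<dots> = gconv (?P k) (?P 1) g"
      using Suc.prems P1 by (intro gconv_cong) auto
    finally show ?case
      using P_add[OF Suc.prems, of k 1] by simp
  qed
  have P_bound: "cmod (?P k g) \<le> C ^ k" if "g \<in> carrier G" for k g
    using that
  proof (induction k arbitrary: g)
    case 0
    have "cmod (sum_zero_unit g) \<le> 1"
    proof -
      define n where "n = card (carrier G)"
      have n: "real n \<ge> 1" using card_pos by (simp add: n_def)
      have "sum_zero_unit g = complex_of_real ((if g = \<one> then 1 else 0) - 1 / real n)"
        by (simp add: sum_zero_unit_def n_def)
      then have "cmod (sum_zero_unit g) = \<bar>(if g = \<one> then 1 else 0) - 1 / real n\<bar>"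
        by (simp only: norm_of_real)
      also have "\<dots> \<le> 1" using n by auto
      finally show ?thesis .
    qed
    then show ?case by simp
  next
    case (Suc k)
    have "cmod (?P (Suc k) g) \<le> (\<Sum>h\<in>carrier G. cmod (\<phi> h) * cmod (?P k (inv h \<otimes> g)))"
      unfolding conv_pow.simps gconv_def by (rule order_trans[OF norm_sum]) (simp add: norm_mult)
    also have "\<dots> \<le> (\<Sum>h\<in>carrier G. cmod (\<phi> h) * C ^ k)"
      using Suc by (intro sum_mono mult_left_mono) auto
    also have "\<dots> \<le> C * C ^ k"
      using C by (simp add: C_def sum_distrib_right[symmetric] distrib_right)
    finally show ?case by simp
  qed
  have main: "\<exists>x. (\<Sum>g\<in>carrier G. x g) = 0 \<and>
      (\<forall>g\<in>carrier G. \<forall>h\<in>carrier G. (\<Sum>k\<in>carrier G. x (k \<otimes> g) * x (k \<otimes> h))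
         = sum_zero_unit (inv g \<otimes> h) + t * \<phi> (inv g \<otimes> h))" if t: "cmod t < 1 / C" for t
  proof -
    define b where "b = (\<lambda>k. ((1/2 :: complex) gchoose k))"
    define f where "f = (\<lambda>g k. b k * t ^ k * ?P k g)"
    have tC: "cmod t * C < 1"
      using t C by (simp add: field_simps)
    have summ: "summable (\<lambda>k. norm (f g k))" if g: "g \<in> carrier G" for g
    proof (rule summable_comparison_test')
      show "summable (\<lambda>k. (cmod t * C) ^ k)"
        using tC C by (intro summable_geometric) (auto simp: abs_mult)
      fix k assume "k \<ge> (0::nat)"
      have "cmod (b k) * (cmod t ^ k * cmod (?P k g)) \<le> 1 * (cmod t ^ k * C ^ k)"
        using norm_half_gchoose_le_1[of k] P_bound[OF g, of k] C
        by (intro mult_mono mult_nonneg_nonneg) (auto simp: b_def)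
      then show "norm (norm (f g k)) \<le> (cmod t * C) ^ k"
        by (simp add: f_def norm_mult norm_power power_mult_distrib mult.assoc)
    qed
    define x where "x = (\<lambda>g. suminf (f g))"
    have x_sums: "f g sums x g" if "g \<in> carrier G" for g
      unfolding x_def by (rule summable_sums[OF summable_norm_cancel[OF summ[OF that]]])
    have x_sum: "(\<Sum>g\<in>carrier G. x g) = 0"
    proof -
      have "(\<lambda>k. \<Sum>g\<in>carrier G. f g k) sums (\<Sum>g\<in>carrier G. x g)"
        by (intro sums_sum x_sums)
      moreover have "(\<lambda>k. \<Sum>g\<in>carrier G. f g k) = (\<lambda>k. 0)"
        by (simp add: f_def sum_distrib_left[symmetric] sumP)
      ultimately show ?thesis by (metis sums_unique2 sums_zero)
    qed
    have x_sym: "x (inv g) = x g" if "g \<in> carrier G" for g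
      using P_sym[OF that] by (simp add: x_def f_def)
    \<comment> \<open>Cauchy product of the series with itself: by Vandermonde the coefficient of
      \<open>t ^ N\<close> carries the factor \<open>1 gchoose N\<close>, so only
      \<open>N = 0\<close> and \<open>N = 1\<close> survive.\<close>
    have x_conv: "gconv x x g = sum_zero_unit g + t * \<phi> g" if g: "g \<in> carrier G" for g
    proof -
      have "(\<lambda>N. \<Sum>h\<in>carrier G. \<Sum>i\<le>N. f h i * f (inv h \<otimes> g) (N - i)) sums (\<Sum>h\<in>carrier G. x h * x (inv h \<otimes> g))"
        unfolding x_def using g by (intro sums_sum Cauchy_product_sums summ) auto
      moreover have "(\<Sum>h\<in>carrier G. \<Sum>i\<le>N. f h i * f (inv h \<otimes> g) (N - i))
          = (1 gchoose N) * t ^ N * ?P N g" for N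
      proof -
        have "(\<Sum>h\<in>carrier G. \<Sum>i\<le>N. f h i * f (inv h \<otimes> g) (N - i))
            = (\<Sum>i\<le>N. b i * b (N - i) * t ^ N * gconv (?P i) (?P (N - i)) g)"
        proof (subst sum.swap, intro sum.cong refl)
          fix i assume "i \<in> {..N}"
          then have "t ^ N = t ^ i * t ^ (N - i)" by (simp flip: power_add)
          then show "(\<Sum>h\<in>carrier G. f h i * f (inv h \<otimes> g) (N - i))
              = b i * b (N - i) * t ^ N * gconv (?P i) (?P (N - i)) g"
            by (simp add: f_def gconv_def sum_distrib_left mult_ac)
        qed
        also have "\<dots> = (\<Sum>i\<le>N. b i * b (N - i) * (t ^ N * ?P N g))"
          using g by (intro sum.cong refl) (simp add: P_add)
        also have "\<dots> = (1 gchoose N) * (t ^ N * ?P N g)"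
          using gbinomial_Vandermonde[of "1/2 :: complex" "1/2" N]
          by (simp add: sum_distrib_right[symmetric] b_def atLeast0AtMost)
        finally show ?thesis by simp
      qed
      ultimately have "(\<lambda>N. (1 gchoose N) * t ^ N * ?P N g) sums gconv x x g"
        by (simp add: gconv_def)
      moreover have "(\<lambda>N. (1 gchoose N) * t ^ N * ?P N g) sums (\<Sum>N\<in>{0, 1}. (1 gchoose N) * t ^ N * ?P N g)"
      proof (rule sums_finite)
        fix N :: nat assume "N \<notin> {0, 1}"
        then have "1 choose N = 0" by (intro binomial_eq_0) auto
        then have "((1::complex) gchoose N) = 0"
          by (metis binomial_gbinomial of_nat_0 of_nat_1)
        then show "(1 gchoose N) * t ^ N * ?P N g = 0" by simp
      qed simp
      ultimately have "gconv x x g = (\<Sum>N\<in>{0, 1}. (1 gchoose N) * t ^ N * ?P N g)"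
        by (rule sums_unique2)
      then show ?thesis using P1[OF g] by simp
    qed
    \<comment> \<open>The substitution \<open>m = inv (k \<otimes> g)\<close> and the symmetry of
      \<open>x\<close> turn \<open>gconv x x\<close> at \<open>inv g \<otimes> h\<close> into the
      Gram sum.\<close>
    have "(\<Sum>k\<in>carrier G. x (k \<otimes> g) * x (k \<otimes> h)) = sum_zero_unit (inv g \<otimes> h) + t * \<phi> (inv g \<otimes> h)"
      if g: "g \<in> carrier G" and h: "h \<in> carrier G" for g h
    proof -
      let ?F = "\<lambda>m. x m * x (inv m \<otimes> (inv g \<otimes> h))"
      have "gconv x x (inv g \<otimes> h) = (\<Sum>m\<in>carrier G. ?F (inv m))"
        unfolding gconv_def by (rule sum_inv[symmetric])
      also have "\<dots> = (\<Sum>k\<in>carrier G. ?F (inv (k \<otimes> g)))"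
        by (rule sum_rmult[OF g, symmetric])
      also have "\<dots> = (\<Sum>k\<in>carrier G. x (k \<otimes> g) * x (k \<otimes> h))"
      proof (intro sum.cong refl)
        fix k assume k: "k \<in> carrier G"
        have "k \<otimes> g \<otimes> (inv g \<otimes> h) = k \<otimes> h"
          using g h k by (metis inv_closed inv_solve_left m_assoc m_closed)
        then show "?F (inv (k \<otimes> g)) = x (k \<otimes> g) * x (k \<otimes> h)"
          using g h k x_sym[of "k \<otimes> g"] by simp
      qed
      finally show ?thesis using x_conv g h by simp
    qed
    then show ?thesis using x_sum by blast
  qed
  show ?thesis
    by (rule that[of "1 / C"]) (use C main in auto)
qed

lemma polyfun_zero_on_gram_imp_zero:
  assumes F: "F \<in> polyfun k (carrier G \<times> carrier G)"
    and zero: "\<And>x. (\<Sum>g\<in>carrier G. x g) = 0 \<Longrightarrow>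
      F (\<lambda>(g, h). \<Sum>k\<in>carrier G. x (k \<otimes> g) * x (k \<otimes> h)) = 0"
    and sym: "\<And>g. g \<in> carrier G \<Longrightarrow> \<phi> (inv g) = \<phi> g" and sum0: "(\<Sum>g\<in>carrier G. \<phi> g) = (0::complex)"
  shows "F (\<lambda>(g, h). \<phi> (inv g \<otimes> h)) = 0"
proof -
  obtain r where r: "r > 0"
    "\<And>t. cmod t < r \<Longrightarrow> \<exists>x. (\<Sum>g\<in>carrier G. x g) = 0 \<and>
      (\<forall>g\<in>carrier G. \<forall>h\<in>carrier G. (\<Sum>k\<in>carrier G. x (k \<otimes> g) * x (k \<otimes> h))
         = sum_zero_unit (inv g \<otimes> h) + t * \<phi> (inv g \<otimes> h))"
    using gram_sqrt_exists[OF sym sum0] by blast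
  define c where "c = (\<lambda>s (g, h). s * sum_zero_unit (inv g \<otimes> h) + \<phi> (inv g \<otimes> h))"
  have "\<exists>q. \<forall>s. F (c s) = poly q s"
  proof (rule polyfun_along_curve[OF F])
    fix i :: "'a \<times> 'a"
    obtain g h where i: "i = (g, h)" by (cases i)
    show "\<exists>q. \<forall>s. c s i = poly q s"
      by (intro exI[of _ "[:\<phi> (inv g \<otimes> h), sum_zero_unit (inv g \<otimes> h):]"]) (simp add: c_def i)
  qed
  then obtain q where q: "\<And>s. F (c s) = poly q s"
    by blast
  have root: "poly q (of_nat m) = 0" if m: "real m > 1 / r" for m
  proof -
    have "0 < 1 / r"
      using r(1) by simp
    then have m0: "real m > 0"
      using m by linarith
    then have "cmod (1 / of_nat m) < r"
      using m r(1) by (simp add: norm_divide field_simps)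
    from r(2)[OF this] obtain x where x: "(\<Sum>g\<in>carrier G. x g) = 0"
      "\<And>g h. g \<in> carrier G \<Longrightarrow> h \<in> carrier G \<Longrightarrow> (\<Sum>k\<in>carrier G. x (k \<otimes> g) * x (k \<otimes> h))
         = sum_zero_unit (inv g \<otimes> h) + 1 / of_nat m * \<phi> (inv g \<otimes> h)"
      by (elim exE conjE) blast
    \<comment> \<open>\<open>m e + \<phi> = m (e + \<phi> / m)\<close>: the square root exists for
      the second factor once \<open>1 / m < r\<close>, and scaling it by the root of
      \<open>m\<close> scales its Gram form by \<open>m\<close>.\<close>
    define y where "y = (\<lambda>g. csqrt (of_nat m) * x g)"
    have "(\<Sum>g\<in>carrier G. y g) = 0"
      using x(1) by (simp add: y_def sum_distrib_left[symmetric])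
    then have "F (\<lambda>(g, h). \<Sum>k\<in>carrier G. y (k \<otimes> g) * y (k \<otimes> h)) = 0"
      by (rule zero)
    moreover have "(\<Sum>k\<in>carrier G. y (k \<otimes> g) * y (k \<otimes> h)) = c (of_nat m) (g, h)"
      if "g \<in> carrier G" "h \<in> carrier G" for g h
    proof -
      have "(\<Sum>k\<in>carrier G. y (k \<otimes> g) * y (k \<otimes> h))
          = (csqrt (of_nat m))\<^sup>2 * (\<Sum>k\<in>carrier G. x (k \<otimes> g) * x (k \<otimes> h))"
        by (simp add: y_def sum_distrib_left power2_eq_square mult_ac)
      also have "\<dots> = of_nat m * (\<Sum>k\<in>carrier G. x (k \<otimes> g) * x (k \<otimes> h))"
        by (simp only: power2_csqrt)
      also have "\<dots> = c (of_nat m) (g, h)"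
        using that m0 by (simp add: x(2) c_def field_simps)
      finally show ?thesis .
    qed
    ultimately have "F (c (of_nat m)) = 0"
      using polyfun_cong[OF F, of "c (of_nat m)" "\<lambda>(g, h). \<Sum>k\<in>carrier G. y (k \<otimes> g) * y (k \<otimes> h)"]
      by auto
    then show ?thesis by (simp add: q)
  qed
  have "q = 0"
  proof (rule ccontr)
    assume "q \<noteq> 0"
    then have "finite {s. poly q s = 0}"
      by (rule poly_roots_finite)
    moreover have "of_nat ` {m. real m > 1 / r} \<subseteq> {s. poly q s = 0}"
      using root by auto
    ultimately have "finite (of_nat ` {m. real m > 1 / r} :: complex set)"
      by (rule rev_finite_subset)
    then have "finite {m. real m > 1 / r}"
      by (rule finite_imageD) (simp add: inj_on_def)
    moreover obtain m0 where "1 / r < real m0"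
      using reals_Archimedean2 by blast
    then have "{m0..} \<subseteq> {m. real m > 1 / r}" by auto
    ultimately show False
      using infinite_Ici finite_subset by blast
  qed
  then have "F (c 0) = 0"
    by (simp add: q)
  then show ?thesis
    by (simp add: c_def case_prod_unfold)
qed

end

subsection \<open>Homomorphisms of number fields\<close>

lemma is_ring_hom_field_hom: "is_ring_hom f \<Longrightarrow> field_hom (f :: 'a::field \<Rightarrow> 'b::field)"
proof -
  assume f: "is_ring_hom f"
  have "f 0 + f 0 = f 0 + 0"
    using f unfolding is_ring_hom_def by (metis add.right_neutral)
  then have "f 0 = 0"
    by (rule add_left_imp_eq)
  then show ?thesis
    using f unfolding is_ring_hom_def by unfold_locales auto
qed

context
  fixes f :: "'a::field_char_0 \<Rightarrow> 'b::field_char_0"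
  assumes f: "is_ring_hom f"
begin

interpretation f: field_hom f
  by (rule is_ring_hom_field_hom[OF f])

lemma is_ring_hom_0: "f 0 = 0"
  and is_ring_hom_1: "f 1 = 1"
  and is_ring_hom_add: "f (x + y) = f x + f y"
  and is_ring_hom_mult: "f (x * y) = f x * f y"
  and is_ring_hom_minus: "f (- x) = - f x"
  and is_ring_hom_diff: "f (x - y) = f x - f y"
  and is_ring_hom_power: "f (x ^ n) = f x ^ n"
  and is_ring_hom_inverse: "f (inverse x) = inverse (f x)"
  and is_ring_hom_divide: "f (x / y) = f x / f y"
  and is_ring_hom_sum: "f (sum g A) = (\<Sum>a\<in>A. f (g a))"
  and is_ring_hom_prod: "f (prod g A) = (\<Prod>a\<in>A. f (g a))"
  by (simp_all add: hom_distribs)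

lemma is_ring_hom_eq_0_iff: "f x = 0 \<longleftrightarrow> x = 0"
proof
  assume "f x = 0"
  show "x = 0"
  proof (rule ccontr)
    assume "x \<noteq> 0"
    then have "f (x * inverse x) = 1" by (simp add: is_ring_hom_1)
    then show False using \<open>f x = 0\<close> by (simp add: is_ring_hom_mult)
  qed
qed (simp add: is_ring_hom_0)

lemma is_ring_hom_eq_iff: "f x = f y \<longleftrightarrow> x = y"
  using is_ring_hom_eq_0_iff[of "x - y"] by (simp add: is_ring_hom_diff)

lemma is_ring_hom_of_nat: "f (of_nat n) = of_nat n"
  by (induction n) (auto simp: is_ring_hom_0 is_ring_hom_1 is_ring_hom_add)

lemma is_ring_hom_of_int: "f (of_int n) = of_int n"
  by (cases n) (auto simp: is_ring_hom_of_nat is_ring_hom_minus is_ring_hom_diff is_ring_hom_1 is_ring_hom_add)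

lemma is_ring_hom_of_rat: "f (of_rat q) = of_rat q"
proof (cases q)
  case (Fract a b)
  then show ?thesis by (simp add: of_rat_rat is_ring_hom_divide is_ring_hom_of_int)
qed

lemma is_ring_hom_algebraic_int:
  assumes "algebraic_int x" shows "algebraic_int (f x)"
proof -
  obtain p :: "int poly" where p: "poly (map_poly of_int p) x = 0" "lead_coeff p = 1"
    using assms by (auto simp: algebraic_int_altdef_ipoly)
  have "f (poly (map_poly of_int p) x) = poly (map_poly of_int p) (f x)"
    by (induction p)
       (auto simp: map_poly_pCons is_ring_hom_0 is_ring_hom_add is_ring_hom_mult is_ring_hom_of_int)
  then show ?thesis
    using p by (auto simp: algebraic_int_altdef_ipoly is_ring_hom_0)
qed

end

section \<open>The automorphism group and separating elements\<close>

lemma gal_groupD: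
  assumes "\<sigma> \<in> carrier (gal_group TYPE('k::field_char_0))"
  shows "bij \<sigma>" "is_ring_hom \<sigma>"
  using assms by (auto simp: gal_group_def)

lemma gal_group_simps:
  "\<sigma> \<otimes>\<^bsub>gal_group TYPE('k::field_char_0)\<^esub> \<tau> = \<sigma> \<circ> \<tau>"
  "\<one>\<^bsub>gal_group TYPE('k)\<^esub> = id"
  by (simp_all add: gal_group_def)

lemma gal_group_group: "group (gal_group TYPE('k::field_char_0))"
proof (rule groupI)
  fix \<sigma> :: "'k \<Rightarrow> 'k" assume "\<sigma> \<in> carrier (gal_group TYPE('k))"
  then have \<sigma>: "bij \<sigma>" "is_ring_hom \<sigma>" by (auto simp: gal_group_def)
  have s: "\<sigma> (Hilbert_Choice.inv \<sigma> x) = x" for x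
    using \<sigma>(1) by (simp add: bij_is_surj surj_f_inv_f)
  have inj: "x = y" if "\<sigma> x = \<sigma> y" for x y
    using that is_ring_hom_eq_iff[OF \<sigma>(2)] by simp
  have "is_ring_hom (Hilbert_Choice.inv \<sigma>)"
    unfolding is_ring_hom_def
    by (intro conjI allI; rule inj)
       (auto simp: s is_ring_hom_1[OF \<sigma>(2)] is_ring_hom_add[OF \<sigma>(2)] is_ring_hom_mult[OF \<sigma>(2)])
  then show "\<exists>\<tau>\<in>carrier (gal_group TYPE('k)). \<tau> \<otimes>\<^bsub>gal_group TYPE('k)\<^esub> \<sigma> = \<one>\<^bsub>gal_group TYPE('k)\<^esub>"
    using \<sigma>(1) by (intro bexI[of _ "Hilbert_Choice.inv \<sigma>"])
      (auto simp: gal_group_def bij_imp_bij_inv bij_is_inj)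
qed (auto simp: gal_group_def is_ring_hom_def bij_comp)

text \<open>A vector space over an infinite field is no finite union of proper subspaces, here the
  kernels of the maps in \<open>D\<close>. If \<open>\<theta>\<close> avoids the old kernels and
  \<open>d y \<noteq> 0\<close>, each map vanishes at \<open>\<theta> + q y\<close> for at most one
  natural \<open>q\<close>, so some \<open>q\<close> suits all of them.\<close>

lemma separating_element:
  fixes D :: "('k::field_char_0 \<Rightarrow> 'k) set"
  assumes "finite D"
    and "\<And>\<delta> x y. \<delta> \<in> D \<Longrightarrow> \<delta> (x + y) = \<delta> x + \<delta> y"
    and "\<And>\<delta> x n. \<delta> \<in> D \<Longrightarrow> \<delta> (of_nat n * x) = of_nat n * \<delta> x"
    and "\<And>\<delta>. \<delta> \<in> D \<Longrightarrow> \<exists>x. \<delta> x \<noteq> 0"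
  shows "\<exists>\<theta>. \<forall>\<delta>\<in>D. \<delta> \<theta> \<noteq> 0"
  using assms
proof (induction D rule: finite_induct)
  case (insert d D)
  then obtain \<theta> where \<theta>: "\<And>\<delta>. \<delta> \<in> D \<Longrightarrow> \<delta> \<theta> \<noteq> 0"
    by (metis insertI2)
  obtain y where y: "d y \<noteq> 0"
    using insert.prems(3) by blast
  define bad where "bad = (\<lambda>\<delta> :: 'k \<Rightarrow> 'k. {q::nat. \<delta> \<theta> + of_nat q * \<delta> y = 0})"
  have "finite (bad \<delta>)" if \<delta>: "\<delta> \<in> insert d D" for \<delta>
  proof (cases "\<delta> y = 0")
    case True
    then have "bad \<delta> = {}"
      using \<theta> \<delta> y by (auto simp: bad_def)
    then show ?thesis by simp
  next
    case False
    have "p = q" if "p \<in> bad \<delta>" "q \<in> bad \<delta>" for p q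
    proof -
      have "of_nat p * \<delta> y = - \<delta> \<theta>" "of_nat q * \<delta> y = - \<delta> \<theta>"
        using that by (simp_all add: bad_def eq_neg_iff_add_eq_0 add.commute)
      then show ?thesis
        using False by (metis mult_right_cancel of_nat_eq_iff)
    qed
    then have "bad \<delta> \<subseteq> {SOME q. q \<in> bad \<delta>}"
      by (intro subsetI) (metis singletonI someI)
    then show ?thesis
      by (rule finite_subset) simp
  qed
  then have "finite (\<Union>\<delta>\<in>insert d D. bad \<delta>)"
    using insert.hyps by (intro finite_UN_I) auto
  then obtain q where q: "q \<notin> (\<Union>\<delta>\<in>insert d D. bad \<delta>)"
    using ex_new_if_finite infinite_UNIV_nat by blast
  show ?case
  proof (intro exI[of _ "\<theta> + of_nat q * y"] ballI)
    fix \<delta> assume \<delta>: "\<delta> \<in> insert d D"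
    have "\<delta> (\<theta> + of_nat q * y) = \<delta> \<theta> + of_nat q * \<delta> y"
      using insert.prems(1,2)[OF \<delta>] by simp
    then show "\<delta> (\<theta> + of_nat q * y) \<noteq> 0"
      using q \<delta> by (auto simp: bad_def)
  qed
qed simp

text \<open>A primitive element, found from the pairwise differences of automorphisms. It is stated
  for finite subsets because finiteness of the whole group is derived from it.\<close>

lemma gal_separating_element:
  assumes "finite F" "F \<subseteq> carrier (gal_group TYPE('k::field_char_0))"
  obtains \<theta> where "inj_on (\<lambda>\<sigma>. \<sigma> \<theta>) F"
proof -
  define D where "D = (\<lambda>(\<sigma>, \<tau>) x. \<sigma> x - \<tau> x) ` {(\<sigma>, \<tau>) \<in> F \<times> F. \<sigma> \<noteq> \<tau>}"
  have "finite {(\<sigma>, \<tau>) \<in> F \<times> F. \<sigma> \<noteq> \<tau>}"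
    using assms(1) by (intro finite_subset[OF _ finite_cartesian_product[of F F]]) auto
  then have fin: "finite D"
    by (simp add: D_def)
  have hom: "is_ring_hom \<sigma>" if "\<sigma> \<in> F" for \<sigma>
    using that assms(2) gal_groupD by blast
  have "\<exists>\<theta>. \<forall>\<delta>\<in>D. \<delta> \<theta> \<noteq> 0"
  proof (rule separating_element[OF fin])
    fix \<delta> assume "\<delta> \<in> D"
    then obtain \<sigma> \<tau> where \<delta>: "\<delta> = (\<lambda>x. \<sigma> x - \<tau> x)" "\<sigma> \<in> F" "\<tau> \<in> F" "\<sigma> \<noteq> \<tau>"
      by (auto simp: D_def)
    note h = hom[OF \<delta>(2)] hom[OF \<delta>(3)]
    show "\<delta> (x + y) = \<delta> x + \<delta> y" for x y
      by (simp add: \<delta>(1) is_ring_hom_add[OF h(1)] is_ring_hom_add[OF h(2)])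
    show "\<delta> (of_nat n * x) = of_nat n * \<delta> x" for n x
      by (simp add: \<delta>(1) is_ring_hom_mult[OF h(1)] is_ring_hom_mult[OF h(2)]
          is_ring_hom_of_nat[OF h(1)] is_ring_hom_of_nat[OF h(2)] right_diff_distrib)
    show "\<exists>x. \<delta> x \<noteq> 0"
      using \<delta>(1,4) by auto
  qed
  then obtain \<theta> where \<theta>: "\<And>\<delta>. \<delta> \<in> D \<Longrightarrow> \<delta> \<theta> \<noteq> 0" by blast
  have "\<sigma> \<theta> \<noteq> \<tau> \<theta>" if "\<sigma> \<in> F" "\<tau> \<in> F" "\<sigma> \<noteq> \<tau>" for \<sigma> \<tau>
  proof -
    have "(\<lambda>x. \<sigma> x - \<tau> x) \<in> D"
      unfolding D_def using that by (intro image_eqI[of _ _ "(\<sigma>, \<tau>)"]) auto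
    from \<theta>[OF this] show ?thesis by simp
  qed
  then show ?thesis
    by (intro that[of \<theta>]) (auto simp: inj_on_def)
qed

text \<open>Automorphisms fix rational coefficients, so a relation would be a polynomial of degree
  below \<open>card F\<close> with the \<open>card F\<close> distinct roots
  \<open>\<sigma> \<theta>\<close>.\<close>

lemma powers_rat_independent:
  assumes F: "finite F" "F \<subseteq> carrier (gal_group TYPE('k::field_char_0))" and inj: "inj_on (\<lambda>\<sigma>. \<sigma> \<theta>) F"
    and zero: "(\<Sum>i<card F. of_rat (c i) * \<theta> ^ i) = 0" and i: "i < card F"
  shows "c i = 0"
proof -
  define p :: "'k poly" where "p = (\<Sum>i<card F. monom (of_rat (c i)) i)"
  have coeff: "coeff p j = (if j < card F then of_rat (c j) else 0)" for j
    by (auto simp: p_def coeff_sum)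
  have "p = 0"
  proof (rule ccontr)
    assume "p \<noteq> 0"
    have "(\<lambda>\<sigma>. \<sigma> \<theta>) ` F \<subseteq> {x. poly p x = 0}"
    proof (intro image_subsetI CollectI)
      fix \<sigma> assume "\<sigma> \<in> F"
      then have h: "is_ring_hom \<sigma>" using F(2) gal_groupD by blast
      have "poly p (\<sigma> \<theta>) = \<sigma> (\<Sum>i<card F. of_rat (c i) * \<theta> ^ i)"
        by (simp add: p_def poly_sum poly_monom is_ring_hom_sum[OF h] is_ring_hom_mult[OF h]
            is_ring_hom_of_rat[OF h] is_ring_hom_power[OF h])
      then show "poly p (\<sigma> \<theta>) = 0"
        by (simp add: zero is_ring_hom_0[OF h])
    qed
    then have "card ((\<lambda>\<sigma>. \<sigma> \<theta>) ` F) \<le> card {x. poly p x = 0}"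
      using poly_roots_finite[OF \<open>p \<noteq> 0\<close>] by (intro card_mono)
    also have "\<dots> \<le> degree p"
      using \<open>p \<noteq> 0\<close> by (rule card_poly_roots_bound)
    also have "card ((\<lambda>\<sigma>. \<sigma> \<theta>) ` F) = card F"
      using inj by (rule card_image)
    finally have "card F \<le> degree p" .
    then have "lead_coeff p = 0" by (simp add: coeff)
    then show False using \<open>p \<noteq> 0\<close> by simp
  qed
  then have "coeff p i = 0" by simp
  then show ?thesis using i by (simp add: coeff)
qed

text \<open>More automorphisms than spanning elements would give too many independent powers of a
  separating element.\<close>

lemma finite_gal_group:
  assumes "number_field TYPE('k::field_char_0)"
  shows "finite (carrier (gal_group TYPE('k)))"
proof (rule ccontr)
  assume inf: "infinite (carrier (gal_group TYPE('k)))"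
  obtain B :: "'k set" where B: "finite B" "rat_vs.span B = UNIV"
    using assms by (auto simp: number_field_def)
  obtain F where F: "finite F" "F \<subseteq> carrier (gal_group TYPE('k))" "card F = Suc (card B)"
    using infinite_arbitrarily_large[OF inf] by blast
  obtain \<theta> where \<theta>: "inj_on (\<lambda>\<sigma>. \<sigma> \<theta>) F"
    using gal_separating_element[OF F(1,2)] by blast
  note indep = powers_rat_independent[OF F(1,2) \<theta>]
  have inj: "inj_on (\<lambda>i. \<theta> ^ i) {..<card F}"
  proof (rule inj_onI, rule ccontr)
    fix i j assume ij: "i \<in> {..<card F}" "j \<in> {..<card F}" "\<theta> ^ i = \<theta> ^ j" "i \<noteq> j"
    define c :: "nat \<Rightarrow> rat" where "c = (\<lambda>l. if l = i then 1 else if l = j then -1 else 0)"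
    have "(\<Sum>l<card F. of_rat (c l) * \<theta> ^ l) = (\<Sum>l\<in>{i, j}. of_rat (c l) * \<theta> ^ l)"
      using ij by (intro sum.mono_neutral_right) (auto simp: c_def)
    also have "\<dots> = 0"
      using ij by (simp add: c_def)
    finally have "c i = 0"
      using indep ij by blast
    then show False by (simp add: c_def)
  qed
  have "rat_vs.independent ((\<lambda>i. \<theta> ^ i) ` {..<card F})"
  proof (rule rat_vs.independent_if_scalars_zero)
    fix c x assume "(\<Sum>x\<in>(\<lambda>i. \<theta> ^ i) ` {..<card F}. of_rat (c x) * x) = 0" "x \<in> (\<lambda>i. \<theta> ^ i) ` {..<card F}"
    then show "c x = 0"
      using indep[of "\<lambda>i. c (\<theta> ^ i)"] by (auto simp: sum.reindex[OF inj])
  qed simp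
  then have "card ((\<lambda>i. \<theta> ^ i) ` {..<card F}) \<le> card B"
    using rat_vs.independent_span_bound[OF B(1)] B(2) by blast
  then show False
    using card_image[OF inj] F(3) by simp
qed

text \<open>The field itself is a finitely generated \<rat>-module stable under every
  multiplication; 1 is inserted to have a non-zero generator.\<close>

lemma number_field_algebraic:
  assumes "number_field TYPE('k::field_char_0)"
  shows "algebraic (x :: 'k)"
proof -
  obtain B :: "'k set" where B: "finite B" "rat_vs.span B = UNIV"
    using assms by (auto simp: number_field_def)
  have "rat_coeffs.lincombs (insert 1 B) = UNIV"
    using B rat_vs.span_mono[of B "insert 1 B"] by (auto simp: rat_lincombs_eq_span)
  then show ?thesis
    using B(1) by (intro integral_imp_algebraic rat_coeffs.integral_elem_if_stable[of "insert 1 B" 1]) auto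
qed

subsection \<open>Dirichlet's construction of units\<close>

lemma finite_range_repeats:
  fixes f :: "nat \<Rightarrow> 'a"
  assumes "finite (range f)"
  obtains k l where "k < l" "f k = f l"
proof -
  have "\<not> inj f"
    using assms range_inj_infinite by blast
  then show ?thesis
    using that unfolding inj_def by (metis linorder_neqE_nat)
qed

locale real_galois_field =
  fixes \<iota> :: "'k::field_char_0 \<Rightarrow> real"
  assumes nf: "number_field TYPE('k)"
    and gal: "galois_over_rat TYPE('k)"
    and hom: "is_ring_hom \<iota>"
begin

abbreviation Gal :: "('k \<Rightarrow> 'k) set" where
  "Gal \<equiv> carrier (gal_group TYPE('k))"

lemma finite_Gal: "finite Gal"
  by (rule finite_gal_group[OF nf])

lemma Gal_hom: "\<sigma> \<in> Gal \<Longrightarrow> is_ring_hom \<sigma>"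
  by (rule gal_groupD)

lemma id_Gal: "id \<in> Gal"
  by (auto simp: gal_group_def is_ring_hom_def)

sublocale Gal: finite_group "gal_group TYPE('k)"
  using gal_group_group finite_Gal by (simp add: finite_group_def finite_group_axioms_def)

section \<open>The norm and a lattice of algebraic integers\<close>

definition gal_norm :: "'k \<Rightarrow> 'k" where
  "gal_norm x = (\<Prod>\<sigma>\<in>Gal. \<sigma> x)"

text \<open>The norm is fixed by the Galois group, hence rational, and a rational algebraic integer
  is an integer.\<close>

lemma gal_norm_int:
  assumes "algebraic_int x"
  obtains N :: int where "gal_norm x = of_int N"
proof -
  have "\<tau> (gal_norm x) = gal_norm x" if \<tau>: "\<tau> \<in> Gal" for \<tau>
  proof -
    have "\<tau> (gal_norm x) = (\<Prod>\<sigma>\<in>Gal. (\<tau> \<circ> \<sigma>) x)"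
      by (simp add: gal_norm_def is_ring_hom_prod[OF Gal_hom[OF \<tau>]])
    also have "\<dots> = gal_norm x"
      unfolding gal_norm_def
    proof (rule prod.reindex_bij_betw)
      show "bij_betw ((\<circ>) \<tau>) Gal Gal"
        using Gal.inj_on_cmult[OF \<tau>] Gal.surj_const_mult[OF \<tau>]
        by (simp add: bij_betw_def gal_group_simps)
    qed
    finally show ?thesis .
  qed
  then have "gal_norm x \<in> \<rat>"
    using gal unfolding galois_over_rat_def by blast
  moreover have "algebraic_int (gal_norm x)"
    unfolding gal_norm_def
    by (rule algebraic_int_prod) (rule is_ring_hom_algebraic_int[OF Gal_hom assms])
  ultimately have "gal_norm x \<in> \<int>"
    by (intro rational_algebraic_int_is_int)
  then show ?thesis using that by (auto elim: Ints_cases)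
qed

lemma gal_norm_eq_0_iff: "gal_norm x = 0 \<longleftrightarrow> x = 0"
proof
  assume "gal_norm x = 0"
  then obtain \<sigma> where "\<sigma> \<in> Gal" "\<sigma> x = 0"
    by (auto simp: gal_norm_def prod_zero_iff[OF finite_Gal])
  then show "x = 0"
    using is_ring_hom_eq_0_iff[OF Gal_hom] by blast
next
  assume "x = 0"
  then show "gal_norm x = 0"
    using id_Gal by (auto simp: gal_norm_def prod_zero_iff[OF finite_Gal] intro!: bexI[of _ id])
qed

lemma gal_norm_split: "gal_norm x = x * (\<Prod>\<sigma>\<in>Gal - {id}. \<sigma> x)"
  unfolding gal_norm_def by (subst prod.remove[OF finite_Gal id_Gal]) simp

lemma integral_generator:
  obtains \<theta> :: 'k where "algebraic_int \<theta>" "inj_on (\<lambda>\<sigma>. \<sigma> \<theta>) Gal"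
proof -
  obtain \<theta> where \<theta>: "inj_on (\<lambda>\<sigma>. \<sigma> \<theta>) Gal"
    using gal_separating_element[OF finite_Gal order_refl] by blast
  obtain m :: int where m: "m \<noteq> 0" "algebraic_int (of_int m * \<theta>)"
    using algebraic_int_multiple[OF number_field_algebraic[OF nf]] by blast
  have scale: "\<sigma> (of_int m * \<theta>) = of_int m * \<sigma> \<theta>" if "\<sigma> \<in> Gal" for \<sigma>
    using Gal_hom[OF that] by (simp add: is_ring_hom_mult is_ring_hom_of_int)
  have "inj_on (\<lambda>\<sigma>. \<sigma> (of_int m * \<theta>)) Gal"
  proof (rule inj_onI)
    fix \<sigma> \<tau> assume st: "\<sigma> \<in> Gal" "\<tau> \<in> Gal" "\<sigma> (of_int m * \<theta>) = \<tau> (of_int m * \<theta>)"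
    then have "\<sigma> \<theta> = \<tau> \<theta>"
      using m(1) by (simp add: scale)
    then show "\<sigma> = \<tau>"
      using \<theta> st by (auto simp: inj_on_def)
  qed
  then show ?thesis using that m(2) by blast
qed

text \<open>The lattice spanned by the powers of \<open>\<theta>\<close> below
  \<open>card Gal\<close> takes the place of the ring of integers. For an integral separating
  \<open>\<theta>\<close> its elements are algebraic integers with unique coefficients.\<close>

definition int_comb :: "'k \<Rightarrow> (nat \<Rightarrow> int) \<Rightarrow> 'k" where
  "int_comb \<theta> c = (\<Sum>i<card Gal. of_int (c i) * \<theta> ^ i)"

lemma int_comb_algebraic_int: "algebraic_int \<theta> \<Longrightarrow> algebraic_int (int_comb \<theta> c)"
  unfolding int_comb_def
  by (intro algebraic_int_sum algebraic_int_times algebraic_int_power)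
     (auto intro: int_imp_algebraic_int)

lemma int_comb_diff: "int_comb \<theta> (\<lambda>i. c i - d i) = int_comb \<theta> c - int_comb \<theta> d"
  by (simp add: int_comb_def left_diff_distrib sum_subtractf)

lemma int_comb_nonzero:
  assumes \<theta>: "inj_on (\<lambda>\<sigma>. \<sigma> \<theta>) Gal" and i: "i < card Gal" "c i \<noteq> 0"
  shows "int_comb \<theta> c \<noteq> 0"
proof
  assume "int_comb \<theta> c = 0"
  then have "(\<Sum>i<card Gal. of_rat (of_int (c i)) * \<theta> ^ i) = 0"
    by (simp add: int_comb_def)
  from powers_rat_independent[OF finite_Gal order_refl \<theta> this i(1)] show False
    using i(2) by simp
qed

lemma embedding_int_comb_bound:
  obtains C where "C > 0"
    "\<And>\<sigma> c H. \<sigma> \<in> Gal \<Longrightarrow> (\<And>i. i < card Gal \<Longrightarrow> \<bar>real_of_int (c i)\<bar> \<le> H) \<Longrightarrow>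
       \<bar>\<iota> (\<sigma> (int_comb \<theta> c))\<bar> \<le> H * C"
proof -
  define S where "S = (\<lambda>\<sigma>. \<Sum>i<card Gal. \<bar>\<iota> (\<sigma> \<theta>)\<bar> ^ i)"
  define C where "C = 1 + (\<Sum>\<sigma>\<in>Gal. S \<sigma>)"
  have S: "S \<sigma> \<ge> 0" for \<sigma>
    by (simp add: S_def sum_nonneg)
  have SC: "S \<sigma> \<le> C" if "\<sigma> \<in> Gal" for \<sigma>
    using member_le_sum[OF that, of S] S finite_Gal by (simp add: C_def)
  show ?thesis
  proof (rule that[of C])
    show "C > 0"
      using S by (simp add: C_def add_pos_nonneg sum_nonneg)
    fix \<sigma> c and H :: real
    assume \<sigma>: "\<sigma> \<in> Gal" and H: "\<And>i. i < card Gal \<Longrightarrow> \<bar>real_of_int (c i)\<bar> \<le> H"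
    have "card Gal > 0"
      by (rule Gal.card_pos)
    then have "H \<ge> 0"
      using H[of 0] by linarith
    have "\<iota> (\<sigma> (int_comb \<theta> c)) = (\<Sum>i<card Gal. of_int (c i) * \<iota> (\<sigma> \<theta>) ^ i)"
      using Gal_hom[OF \<sigma>] hom
      by (simp add: int_comb_def is_ring_hom_sum is_ring_hom_mult is_ring_hom_of_int is_ring_hom_power)
    then have "\<bar>\<iota> (\<sigma> (int_comb \<theta> c))\<bar> \<le> (\<Sum>i<card Gal. \<bar>of_int (c i) * \<iota> (\<sigma> \<theta>) ^ i\<bar>)"
      using sum_abs by metis
    also have "\<dots> \<le> (\<Sum>i<card Gal. H * \<bar>\<iota> (\<sigma> \<theta>)\<bar> ^ i)"
      using H by (intro sum_mono) (auto simp: abs_mult power_abs intro!: mult_right_mono)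
    also have "\<dots> = H * S \<sigma>"
      by (simp add: S_def sum_distrib_left)
    also have "\<dots> \<le> H * C"
      using SC[OF \<sigma>] \<open>H \<ge> 0\<close> by (rule mult_left_mono)
    finally show "\<bar>\<iota> (\<sigma> (int_comb \<theta> c))\<bar> \<le> H * C" .
  qed
qed

text \<open>Pigeonhole: with \<open>H = (3 T)\<^bsup>n - 1\<^esup>\<close> there are \<open>(H + 1)\<^sup>n\<close> coefficient vectors in \<open>{0..H}\<^sup>n\<close>, but at
  most \<open>(2 T H + 1)\<^bsup>n - 1\<^esup> \<le> H\<^sup>n\<close> boxes of side \<open>C / T\<close> for the conjugates other than the first.\<close>

lemma small_conjugates:
  assumes \<theta>: "inj_on (\<lambda>\<sigma>. \<sigma> \<theta>) Gal"
  obtains K where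
    "\<And>\<delta>::real. \<delta> > 0 \<Longrightarrow> \<exists>c. int_comb \<theta> c \<noteq> 0 \<and> (\<forall>\<sigma>\<in>Gal - {id}. \<bar>\<iota> (\<sigma> (int_comb \<theta> c))\<bar> < \<delta>) \<and>
      \<bar>\<iota> (gal_norm (int_comb \<theta> c))\<bar> \<le> K"
proof -
  define n where "n = card Gal"
  have n: "n > 0"
    unfolding n_def by (rule Gal.card_pos)
  obtain C where C: "C > 0"
    "\<And>\<sigma> c H. \<sigma> \<in> Gal \<Longrightarrow> (\<And>i. i < n \<Longrightarrow> \<bar>real_of_int (c i)\<bar> \<le> H) \<Longrightarrow>
       \<bar>\<iota> (\<sigma> (int_comb \<theta> c))\<bar> \<le> H * C"
    using embedding_int_comb_bound[of \<theta>] unfolding n_def by blast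
  have cardG': "card (Gal - {id}) = n - 1"
    using id_Gal finite_Gal by (simp add: n_def)
  have main: "\<exists>c. int_comb \<theta> c \<noteq> 0 \<and> (\<forall>\<sigma>\<in>Gal - {id}. \<bar>\<iota> (\<sigma> (int_comb \<theta> c))\<bar> < \<delta>) \<and>
      \<bar>\<iota> (gal_norm (int_comb \<theta> c))\<bar> \<le> 3 ^ (n - 1) * C ^ n" if \<delta>: "\<delta> > 0" for \<delta>
  proof -
    obtain T :: nat where T: "real T > C / \<delta>"
      using reals_Archimedean2 by blast
    have "C / \<delta> > 0" using C(1) \<delta> by simp
    then have T0: "T > 0" using T by (cases T) auto
    \<comment> \<open>The first conjugate is at most \<open>H * C\<close>, the others at most
      \<open>C / T\<close>. With \<open>H\<close> of order \<open>T ^ (n - 1)\<close> the resulting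
      norm bound is free of \<open>T\<close>, hence of \<open>\<delta>\<close>; the later pigeonhole
      on norms depends on this uniformity.\<close>
    define H where "H = (3 * T) ^ (n - 1)"
    have H: "H \<ge> 1" using T0 by (simp add: H_def)
    define A where "A = PiE {..<n} (\<lambda>_. {0..int H})"
    define P where "P = PiE (Gal - {id}) (\<lambda>_. {- int (T * H)..int (T * H)})"
    define \<Phi> where "\<Phi> = (\<lambda>c. \<lambda>\<sigma>\<in>Gal - {id}. \<lfloor>\<iota> (\<sigma> (int_comb \<theta> c)) * real T / C\<rfloor>)"
    have cA: "c i \<in> {0..int H}" if "c \<in> A" "i < n" for c i
      using PiE_mem[OF that(1)[unfolded A_def], of i] that(2) by simp
    have floor_mem: "\<lfloor>z\<rfloor> \<in> {- int m..int m}" if "\<bar>z\<bar> \<le> real m" for z m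
      using that by (auto simp: le_floor_iff floor_le_iff abs_le_iff)
    have \<Phi>P: "\<Phi> c \<in> P" if c: "c \<in> A" for c
    proof -
      have "\<lfloor>\<iota> (\<sigma> (int_comb \<theta> c)) * real T / C\<rfloor> \<in> {- int (T * H)..int (T * H)}" if "\<sigma> \<in> Gal - {id}" for \<sigma>
      proof -
        have "\<bar>real_of_int (c i)\<bar> \<le> real H" if "i < n" for i
          using cA[OF c that] by auto
        then have "\<bar>\<iota> (\<sigma> (int_comb \<theta> c))\<bar> \<le> real H * C"
          using C(2)[of \<sigma> c "real H"] that by blast
        then have "\<bar>\<iota> (\<sigma> (int_comb \<theta> c))\<bar> * (real T / C) \<le> real H * C * (real T / C)"
          using C(1) by (intro mult_right_mono) auto
        then have "\<bar>\<iota> (\<sigma> (int_comb \<theta> c)) * real T / C\<bar> \<le> real (T * H)"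
          using C(1) by (simp add: abs_mult mult.commute)
        then show ?thesis
          by (rule floor_mem)
      qed
      then show ?thesis by (auto simp: \<Phi>_def P_def)
    qed
    have "card P = (2 * T * H + 1) ^ (n - 1)"
      using finite_Gal cardG' by (simp add: P_def card_PiE nat_add_distrib nat_mult_distrib mult_ac)
    also have "\<dots> \<le> (3 * T * H) ^ (n - 1)"
      using T0 H by (intro power_mono) (auto simp: Suc_le_eq)
    also have "\<dots> = H ^ n"
      using n by (cases n) (auto simp: H_def power_mult_distrib)
    also have "\<dots> < (H + 1) ^ n"
      using n by (intro power_strict_mono) auto
    also have "\<dots> = card A"
      by (simp add: A_def card_PiE nat_add_distrib)
    finally have lt: "card P < card A" .
    have finP: "finite P"
      unfolding P_def using finite_Gal by (intro finite_PiE) auto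
    have "\<not> inj_on \<Phi> A"
    proof
      assume "inj_on \<Phi> A"
      then have "card A \<le> card P"
        using \<Phi>P finP by (intro card_inj_on_le[of \<Phi>]) auto
      then show False using lt by simp
    qed
    then obtain c d where cd: "c \<in> A" "d \<in> A" "c \<noteq> d" "\<Phi> c = \<Phi> d"
      by (auto simp: inj_on_def)
    define e where "e = (\<lambda>i. c i - d i)"
    have "\<exists>i<n. c i \<noteq> d i"
    proof (rule ccontr)
      assume "\<not> (\<exists>i<n. c i \<noteq> d i)"
      then have "c = d"
        using cd(1,2) unfolding A_def by (intro PiE_ext) auto
      then show False using cd(3) by simp
    qed
    then have nz: "int_comb \<theta> e \<noteq> 0"
      using int_comb_nonzero[OF \<theta>] by (auto simp: e_def n_def)
    have small: "\<bar>\<iota> (\<sigma> (int_comb \<theta> e))\<bar> < C / real T" if \<sigma>: "\<sigma> \<in> Gal - {id}" for \<sigma>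
    proof -
      let ?x = "\<iota> (\<sigma> (int_comb \<theta> c)) * real T / C" and ?y = "\<iota> (\<sigma> (int_comb \<theta> d)) * real T / C"
      have "\<lfloor>?x\<rfloor> = \<lfloor>?y\<rfloor>"
        using fun_cong[OF cd(4), of \<sigma>] \<sigma> by (simp add: \<Phi>_def)
      then have "\<bar>?x - ?y\<bar> < 1"
        by linarith
      moreover have "?x - ?y = \<iota> (\<sigma> (int_comb \<theta> e)) * real T / C"
        using \<sigma> Gal_hom[of \<sigma>] hom
        by (simp add: e_def int_comb_diff is_ring_hom_diff left_diff_distrib diff_divide_distrib)
      ultimately have "\<bar>\<iota> (\<sigma> (int_comb \<theta> e))\<bar> * real T / C < 1"
        using C(1) by (simp add: abs_mult)
      then show ?thesis
        using C(1) T0 by (simp add: field_simps)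
    qed
    have big: "\<bar>\<iota> (int_comb \<theta> e)\<bar> \<le> real H * C"
    proof -
      have "\<bar>real_of_int (e i)\<bar> \<le> real H" if "i < n" for i
        using cA[OF cd(1) that] cA[OF cd(2) that] by (auto simp: e_def abs_le_iff)
      then show ?thesis
        using C(2)[OF id_Gal, of e "real H"] by simp
    qed
    have "\<bar>\<iota> (gal_norm (int_comb \<theta> e))\<bar>
        = \<bar>\<iota> (int_comb \<theta> e)\<bar> * (\<Prod>\<sigma>\<in>Gal - {id}. \<bar>\<iota> (\<sigma> (int_comb \<theta> e))\<bar>)"
      by (simp add: gal_norm_split is_ring_hom_mult[OF hom] is_ring_hom_prod[OF hom] abs_mult abs_prod)
    also have "\<dots> \<le> (real H * C) * (\<Prod>\<sigma>\<in>Gal - {id}. C / real T)"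
      using big small C(1) by (intro mult_mono prod_mono prod_nonneg) (auto intro: less_imp_le)
    also have "\<dots> = real H * C * (C / real T) ^ (n - 1)"
      by (simp add: cardG')
    also have "\<dots> = 3 ^ (n - 1) * C ^ n"
      using n T0 by (cases n) (auto simp: H_def power_mult_distrib power_divide field_simps)
    finally have "\<bar>\<iota> (gal_norm (int_comb \<theta> e))\<bar> \<le> 3 ^ (n - 1) * C ^ n" .
    moreover have "C / real T < \<delta>"
      using T T0 \<delta> by (simp add: field_simps)
    ultimately show ?thesis
      using nz small by (intro exI[of _ e]) force
  qed
  show ?thesis
    by (rule that[OF main])
qed

text \<open>Let a and b be the elements with coefficients \<open>c\<close> and \<open>d\<close>.
  Since N / a is the product of the other conjugates of a, it is an algebraic integer; so with b = a
  + N e the quotient b / a = 1 + (N / a) e is one too.\<close>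

lemma quotient_algebraic_int:
  assumes \<theta>: "algebraic_int \<theta>"
    and N: "gal_norm (int_comb \<theta> c) = of_int N" "N \<noteq> 0"
    and cong: "\<And>i. i < card Gal \<Longrightarrow> c i mod N = d i mod N"
  shows "algebraic_int (int_comb \<theta> d / int_comb \<theta> c)"
proof -
  let ?a = "int_comb \<theta> c"
  define e where "e = (\<lambda>i. (d i - c i) div N)"
  have e: "d i - c i = N * e i" if "i < card Gal" for i
    using cong[OF that, symmetric] by (simp add: e_def mod_eq_dvd_iff)
  have "int_comb \<theta> d - ?a = (\<Sum>i<card Gal. of_int (d i - c i) * \<theta> ^ i)"
    by (simp add: int_comb_diff[symmetric]) (simp add: int_comb_def)
  also have "\<dots> = (\<Sum>i<card Gal. of_int (N * e i) * \<theta> ^ i)"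
    using e by (intro sum.cong) auto
  also have "\<dots> = of_int N * int_comb \<theta> e"
    by (simp add: int_comb_def sum_distrib_left mult.assoc)
  finally have diff: "int_comb \<theta> d = ?a + of_int N * int_comb \<theta> e"
    by (simp add: algebra_simps)
  have nz: "?a \<noteq> 0"
    using N gal_norm_eq_0_iff[of ?a] by auto
  have "of_int N = ?a * (\<Prod>\<sigma>\<in>Gal - {id}. \<sigma> ?a)"
    using N(1) gal_norm_split by metis
  then have "int_comb \<theta> d / ?a = 1 + (\<Prod>\<sigma>\<in>Gal - {id}. \<sigma> ?a) * int_comb \<theta> e"
    using nz by (simp add: diff add_divide_distrib)
  moreover have "algebraic_int (\<sigma> ?a)" if "\<sigma> \<in> Gal - {id}" for \<sigma>
    using is_ring_hom_algebraic_int[OF Gal_hom[of \<sigma>] int_comb_algebraic_int[OF \<theta>, of c]] that by simp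
  then have "algebraic_int (1 + (\<Prod>\<sigma>\<in>Gal - {id}. \<sigma> ?a) * int_comb \<theta> e)"
    by (intro algebraic_int_plus algebraic_int_times algebraic_int_prod int_comb_algebraic_int \<theta>
        int_imp_algebraic_int[OF Ints_1])
  ultimately show ?thesis by simp
qed

text \<open>Take an infinite sequence of elements of bounded norm whose conjugates, all but the
  first, strictly decrease. Two of them share the norm and the coefficients modulo it; each divides
  the other, so their quotient is a unit.\<close>

lemma dirichlet_unit:
  obtains \<epsilon> where "\<epsilon> \<noteq> 0" "algebraic_int \<epsilon>" "algebraic_int (inverse \<epsilon>)"
    "\<And>\<sigma>. \<sigma> \<in> Gal - {id} \<Longrightarrow> \<bar>\<iota> (\<sigma> \<epsilon>)\<bar> < 1"
proof -
  obtain \<theta> where \<theta>: "algebraic_int \<theta>" "inj_on (\<lambda>\<sigma>. \<sigma> \<theta>) Gal"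
    using integral_generator by blast
  obtain K where K: "\<And>\<delta>::real. \<delta> > 0 \<Longrightarrow>
      \<exists>c. int_comb \<theta> c \<noteq> 0 \<and> (\<forall>\<sigma>\<in>Gal - {id}. \<bar>\<iota> (\<sigma> (int_comb \<theta> c))\<bar> < \<delta>) \<and>
      \<bar>\<iota> (gal_norm (int_comb \<theta> c))\<bar> \<le> K"
    using small_conjugates[OF \<theta>(2)] by blast
  define P where "P = (\<lambda>c. int_comb \<theta> c \<noteq> 0 \<and> \<bar>\<iota> (gal_norm (int_comb \<theta> c))\<bar> \<le> K)"
  define Q where "Q = (\<lambda>c d. \<forall>\<sigma>\<in>Gal - {id}. \<bar>\<iota> (\<sigma> (int_comb \<theta> d))\<bar> < \<bar>\<iota> (\<sigma> (int_comb \<theta> c))\<bar>)"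
  have "\<exists>f. \<forall>k. P (f k) \<and> Q (f k) (f (Suc k))"
  proof (rule dependent_nat_choice)
    show "\<exists>c. P c"
      using K[of 1] by (auto simp: P_def)
  next
    fix c :: "nat \<Rightarrow> int" and k :: nat assume c: "P c"
    \<comment> \<open>The value 1 keeps the set non-empty for the trivial group.\<close>
    define \<delta> where "\<delta> = Min (insert 1 ((\<lambda>\<sigma>. \<bar>\<iota> (\<sigma> (int_comb \<theta> c))\<bar>) ` (Gal - {id})))"
    have "\<delta> > 0"
      unfolding \<delta>_def using finite_Gal c is_ring_hom_eq_0_iff[OF hom] is_ring_hom_eq_0_iff[OF Gal_hom]
      by (subst Min_gr_iff) (auto simp: P_def)
    moreover have "\<delta> \<le> \<bar>\<iota> (\<sigma> (int_comb \<theta> c))\<bar>" if "\<sigma> \<in> Gal - {id}" for \<sigma>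
      unfolding \<delta>_def using finite_Gal that by (intro Min_le) auto
    ultimately show "\<exists>d. P d \<and> Q c d"
      using K[of \<delta>] unfolding P_def Q_def by (meson less_le_trans)
  qed
  then obtain f where f: "\<And>k. P (f k)" "\<And>k. Q (f k) (f (Suc k))" by blast
  have Q: "Q (f k) (f l)" if "k < l" for k l
    using that
  proof (induction rule: less_Suc_induct)
    case (1 i)
    then show ?case by (rule f(2))
  next
    case (2 i j k)
    then show ?case unfolding Q_def by (meson less_trans)
  qed
  have "\<exists>N. gal_norm (int_comb \<theta> (f k)) = of_int N" for k
    using gal_norm_int[OF int_comb_algebraic_int[OF \<theta>(1)]] by metis
  then obtain N where N: "\<And>k. gal_norm (int_comb \<theta> (f k)) = of_int (N k)" by metis
  have N0: "N k \<noteq> 0" for k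
    using f(1)[of k] N[of k] gal_norm_eq_0_iff[of "int_comb \<theta> (f k)"] by (auto simp: P_def)
  define M where "M = \<lceil>K\<rceil>"
  have NM: "\<bar>N k\<bar> \<le> M" for k
  proof -
    have "\<bar>real_of_int (N k)\<bar> \<le> K"
      using f(1)[of k] by (simp add: P_def N is_ring_hom_of_int[OF hom])
    then have "real_of_int \<bar>N k\<bar> \<le> K" by simp
    then show ?thesis unfolding M_def by linarith
  qed
  \<comment> \<open>The norm is recorded with its sign, so that one modulus serves both elements of
    a repeated pair.\<close>
  define \<kappa> where "\<kappa> = (\<lambda>k. (N k, \<lambda>i\<in>{..<card Gal}. f k i mod N k))"
  have "range \<kappa> \<subseteq> {-M..M} \<times> PiE {..<card Gal} (\<lambda>_. {-M..M})"
  proof (intro image_subsetI)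
    fix k
    have "f k i mod N k \<in> {-M..M}" for i
      using NM[of k] abs_mod_less[OF N0[of k], of "f k i"] by auto
    then show "\<kappa> k \<in> {-M..M} \<times> PiE {..<card Gal} (\<lambda>_. {-M..M})"
      using NM[of k] by (auto simp: \<kappa>_def)
  qed
  moreover have "finite ({-M..M} \<times> PiE {..<card Gal} (\<lambda>_. {-M..M}))"
    by (intro finite_cartesian_product finite_PiE) auto
  ultimately have "finite (range \<kappa>)"
    by (rule finite_subset)
  from finite_range_repeats[OF this] obtain k l where kl: "\<kappa> k = \<kappa> l" "k < l"
    by blast
  have NN: "N k = N l"
    using kl(1) by (simp add: \<kappa>_def)
  have cong: "f k i mod N k = f l i mod N k" if "i < card Gal" for i
    using kl(1) that by (auto simp: \<kappa>_def dest!: fun_cong[of _ _ i])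
  define \<epsilon> where "\<epsilon> = int_comb \<theta> (f l) / int_comb \<theta> (f k)"
  show ?thesis
  proof (rule that[of \<epsilon>])
    show "\<epsilon> \<noteq> 0"
      using f(1) by (simp add: \<epsilon>_def P_def)
    show "algebraic_int \<epsilon>"
      unfolding \<epsilon>_def by (rule quotient_algebraic_int[OF \<theta>(1) N N0 cong])
    have "algebraic_int (int_comb \<theta> (f k) / int_comb \<theta> (f l))"
      by (rule quotient_algebraic_int[OF \<theta>(1) N N0]) (use cong NN in simp)
    then show "algebraic_int (inverse \<epsilon>)"
      by (simp add: \<epsilon>_def)
    fix \<sigma> assume \<sigma>: "\<sigma> \<in> Gal - {id}"
    have "\<bar>\<iota> (\<sigma> (int_comb \<theta> (f l)))\<bar> < \<bar>\<iota> (\<sigma> (int_comb \<theta> (f k)))\<bar>"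
      using Q[OF kl(2)] \<sigma> by (simp add: Q_def)
    then show "\<bar>\<iota> (\<sigma> \<epsilon>)\<bar> < 1"
      using \<sigma> Gal_hom[of \<sigma>] hom
      by (simp add: \<epsilon>_def is_ring_hom_divide abs_divide divide_less_eq)
  qed
qed

end

subsection \<open>Logarithms of the conjugates of a weak Minkowski unit\<close>

text \<open>A square matrix and its transpose have the same determinant, so a trivial left kernel
  forces a trivial right one.\<close>

lemma transpose_kernel_trivial:
  fixes M :: "'a \<Rightarrow> 'a \<Rightarrow> 'b::field"
  assumes "finite S"
    and left: "\<And>y i. (\<And>j. j \<in> S \<Longrightarrow> (\<Sum>i\<in>S. y i * M i j) = 0) \<Longrightarrow> i \<in> S \<Longrightarrow> y i = 0"
    and right: "\<And>i. i \<in> S \<Longrightarrow> (\<Sum>j\<in>S. M i j * c j) = 0" and j: "j \<in> S"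
  shows "c j = 0"
proof (rule ccontr)
  assume "c j \<noteq> 0"
  define n where "n = card S"
  obtain f where f: "bij_betw f {0..<n} S"
    using ex_bij_betw_nat_finite[OF \<open>finite S\<close>] n_def by blast
  have fS: "f i \<in> S" if "i < n" for i
    using f that by (auto simp: bij_betw_def)
  define A where "A = mat n n (\<lambda>(i, j). M (f i) (f j))"
  have A: "A \<in> carrier_mat n n" by (simp add: A_def)
  obtain j' where j': "j' < n" "f j' = j"
    using f j by (auto simp: bij_betw_def image_iff)
  have "vec n (c \<circ> f) \<noteq> 0\<^sub>v n"
    using j' \<open>c j \<noteq> 0\<close> by (metis comp_apply index_vec index_zero_vec(1))
  moreover have "A *\<^sub>v vec n (c \<circ> f) = 0\<^sub>v n"
  proof (rule eq_vecI)
    fix i assume "i < dim_vec (0\<^sub>v n :: 'b vec)"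
    then have i: "i < n" by simp
    have "(A *\<^sub>v vec n (c \<circ> f)) $ i = (\<Sum>j\<in>{0..<n}. M (f i) (f j) * c (f j))"
      using i by (simp add: A_def scalar_prod_def)
    also have "\<dots> = (\<Sum>j\<in>S. M (f i) j * c j)"
      by (rule sum.reindex_bij_betw[OF f])
    also have "\<dots> = 0"
      using right[OF fS[OF i]] .
    finally show "(A *\<^sub>v vec n (c \<circ> f)) $ i = 0\<^sub>v n $ i"
      using i by simp
  qed (simp add: A_def)
  ultimately have "det A = 0"
    unfolding det_0_iff_vec_prod_zero[OF A] by (intro exI[of _ "vec n (c \<circ> f)"]) auto
  then have "det (transpose_mat A) = 0"
    using det_transpose[OF A] by simp
  then obtain v where v: "v \<in> carrier_vec n" "v \<noteq> 0\<^sub>v n" "transpose_mat A *\<^sub>v v = 0\<^sub>v n"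
    using det_0_iff_vec_prod_zero[of "transpose_mat A" n] A by auto
  define y where "y = (\<lambda>x. v $ the_inv_into {0..<n} f x)"
  have y: "y (f i) = v $ i" if "i < n" for i
    using f that by (simp add: y_def bij_betw_def the_inv_into_f_f)
  have "(\<Sum>i\<in>S. y i * M i j) = 0" if j: "j \<in> S" for j
  proof -
    obtain j' where j': "j' < n" "f j' = j"
      using f j by (auto simp: bij_betw_def image_iff)
    have "(\<Sum>i\<in>S. y i * M i j) = (\<Sum>i\<in>{0..<n}. y (f i) * M (f i) j)"
      by (rule sum.reindex_bij_betw[OF f, symmetric])
    also have "\<dots> = (transpose_mat A *\<^sub>v v) $ j'"
      using v(1) j' by (simp add: A_def scalar_prod_def y mult.commute)
    also have "\<dots> = 0"
      using v(3) j'(1) by simp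
    finally show ?thesis .
  qed
  then have "v $ i = 0" if "i < n" for i
    using left[of y "f i"] fS[OF that] y[OF that] by simp
  then have "v = 0\<^sub>v n"
    using v(1) by (intro eq_vecI) auto
  then show False using v(2) by simp
qed

lemma common_denominator:
  fixes c :: "'a \<Rightarrow> rat"
  assumes "finite A"
  shows "\<exists>D::int. D > 0 \<and> (\<forall>a\<in>A. of_int D * c a \<in> \<int>)"
  using assms
proof induction
  case (insert x A)
  then obtain D :: int where D: "D > 0" "\<And>a. a \<in> A \<Longrightarrow> of_int D * c a \<in> \<int>" by blast
  obtain p q :: int where pq: "c x = of_int p / of_int q" "q > 0"
    by (metis Fract_of_int_quotient Rat_cases)
  have "of_int (D * q) * c a \<in> \<int>" if "a \<in> insert x A" for a
  proof (cases "a = x")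
    case True
    then have "of_int (D * q) * c a = of_int (D * p)" using pq by simp
    then show ?thesis by (simp only: Ints_of_int)
  next
    case False
    then have "of_int (D * q) * c a = of_int q * (of_int D * c a)" by simp
    moreover have "of_int D * c a \<in> \<int>" using D(2) False that by blast
    ultimately show ?thesis by (simp only: Ints_mult Ints_of_int)
  qed
  then show ?case using D(1) pq(2) by (intro exI[of _ "D * q"]) auto
qed (auto intro: exI[of _ 1])

context finite_group
begin

text \<open>Look at the row where \<open>y\<close> is maximal.\<close>

lemma left_kernel_const:
  fixes w y :: "'a \<Rightarrow> real"
  assumes neg: "\<And>h. h \<in> carrier G \<Longrightarrow> h \<noteq> \<one> \<Longrightarrow> w h < 0"
    and sum0: "(\<Sum>h\<in>carrier G. w h) = 0"
    and ker: "\<And>g. g \<in> carrier G \<Longrightarrow> (\<Sum>h\<in>carrier G. y h * w (h \<otimes> g)) = 0"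
  shows "\<exists>c. \<forall>h\<in>carrier G. y h = c"
proof -
  define M where "M = Max (y ` carrier G)"
  have "M \<in> y ` carrier G"
    unfolding M_def using fin one_closed by (intro Max_in) auto
  then obtain h0 where h0: "h0 \<in> carrier G" "y h0 = M" by auto
  have le: "y h \<le> M" if "h \<in> carrier G" for h
    unfolding M_def using fin that by (intro Max_ge) auto
  have neg': "w (h \<otimes> inv h0) < 0" if "h \<in> carrier G" "h \<noteq> h0" for h
  proof (rule neg)
    show "h \<otimes> inv h0 \<noteq> \<one>"
      using that h0(1) by (metis inv_closed inv_equality inv_inv)
  qed (use that h0 in auto)
  \<comment> \<open>Subtracting \<open>M\<close> keeps the equation because the column sums are 0.
    In the column of \<open>inv h0\<close> every term off \<open>h0\<close> is a product of two
    non-positive factors, and the term at \<open>h0\<close> is 0; hence all terms vanish.\<close>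
  have "(\<Sum>h\<in>carrier G. (y h - M) * w (h \<otimes> inv h0))
      = (\<Sum>h\<in>carrier G. y h * w (h \<otimes> inv h0)) - M * (\<Sum>h\<in>carrier G. w (h \<otimes> inv h0))"
    by (simp add: left_diff_distrib sum_subtractf sum_distrib_left)
  also have "\<dots> = 0"
    using ker[of "inv h0"] sum_rmult[of "inv h0" w] sum0 h0(1) by simp
  finally have "(\<Sum>h\<in>carrier G. (y h - M) * w (h \<otimes> inv h0)) = 0" .
  moreover have "(y h - M) * w (h \<otimes> inv h0) \<ge> 0" if "h \<in> carrier G" for h
    using le[OF that] neg'[OF that] h0(2)
    by (cases "h = h0") (auto intro: mult_nonpos_nonpos)
  ultimately have "(y h - M) * w (h \<otimes> inv h0) = 0" if "h \<in> carrier G" for h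
    using sum_nonneg_eq_0_iff[OF fin] that by (metis (no_types, lifting))
  then have "y h = M" if "h \<in> carrier G" for h
    using neg'[OF that] h0(2) that by (cases "h = h0") fastforce+
  then show ?thesis by blast
qed

text \<open>Adding 1 to all entries of the matrix \<open>v\<^sub>h\<^sub>g\<close> makes it invertible, and an invertible matrix has
  trivial kernels on both sides.\<close>

lemma right_kernel_const:
  fixes v c :: "'a \<Rightarrow> real"
  assumes sum0: "(\<Sum>h\<in>carrier G. v h) = 0"
    and left: "\<And>y. (\<And>g. g \<in> carrier G \<Longrightarrow> (\<Sum>h\<in>carrier G. y h * v (h \<otimes> g)) = 0) \<Longrightarrow>
      \<exists>c. \<forall>h\<in>carrier G. y h = c"
    and ker: "\<And>h. h \<in> carrier G \<Longrightarrow> (\<Sum>g\<in>carrier G. c g * v (h \<otimes> g)) = 0"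
  shows "\<exists>d. \<forall>g\<in>carrier G. c g = d"
proof -
  define n where "n = real (card (carrier G))"
  have n: "n > 0" using card_pos by (simp add: n_def)
  \<comment> \<open>The mean value: the all-ones matrix annihilates \<open>c - d\<close>, so adding
    it to the matrix keeps \<open>c - d\<close> in the kernel.\<close>
  define d where "d = (\<Sum>g\<in>carrier G. c g) / n"
  have sumd: "(\<Sum>g\<in>carrier G. c g - d) = 0"
    using n by (simp add: sum_subtractf d_def n_def)
  have row: "(\<Sum>g\<in>carrier G. v (h \<otimes> g)) = 0" if "h \<in> carrier G" for h
    using sum_lmult[OF that, of v] sum0 by simp
  have "c g - d = 0" if g: "g \<in> carrier G" for g
  proof (rule transpose_kernel_trivial[where S = "carrier G" and M = "\<lambda>h g. v (h \<otimes> g) + 1"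
        and c = "\<lambda>g. c g - d"])
    show "finite (carrier G)" by (rule fin)
    show "g \<in> carrier G" by (rule g)
    fix h assume h: "h \<in> carrier G"
    have "(\<Sum>g\<in>carrier G. (v (h \<otimes> g) + 1) * (c g - d))
        = (\<Sum>g\<in>carrier G. c g * v (h \<otimes> g)) - d * (\<Sum>g\<in>carrier G. v (h \<otimes> g)) + (\<Sum>g\<in>carrier G. c g - d)"
      by (simp add: algebra_simps sum.distrib sum_subtractf sum_distrib_left)
    then show "(\<Sum>g\<in>carrier G. (v (h \<otimes> g) + 1) * (c g - d)) = 0"
      using ker[OF h] row[OF h] sumd by simp
  next
    fix y h assume y: "\<And>g. g \<in> carrier G \<Longrightarrow> (\<Sum>h\<in>carrier G. y h * (v (h \<otimes> g) + 1)) = 0"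
      and h: "h \<in> carrier G"
    have split: "(\<Sum>h\<in>carrier G. y h * v (h \<otimes> g)) + (\<Sum>h\<in>carrier G. y h) = 0" if "g \<in> carrier G" for g
      using y[OF that] by (simp add: distrib_left sum.distrib)
    \<comment> \<open>Adding up all columns removes the entries \<open>v\<close>, whose row sums are
      0, and leaves \<open>n\<close> times the sum of \<open>y\<close>.\<close>
    have "0 = (\<Sum>g\<in>carrier G. (\<Sum>h\<in>carrier G. y h * v (h \<otimes> g)) + (\<Sum>h\<in>carrier G. y h))"
      using split by simp
    also have "\<dots> = (\<Sum>g\<in>carrier G. \<Sum>h\<in>carrier G. y h * v (h \<otimes> g)) + n * (\<Sum>h\<in>carrier G. y h)"
      by (simp add: sum.distrib n_def)
    also have "(\<Sum>g\<in>carrier G. \<Sum>h\<in>carrier G. y h * v (h \<otimes> g))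
        = (\<Sum>h\<in>carrier G. y h * (\<Sum>g\<in>carrier G. v (h \<otimes> g)))"
      by (subst sum.swap) (simp add: sum_distrib_left)
    also have "\<dots> = 0"
      using row by simp
    finally have sumy: "(\<Sum>h\<in>carrier G. y h) = 0"
      using n by simp
    have "\<exists>c. \<forall>h\<in>carrier G. y h = c"
      using split sumy by (intro left) simp
    then obtain e where e: "\<And>h. h \<in> carrier G \<Longrightarrow> y h = e" by blast
    then have "n * e = 0"
      using sumy by (simp add: n_def)
    then show "y h = 0"
      using n e h by simp
  qed
  then show ?thesis by (intro exI[of _ d]) auto
qed

end

context real_galois_field
begin

section \<open>Logarithms of units and their linear relations\<close>

definition log_abs :: "'k \<Rightarrow> ('k \<Rightarrow> 'k) \<Rightarrow> real" where
  "log_abs x h = ln \<bar>\<iota> (h x)\<bar>"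

lemma embedding_eq_0_iff: "h \<in> Gal \<Longrightarrow> \<iota> (h x) = 0 \<longleftrightarrow> x = 0"
  using is_ring_hom_eq_0_iff[OF hom] is_ring_hom_eq_0_iff[OF Gal_hom] by simp

lemma log_abs_1: "h \<in> Gal \<Longrightarrow> log_abs 1 h = 0"
  using is_ring_hom_1[OF hom] is_ring_hom_1[OF Gal_hom[of h]] by (simp add: log_abs_def)

lemma log_abs_mult:
  "h \<in> Gal \<Longrightarrow> x \<noteq> 0 \<Longrightarrow> y \<noteq> 0 \<Longrightarrow> log_abs (x * y) h = log_abs x h + log_abs y h"
  using embedding_eq_0_iff[of h x] embedding_eq_0_iff[of h y]
  by (simp add: log_abs_def is_ring_hom_mult[OF hom] is_ring_hom_mult[OF Gal_hom] abs_mult ln_mult)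

lemma log_abs_inverse: "h \<in> Gal \<Longrightarrow> x \<noteq> 0 \<Longrightarrow> log_abs (inverse x) h = - log_abs x h"
  using embedding_eq_0_iff[of h x]
  by (simp add: log_abs_def is_ring_hom_inverse[OF hom] is_ring_hom_inverse[OF Gal_hom] ln_inverse)

lemma log_abs_power: "h \<in> Gal \<Longrightarrow> x \<noteq> 0 \<Longrightarrow> log_abs (x ^ n) h = real n * log_abs x h"
  by (induction n) (auto simp: log_abs_1 log_abs_mult algebra_simps)

lemma log_abs_conj: "log_abs (g x) h = log_abs x (h \<circ> g)"
  by (simp add: log_abs_def)

lemma integer_units_simps:
  "carrier (integer_units TYPE('k)) = {x. x \<noteq> 0 \<and> algebraic_int x \<and> algebraic_int (inverse x)}"
  "x \<otimes>\<^bsub>integer_units TYPE('k)\<^esub> y = x * y"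
  "\<one>\<^bsub>integer_units TYPE('k)\<^esub> = 1"
  by (simp_all add: integer_units_def)

lemma integer_units_group: "group (integer_units TYPE('k))"
proof (rule groupI)
  fix x assume "x \<in> carrier (integer_units TYPE('k))"
  then show "\<exists>y\<in>carrier (integer_units TYPE('k)).
      y \<otimes>\<^bsub>integer_units TYPE('k)\<^esub> x = \<one>\<^bsub>integer_units TYPE('k)\<^esub>"
    by (intro bexI[of _ "inverse x"]) (auto simp: integer_units_simps)
qed (auto simp: integer_units_simps inverse_mult_distrib intro: algebraic_int_times int_imp_algebraic_int)

text \<open>The norms of \<open>x\<close> and of its inverse are integers with product 1, so the
  norm is 1 or -1 and the logarithm of its absolute value is 0.\<close>

lemma sum_log_abs_unit:
  assumes "x \<in> carrier (integer_units TYPE('k))"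
  shows "(\<Sum>h\<in>Gal. log_abs x h) = 0"
proof -
  have x: "x \<noteq> 0" "algebraic_int x" "algebraic_int (inverse x)"
    using assms by (auto simp: integer_units_simps)
  obtain M N where MN: "gal_norm x = of_int M" "gal_norm (inverse x) = of_int N"
    using gal_norm_int[OF x(2)] gal_norm_int[OF x(3)] by metis
  have "gal_norm x * gal_norm (inverse x) = (\<Prod>\<sigma>\<in>Gal. \<sigma> x * \<sigma> (inverse x))"
    by (simp add: gal_norm_def prod.distrib)
  also have "\<dots> = 1"
  proof (rule prod.neutral, rule ballI)
    fix \<sigma> assume \<sigma>: "\<sigma> \<in> Gal"
    show "\<sigma> x * \<sigma> (inverse x) = 1"
      using x(1) is_ring_hom_mult[OF Gal_hom[OF \<sigma>], of x "inverse x"]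
      by (simp add: is_ring_hom_1[OF Gal_hom[OF \<sigma>]])
  qed
  finally have "(of_int (M * N) :: 'k) = of_int 1"
    by (simp add: MN)
  then have "M * N = 1"
    by (simp only: of_int_eq_iff)
  then have "\<bar>M\<bar> = 1"
    by (metis abs_1 abs_zmult_eq_1)
  then have "\<bar>\<iota> (gal_norm x)\<bar> = 1"
    by (simp add: MN is_ring_hom_of_int[OF hom] flip: of_int_abs)
  moreover have "\<iota> (gal_norm x) = (\<Prod>h\<in>Gal. \<iota> (h x))"
    by (simp add: gal_norm_def is_ring_hom_prod[OF hom])
  ultimately have "(\<Prod>h\<in>Gal. \<bar>\<iota> (h x)\<bar>) = 1"
    by (simp add: abs_prod)
  moreover have "ln (\<Prod>h\<in>Gal. \<bar>\<iota> (h x)\<bar>) = (\<Sum>h\<in>Gal. ln \<bar>\<iota> (h x)\<bar>)"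
    using embedding_eq_0_iff x(1) finite_Gal by (intro ln_prod) auto
  ultimately show ?thesis by (simp add: log_abs_def)
qed

text \<open>Conjugating \<open>u\<close> by \<open>g\<close> translates its logarithmic vector, and
  the logarithm turns products into sums; generators and their inverses contribute coefficients 1
  and -1.\<close>

lemma log_abs_generate:
  assumes u: "u \<in> carrier (integer_units TYPE('k))"
    and "x \<in> generate (integer_units TYPE('k)) {\<sigma> u | \<sigma>. \<sigma> \<in> Gal}"
  shows "x \<noteq> 0 \<and> (\<exists>a. \<forall>h\<in>Gal. log_abs x h = (\<Sum>g\<in>Gal. a g * log_abs u (h \<circ> g)))"
  using assms(2)
proof induction
  case one
  show ?case
    by (auto simp: integer_units_simps log_abs_1 intro!: exI[of _ "\<lambda>_. 0"])
next
  case (incl y)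
  then obtain \<sigma> where \<sigma>: "y = \<sigma> u" "\<sigma> \<in> Gal" by auto
  have "(\<Sum>g\<in>Gal. (if g = \<sigma> then 1 else 0) * log_abs u (h \<circ> g)) = log_abs y h" for h
  proof -
    have "(\<Sum>g\<in>Gal. (if g = \<sigma> then 1 else 0) * log_abs u (h \<circ> g))
        = (\<Sum>g\<in>Gal. if g = \<sigma> then log_abs u (h \<circ> g) else 0)"
      by (intro sum.cong) auto
    then show ?thesis using \<sigma> finite_Gal by (simp add: log_abs_conj)
  qed
  moreover have "y \<noteq> 0"
    using u \<sigma> is_ring_hom_eq_0_iff[OF Gal_hom[OF \<sigma>(2)]] by (auto simp: integer_units_simps)
  ultimately show ?case
    by (intro conjI exI[of _ "\<lambda>g. if g = \<sigma> then 1 else 0"] ballI) (simp_all only: not_False_eq_True)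
next
  case (inv y)
  interpret U: group "integer_units TYPE('k)" by (rule integer_units_group)
  obtain \<sigma> where \<sigma>: "y = \<sigma> u" "\<sigma> \<in> Gal" using inv by auto
  have y: "y \<in> carrier (integer_units TYPE('k))"
    using u \<sigma> is_ring_hom_eq_0_iff[OF Gal_hom[OF \<sigma>(2)]] is_ring_hom_inverse[OF Gal_hom[OF \<sigma>(2)], of u]
      is_ring_hom_algebraic_int[OF Gal_hom[OF \<sigma>(2)], of u]
      is_ring_hom_algebraic_int[OF Gal_hom[OF \<sigma>(2)], of "inverse u"]
    by (auto simp: integer_units_simps)
  then have y0: "y \<noteq> 0" by (simp add: integer_units_simps)
  have "inv\<^bsub>integer_units TYPE('k)\<^esub> y = inverse y"
    using y by (intro U.inv_equality) (auto simp: integer_units_simps)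
  moreover have "(\<Sum>g\<in>Gal. (if g = \<sigma> then -1 else 0) * log_abs u (h \<circ> g)) = log_abs (inverse y) h"
    if "h \<in> Gal" for h
  proof -
    have "(\<Sum>g\<in>Gal. (if g = \<sigma> then -1 else 0) * log_abs u (h \<circ> g))
        = (\<Sum>g\<in>Gal. if g = \<sigma> then - log_abs u (h \<circ> g) else 0)"
      by (intro sum.cong) auto
    then show ?thesis using \<sigma> finite_Gal that y0 by (simp add: log_abs_inverse) (simp add: log_abs_conj)
  qed
  ultimately show ?case
    using y0 by (intro conjI exI[of _ "\<lambda>g. if g = \<sigma> then -1 else 0"] ballI)
      (simp_all only: inverse_nonzero_iff_nonzero not_False_eq_True)
next
  case (eng y z)
  then obtain a b where ab: "\<And>h. h \<in> Gal \<Longrightarrow> log_abs y h = (\<Sum>g\<in>Gal. a g * log_abs u (h \<circ> g))"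
    "\<And>h. h \<in> Gal \<Longrightarrow> log_abs z h = (\<Sum>g\<in>Gal. b g * log_abs u (h \<circ> g))"
    by (elim conjE exE) blast
  show ?case
  proof (intro conjI exI[of _ "\<lambda>g. a g + b g"] ballI)
    show "y \<otimes>\<^bsub>integer_units TYPE('k)\<^esub> z \<noteq> 0"
      using eng by (simp add: integer_units_simps)
    fix h assume h: "h \<in> Gal"
    have "log_abs (y \<otimes>\<^bsub>integer_units TYPE('k)\<^esub> z) h = log_abs y h + log_abs z h"
      using eng h by (simp add: integer_units_simps log_abs_mult)
    then show "log_abs (y \<otimes>\<^bsub>integer_units TYPE('k)\<^esub> z) h = (\<Sum>g\<in>Gal. (a g + b g) * log_abs u (h \<circ> g))"
      by (simp only: ab[OF h] distrib_right sum.distrib)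
  qed
qed

text \<open>With finitely many cosets, two powers of \<open>x\<close> share one; the difference of
  their exponents is the required \<open>m\<close>.\<close>

lemma weak_minkowski_power:
  assumes "weak_minkowski_unit u" and x: "x \<in> carrier (integer_units TYPE('k))"
  obtains m :: nat where "m > 0"
    "x ^ m \<in> generate (integer_units TYPE('k)) {\<sigma> u | \<sigma>. \<sigma> \<in> Gal}"
proof -
  let ?U = "integer_units TYPE('k)"
  let ?H = "generate ?U {\<sigma> u | \<sigma>. \<sigma> \<in> Gal}"
  have fin: "finite (rcosets\<^bsub>?U\<^esub> ?H)"
    using assms(1) by (simp add: weak_minkowski_unit_def Let_def)
  have xk: "x ^ k \<in> carrier ?U" for k
    using x by (auto simp: integer_units_simps power_inverse[symmetric] algebraic_int_power)
  have "range (\<lambda>k. ?H #>\<^bsub>?U\<^esub> x ^ k) \<subseteq> rcosets\<^bsub>?U\<^esub> ?H"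
    using xk by (auto simp: RCOSETS_def)
  then have "finite (range (\<lambda>k. ?H #>\<^bsub>?U\<^esub> x ^ k))"
    using fin by (rule finite_subset)
  from finite_range_repeats[OF this]
  obtain k l where kl: "?H #>\<^bsub>?U\<^esub> x ^ k = ?H #>\<^bsub>?U\<^esub> x ^ l" "k < l"
    by blast
  have "x ^ l \<in> ?H #>\<^bsub>?U\<^esub> x ^ l"
    using generate.one[of ?U] by (force simp: r_coset_def integer_units_simps)
  then have "x ^ l \<in> ?H #>\<^bsub>?U\<^esub> x ^ k"
    unfolding kl(1) .
  then obtain h where h: "h \<in> ?H" "x ^ l = h * x ^ k"
    unfolding r_coset_def integer_units_simps by blast
  have "x ^ l = x ^ (l - k) * x ^ k"
    using kl(2) by (simp flip: power_add)
  then have "x ^ (l - k) = h"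
    using h(2) x by (auto simp: integer_units_simps)
  then show ?thesis
    using that[of "l - k"] kl(2) h(1) by simp
qed

text \<open>Up to the factor \<open>m\<close>, the columns of the matrix of the Dirichlet unit are
  combinations of the columns for \<open>u\<close>. A left kernel vector for \<open>u\<close> is
  therefore one for the Dirichlet unit, hence constant; \<open>right_kernel_const\<close> carries
  this over to the right kernel.\<close>

lemma log_abs_kernel_const:
  assumes u: "weak_minkowski_unit u"
    and ker: "\<And>h. h \<in> Gal \<Longrightarrow> (\<Sum>g\<in>Gal. c g * log_abs u (h \<circ> g)) = 0"
  shows "\<exists>d. \<forall>g\<in>Gal. c g = d"
proof (rule Gal.right_kernel_const[where v = "log_abs u"])
  have uU: "u \<in> carrier (integer_units TYPE('k))"
    using u by (simp add: weak_minkowski_unit_def Let_def)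
  then show "(\<Sum>h\<in>Gal. log_abs u h) = 0"
    by (rule sum_log_abs_unit)
  show "(\<Sum>g\<in>Gal. c g * log_abs u (h \<otimes>\<^bsub>gal_group TYPE('k)\<^esub> g)) = 0" if "h \<in> Gal" for h
    using ker[OF that] by (simp add: gal_group_simps)
  fix y assume y: "\<And>g. g \<in> Gal \<Longrightarrow> (\<Sum>h\<in>Gal. y h * log_abs u (h \<otimes>\<^bsub>gal_group TYPE('k)\<^esub> g)) = 0"
  obtain \<epsilon> where \<epsilon>: "\<epsilon> \<noteq> 0" "algebraic_int \<epsilon>" "algebraic_int (inverse \<epsilon>)"
    "\<And>\<sigma>. \<sigma> \<in> Gal - {id} \<Longrightarrow> \<bar>\<iota> (\<sigma> \<epsilon>)\<bar> < 1"
    using dirichlet_unit by blast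
  have \<epsilon>U: "\<epsilon> \<in> carrier (integer_units TYPE('k))"
    using \<epsilon> by (simp add: integer_units_simps)
  obtain m where m: "m > 0" "\<epsilon> ^ m \<in> generate (integer_units TYPE('k)) {\<sigma> u | \<sigma>. \<sigma> \<in> Gal}"
    using weak_minkowski_power[OF u \<epsilon>U] by blast
  obtain a where a: "\<And>h. h \<in> Gal \<Longrightarrow> log_abs (\<epsilon> ^ m) h = (\<Sum>g\<in>Gal. a g * log_abs u (h \<circ> g))"
    using log_abs_generate[OF uU m(2)] by (elim conjE exE) blast
  show "\<exists>c. \<forall>h\<in>Gal. y h = c"
  proof (rule Gal.left_kernel_const[where w = "log_abs \<epsilon>"])
    show "log_abs \<epsilon> h < 0" if "h \<in> Gal" "h \<noteq> \<one>\<^bsub>gal_group TYPE('k)\<^esub>" for h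
      using that \<epsilon>(4)[of h] \<epsilon>(1) embedding_eq_0_iff[OF that(1), of \<epsilon>]
      by (simp add: log_abs_def gal_group_simps)
    show "(\<Sum>h\<in>Gal. log_abs \<epsilon> h) = 0"
      by (rule sum_log_abs_unit[OF \<epsilon>U])
    fix k assume k: "k \<in> Gal"
    have comp: "h \<circ> k \<in> Gal" if "h \<in> Gal" for h
      using Gal.m_closed[OF that k] by (simp add: gal_group_simps)
    have "real m * (\<Sum>h\<in>Gal. y h * log_abs \<epsilon> (h \<circ> k)) = (\<Sum>h\<in>Gal. y h * log_abs (\<epsilon> ^ m) (h \<circ> k))"
      using \<epsilon>(1) by (simp add: sum_distrib_left log_abs_power comp mult_ac)
    also have "\<dots> = (\<Sum>h\<in>Gal. \<Sum>g\<in>Gal. a g * (y h * log_abs u (h \<circ> (k \<circ> g))))"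
      by (intro sum.cong refl) (simp add: a comp sum_distrib_left mult_ac comp_assoc)
    also have "\<dots> = (\<Sum>g\<in>Gal. a g * (\<Sum>h\<in>Gal. y h * log_abs u (h \<circ> (k \<circ> g))))"
      by (subst sum.swap) (simp add: sum_distrib_left)
    also have "\<dots> = 0"
    proof (intro sum.neutral ballI)
      fix g assume "g \<in> Gal"
      then have "k \<circ> g \<in> Gal"
        using Gal.m_closed[OF k] by (simp add: gal_group_simps)
      then show "a g * (\<Sum>h\<in>Gal. y h * log_abs u (h \<circ> (k \<circ> g))) = 0"
        using y[of "k \<circ> g"] by (simp add: gal_group_simps)
    qed
    finally show "(\<Sum>h\<in>Gal. y h * log_abs \<epsilon> (h \<otimes>\<^bsub>gal_group TYPE('k)\<^esub> k)) = 0"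
      using m(1) by (simp add: gal_group_simps)
  qed
qed

text \<open>The witness is the product of the powers \<open>g u ^ C g\<close>. It turns an integer
  relation between logarithms into a statement about one element of the field.\<close>

lemma integer_combination_realized:
  fixes C :: "('k \<Rightarrow> 'k) \<Rightarrow> int"
  assumes "u \<noteq> 0" "finite A" "A \<subseteq> Gal"
  shows "\<exists>x. x \<noteq> 0 \<and> (\<forall>h\<in>Gal. log_abs x h = (\<Sum>g\<in>A. of_int (C g) * log_abs u (h \<circ> g)))"
  using assms(2,3)
proof induction
  case empty
  show ?case by (intro exI[of _ 1]) (auto simp: log_abs_1)
next
  case (insert g A)
  then obtain x where x: "x \<noteq> 0" "\<And>h. h \<in> Gal \<Longrightarrow> log_abs x h = (\<Sum>g\<in>A. of_int (C g) * log_abs u (h \<circ> g))"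
    by blast
  have gu: "g u \<noteq> 0"
    using assms(1) is_ring_hom_eq_0_iff[OF Gal_hom[of g]] insert.prems by simp
  define y where "y = (if C g \<ge> 0 then g u ^ nat (C g) else inverse (g u ^ nat (- C g)))"
  have "y \<noteq> 0" using gu by (simp add: y_def)
  have "log_abs y h = of_int (C g) * log_abs u (h \<circ> g)" if "h \<in> Gal" for h
    unfolding log_abs_conj[of g u h, symmetric]
    using gu that by (simp add: y_def log_abs_power log_abs_inverse)
  then have "log_abs (y * x) h = (\<Sum>g\<in>insert g A. of_int (C g) * log_abs u (h \<circ> g))" if "h \<in> Gal" for h
    using x \<open>y \<noteq> 0\<close> insert.hyps that by (simp only: log_abs_mult sum.insert not_False_eq_True)
  then show ?case
    using x(1) \<open>y \<noteq> 0\<close> by (intro exI[of _ "y * x"]) (simp only: mult_eq_0_iff, blast)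
qed

lemma log_abs_rat_independent:
  fixes c :: "('k \<Rightarrow> 'k) \<Rightarrow> rat"
  assumes u: "weak_minkowski_unit u"
    and zero: "(\<Sum>g\<in>Gal - {id}. of_rat (c g) * log_abs u g) = 0" and g: "g \<in> Gal - {id}"
  shows "c g = 0"
proof -
  have u0: "u \<noteq> 0"
    using u by (simp add: weak_minkowski_unit_def Let_def integer_units_simps)
  obtain D :: int where D: "D > 0" "\<And>g. g \<in> Gal \<Longrightarrow> of_int D * c g \<in> \<int>"
    using common_denominator[OF finite_Gal, of c] by blast
  have "\<forall>g\<in>Gal. \<exists>z. of_int D * c g = of_int z"
    using D(2) by (auto elim: Ints_cases)
  then obtain C' where C': "\<And>g. g \<in> Gal \<Longrightarrow> of_int D * c g = of_int (C' g)"
    by metis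
  \<comment> \<open>With coefficient 0 at \<open>id\<close> the sum may run over the whole group;
    once \<open>C\<close> is known to be constant, this value forces it to vanish.\<close>
  define C where "C = C'(id := 0)"
  have C: "real_of_int (C g) = real_of_int D * of_rat (c g)" if "g \<in> Gal - {id}" for g
  proof -
    have "of_rat (of_int D * c g) = (of_rat (of_int (C' g)) :: real)"
      using C' that by simp
    then show ?thesis using that by (simp add: C_def of_rat_mult)
  qed
  obtain x where x: "x \<noteq> 0" "\<And>h. h \<in> Gal \<Longrightarrow> log_abs x h = (\<Sum>g\<in>Gal. of_int (C g) * log_abs u (h \<circ> g))"
    using integer_combination_realized[OF u0 finite_Gal order_refl, of C] by blast
  have "log_abs x id = (\<Sum>g\<in>Gal - {id}. of_int (C g) * log_abs u g)"
    using x(2)[OF id_Gal] finite_Gal id_Gal by (simp add: sum.remove[of Gal id] C_def)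
  also have "\<dots> = real_of_int D * (\<Sum>g\<in>Gal - {id}. of_rat (c g) * log_abs u g)"
    using C by (simp add: sum_distrib_left mult.assoc)
  finally have "ln \<bar>\<iota> x\<bar> = 0"
    using zero by (simp add: log_abs_def)
  \<comment> \<open>Here it matters that the embedding is real: absolute value 1 leaves only 1 and
    -1, whose conjugates all have logarithm 0.\<close>
  then have "\<bar>\<iota> x\<bar> = 1"
    using is_ring_hom_eq_0_iff[OF hom, of x] x(1) by simp
  then have "\<iota> x = \<iota> 1 \<or> \<iota> x = \<iota> (- 1)"
    using is_ring_hom_1[OF hom] is_ring_hom_minus[OF hom, of 1] by auto
  then have "x = 1 \<or> x = - 1"
    by (simp only: is_ring_hom_eq_iff[OF hom])
  then have "log_abs x h = 0" if "h \<in> Gal" for h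
    using log_abs_1[OF that] is_ring_hom_minus[OF hom] is_ring_hom_minus[OF Gal_hom[OF that]]
    by (auto simp: log_abs_def)
  then have "\<exists>d. \<forall>g\<in>Gal. real_of_int (C g) = d"
    using x(2) by (intro log_abs_kernel_const[OF u]) simp
  then have "real_of_int (C g) = real_of_int (C id)"
    using g id_Gal by (metis DiffD1)
  then have "real_of_int (C g) = 0"
    by (simp add: C_def)
  then show ?thesis using C[OF g] D(1) by simp
qed

end

subsection \<open>Genericity of the Gram form\<close>

context real_galois_field
begin

lemma sum_log_vec:
  assumes "weak_minkowski_unit u"
  shows "(\<Sum>g\<in>Gal. log_vec \<iota> u g) = 0"
proof -
  have "(\<Sum>g\<in>Gal. log_vec \<iota> u g) = of_real (\<Sum>g\<in>Gal. log_abs u g)"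
    by (simp add: log_vec_def log_abs_def)
  also have "(\<Sum>g\<in>Gal. log_abs u g) = 0"
    using assms by (intro sum_log_abs_unit) (simp add: weak_minkowski_unit_def Let_def)
  finally show ?thesis by simp
qed

text \<open>Each of these numbers is the logarithm of some \<open>\<bar>\<iota> (g u)\<bar>\<close>,
  which is algebraic, so the conjecture applies. The numbering \<open>e\<close> matches its families
  indexed by \<open>{..<m}\<close>.\<close>

lemma log_vec_alg_independent:
  fixes e :: "nat \<Rightarrow> 'k \<Rightarrow> 'k"
  assumes "weak_schanuel_conjecture" and u: "weak_minkowski_unit u"
    and e: "bij_betw e {..<m} (Gal - {id})"
  shows "alg_independent \<rat> {..<m} (log_vec \<iota> u \<circ> e)"
proof -
  have eG: "e i \<in> Gal - {id}" if "i < m" for i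
    using e that by (auto simp: bij_betw_def)
  have l: "(log_vec \<iota> u \<circ> e) i = of_real (log_abs u (e i))" if "i < m" for i
    using eG[OF that] by (simp add: log_vec_def log_abs_def)
  have "algebraic (exp ((log_vec \<iota> u \<circ> e) i))" if i: "i < m" for i
  proof -
    have "u \<noteq> 0" "algebraic_int u"
      using u by (auto simp: weak_minkowski_unit_def Let_def integer_units_simps)
    have "algebraic_int (\<iota> (e i u))"
      using is_ring_hom_algebraic_int[OF hom is_ring_hom_algebraic_int[OF Gal_hom \<open>algebraic_int u\<close>]]
        eG[OF i] by blast
    then have "algebraic (complex_of_real \<bar>\<iota> (e i u)\<bar>)"
      by (simp add: algebraic_int_imp_algebraic)
    moreover have "exp (log_abs u (e i)) = \<bar>\<iota> (e i u)\<bar>"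
      using embedding_eq_0_iff[of "e i" u] eG[OF i] \<open>u \<noteq> 0\<close> by (simp add: log_abs_def)
    ultimately show ?thesis
      by (simp only: l[OF i] exp_of_real)
  qed
  moreover have "rat_lin_independent {..<m} (log_vec \<iota> u \<circ> e)"
    unfolding rat_lin_independent_def
  proof (intro allI impI ballI)
    fix c :: "nat \<Rightarrow> rat" and i
    assume zero: "(\<Sum>i<m. of_rat (c i) * (log_vec \<iota> u \<circ> e) i) = 0" and i: "i \<in> {..<m}"
    have of_rat: "complex_of_real (of_rat q) = of_rat q" for q
      by (rule is_ring_hom_of_rat) (simp add: is_ring_hom_def)
    define c' where "c' = c \<circ> the_inv_into {..<m} e"
    have c': "c' (e j) = c j" if "j < m" for j
      using e that by (simp add: c'_def bij_betw_def the_inv_into_f_f)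
    have "complex_of_real (\<Sum>g\<in>Gal - {id}. of_rat (c' g) * log_abs u g)
        = complex_of_real (\<Sum>i<m. of_rat (c' (e i)) * log_abs u (e i))"
      by (simp only: sum.reindex_bij_betw[OF e, of "\<lambda>g. of_rat (c' g) * log_abs u g"])
    also have "\<dots> = (\<Sum>i<m. of_rat (c i) * (log_vec \<iota> u \<circ> e) i)"
      unfolding of_real_sum by (intro sum.cong refl) (simp add: c' l of_rat del: comp_apply)
    finally have "(\<Sum>g\<in>Gal - {id}. of_rat (c' g) * log_abs u g) = 0"
      using zero by (simp only: of_real_eq_0_iff)
    then have "c' (e i) = 0"
      using log_abs_rat_independent[OF u] eG i by blast
    then show "c i = 0"
      using c' i by simp
  qed
  ultimately show ?thesis
    using assms(1) unfolding weak_schanuel_conjecture_def by blast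
qed

text \<open>The coordinates off \<open>id\<close> parametrise the vectors of sum 0 linearly. In
  these parameters the composite of \<open>F\<close> with the Gram form is a polynomial over
  \<open>Qbar\<close> that vanishes at algebraically independent numbers, hence everywhere.\<close>

lemma polyfun_zero_at_gram_imp_zero:
  assumes wsc: "weak_schanuel_conjecture" and u: "weak_minkowski_unit u"
    and F: "F \<in> polyfun Qbar (Gal \<times> Gal)"
    and zero: "F (form_coords (gal_group TYPE('k)) (gram_form (gal_group TYPE('k)) (log_vec \<iota> u))) = 0"
    and sum0: "(\<Sum>g\<in>Gal. x g) = 0"
  shows "F (\<lambda>(g, h). \<Sum>k\<in>Gal. x (k \<otimes>\<^bsub>gal_group TYPE('k)\<^esub> g) * x (k \<otimes>\<^bsub>gal_group TYPE('k)\<^esub> h)) = 0"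
proof -
  define m where "m = card (Gal - {id})"
  obtain e where e: "bij_betw e {..<m} (Gal - {id})"
    using ex_bij_betw_nat_finite[of "Gal - {id}"] finite_Gal by (auto simp: m_def atLeast0LessThan)
  \<comment> \<open>The entry at \<open>id\<close> completes \<open>z\<close> to sum 0. The sign is
    written as a product with a constant because \<open>polyfun\<close> has a rule for products but
    none for negation.\<close>
  define X where "X = (\<lambda>z g. if g = id then - 1 * (\<Sum>i<m. z i) else z (the_inv_into {..<m} e g) :: complex)"
  define W where "W = (\<lambda>y (g, h). \<Sum>k\<in>Gal. y (k \<otimes>\<^bsub>gal_group TYPE('k)\<^esub> g) * y (k \<otimes>\<^bsub>gal_group TYPE('k)\<^esub> h) :: complex)"
  have inv_e: "the_inv_into {..<m} e g \<in> {..<m}" "e (the_inv_into {..<m} e g) = g" if "g \<in> Gal" "g \<noteq> id" for g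
    using e that the_inv_into_into[of e "{..<m}" g "{..<m}"] f_the_inv_into_f[of e "{..<m}" g]
    by (auto simp: bij_betw_def)
  have X_restrict: "X (y \<circ> e) g = y g" if y: "(\<Sum>g\<in>Gal. y g) = 0" and g: "g \<in> Gal" for y g
  proof (cases "g = id")
    case True
    have "(\<Sum>i<m. y (e i)) = (\<Sum>g\<in>Gal - {id}. y g)"
      by (rule sum.reindex_bij_betw[OF e])
    then show ?thesis
      using y True finite_Gal id_Gal by (simp add: X_def sum.remove[of Gal id] neg_eq_iff_add_eq_0 add.commute)
  next
    case False
    then show ?thesis using inv_e[OF g] by (simp add: X_def)
  qed
  have mult_Gal: "k \<otimes>\<^bsub>gal_group TYPE('k)\<^esub> g \<in> Gal" if "k \<in> Gal" "g \<in> Gal" for k g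
    using that by (rule Gal.m_closed)
  have W_restrict: "F (W (X (y \<circ> e))) = F (W y)" if "(\<Sum>g\<in>Gal. y g) = 0" for y
    by (rule polyfun_cong[OF F]) (auto simp: W_def X_restrict[OF that] mult_Gal intro!: sum.cong)
  have Qbar_mem: "0 \<in> Qbar" "1 \<in> Qbar" "- 1 \<in> Qbar"
    by (auto simp: Qbar_def intro: rat_imp_algebraic)
  have Xpoly: "(\<lambda>z. X z g) \<in> polyfun Qbar {..<m}" if "g \<in> Gal" for g
  proof (cases "g = id")
    case True
    have "(\<lambda>z. - 1 * (\<Sum>i<m. z i)) \<in> polyfun Qbar {..<m}"
      by (intro polyfun.mult polyfun.const polyfun_sum polyfun.var Qbar_mem)
    then show ?thesis
      using True by (simp add: X_def)
  next
    case False
    then show ?thesis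
      using polyfun.var[OF inv_e(1)[OF that False]] by (simp add: X_def)
  qed
  have "(\<lambda>z. F (W (X z))) \<in> polyfun Qbar {..<m}"
  proof (rule polyfun_subst[OF F])
    fix j assume "j \<in> Gal \<times> Gal"
    then obtain g h where j: "j = (g, h)" "g \<in> Gal" "h \<in> Gal" by auto
    show "(\<lambda>z. W (X z) j) \<in> polyfun Qbar {..<m}"
      unfolding W_def j(1) prod.case
      by (intro polyfun_sum polyfun.mult Xpoly mult_Gal j Qbar_mem)
  qed
  moreover have "F (W (X (log_vec \<iota> u \<circ> e))) = 0"
  proof -
    have "F (W (X (log_vec \<iota> u \<circ> e))) = F (W (log_vec \<iota> u))"
      by (rule W_restrict[OF sum_log_vec[OF u]])
    also have "\<dots> = F (form_coords (gal_group TYPE('k)) (gram_form (gal_group TYPE('k)) (log_vec \<iota> u)))"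
      by (rule polyfun_cong[OF F]) (auto simp: W_def Gal.form_coords_gram_form[OF sum_log_vec[OF u]])
    finally show ?thesis using zero by simp
  qed
  ultimately have "F (W (X z)) = 0" for z
    using alg_independent_imp_polyfun_eq_0[OF log_vec_alg_independent[OF wsc u e], of "\<lambda>z. F (W (X z))" z]
    by (simp add: Qbar_def)
  then have "F (W x) = 0"
    using W_restrict[OF sum0] by simp
  then show ?thesis by (simp add: W_def)
qed

end

theorem theorem4p5:
  fixes \<iota> :: "'k::field_char_0 \<Rightarrow> real" and u :: 'k
  assumes "weak_schanuel_conjecture"
    and "number_field TYPE('k)"
    and "galois_over_rat TYPE('k)"
    and "is_ring_hom \<iota>"
    and "weak_minkowski_unit u"
  shows "generic_sym_form (gal_group TYPE('k)) (gram_form (gal_group TYPE('k)) (log_vec \<iota> u))"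
proof -
  interpret real_galois_field \<iota>
    using assms by unfold_locales
  let ?G = "gal_group TYPE('k)"
  let ?b = "gram_form ?G (log_vec \<iota> u)"
  \<comment> \<open>Genericity reduces to this: a closed subset over \<open>Qbar\<close> that
    contains the Gram form is cut out by polynomials vanishing on the whole variety.\<close>
  have vanish: "mpol_eval (form_coords ?G b) p = 0"
    if p: "p \<in> mpols_over Qbar (Gal \<times> Gal)" "mpol_eval (form_coords ?G ?b) p = 0"
      and b: "b \<in> sym_forms ?G" for p b
  proof -
    have F: "(\<lambda>y. mpol_eval y p) \<in> polyfun Qbar (Gal \<times> Gal)"
      by (rule mpol_imp_polyfun[OF p(1)]) (auto simp: Qbar_def intro: rat_imp_algebraic)
    obtain \<phi> where \<phi>: "\<And>g. g \<in> Gal \<Longrightarrow> \<phi> (inv\<^bsub>?G\<^esub> g) = \<phi> g" "(\<Sum>g\<in>Gal. \<phi> g) = 0"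
      "\<And>g h. g \<in> Gal \<Longrightarrow> h \<in> Gal \<Longrightarrow> form_coords ?G b (g, h) = \<phi> (inv\<^bsub>?G\<^esub> g \<otimes>\<^bsub>?G\<^esub> h)"
      using Gal.sym_form_coords[OF b] by blast
    have "mpol_eval (\<lambda>(g, h). \<phi> (inv\<^bsub>?G\<^esub> g \<otimes>\<^bsub>?G\<^esub> h)) p = 0"
      by (rule Gal.polyfun_zero_on_gram_imp_zero[OF F _ \<phi>(1,2)])
         (rule polyfun_zero_at_gram_imp_zero[OF assms(1,5) F p(2)])
    moreover have "mpol_eval (form_coords ?G b) p = mpol_eval (\<lambda>(g, h). \<phi> (inv\<^bsub>?G\<^esub> g \<otimes>\<^bsub>?G\<^esub> h)) p"
      by (rule polyfun_cong[OF F]) (auto simp: \<phi>(3))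
    ultimately show ?thesis by simp
  qed
  have "?b \<in> sym_forms ?G"
    by (rule Gal.gram_form_in_sym_forms[OF sum_log_vec[OF assms(5)]])
  moreover have "Z = sym_forms ?G"
    if closed: "zariski_closed_over Qbar (Gal \<times> Gal) (form_coords ?G) (sym_forms ?G) Z" and mem: "?b \<in> Z" for Z
  proof -
    obtain S where S: "S \<subseteq> mpols_over Qbar (Gal \<times> Gal)"
      "Z = {x \<in> sym_forms ?G. \<forall>p\<in>S. mpol_eval (form_coords ?G x) p = 0}"
      using closed unfolding zariski_closed_over_def by blast
    have "mpol_eval (form_coords ?G x) p = 0" if "x \<in> sym_forms ?G" "p \<in> S" for x p
    proof (rule vanish[OF _ _ that(1)])
      show "p \<in> mpols_over Qbar (Gal \<times> Gal)"
        using S(1) that(2) by (rule subsetD)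
      show "mpol_eval (form_coords ?G ?b) p = 0"
        using mem that(2) unfolding S(2) by simp
    qed
    then show ?thesis
      unfolding S(2) by blast
  qed
  ultimately show ?thesis
    unfolding generic_sym_form_def generic_point_def by blast
qed

end
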